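(* Let $E$ be an arbitrary graph, $K$ a field, $L=L_K(E)$ the Leavitt path algebra of $E$ over $K$, and $A=\mathrm{End}(L_L)$ the ring of endomorphisms of $L$ as a right $L$-module. Then the following conditions are equivalent: (i) $A$ is left self-injective. (ii) $L$ is semisimple (as a right $L$-module) and every homogeneous component is an artinian ring; concretely, $L\cong\bigoplus_{i\in\Lambda}\mathbb{M}_{n_i}(K)$ for some index set $\Lambda$, where every $n_i$ is a positive integer (the set of the $n_i$'s might not be bounded). (iii) $E$ is both row-finite and column-finite, is acyclic, and there are no left or right infinite paths in $E$.
   Context: A (directed) graph $E=(E^0,E^1,r,s)$ consists of sets $E^0$ (vertices), $E^1$ (edges) and maps $r,s:E^1\to E^0$. It is row-finite if $s^{-1}(v)$ is finite for every $v\in E^0$, and column-finite if $r^{-1}(v)$ is finite for every $v\in E^0$. A vertex $v$ is regular if $0\neq|s^{-1}(v)|<\infty$. A path is a finite sequence of edges $e_1\cdots e_n$ with $r(e_i)=s(e_{i+1})$. A cycle is a path $e_1\cdots e_n$ ($n\ge1$) with $r(e_n)=s(e_1)$ and $s(e_i)\ne s(e_j)$ for $i\neq j$; $E$ is acyclic if it has no cycles. A right infinite path is $e_1e_2\cdots e_n\cdots$ with $e_i\in E^1$ and $r(e_i)=s(e_{i+1})$ for every $i\ge1$; a left infinite path is $\cdots e_n\cdots e_2e_1$ with $e_i\in E^1$ and $r(e_{i+1})=s(e_i)$ for every $i\ge1$. The Leavitt path algebra $L_K(E)$ is the $K$-algebra generated by a set $\{v: v\in E^0\}$ of pairwise orthogonal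 idempotents together with $\{e,e^*:e\in E^1\}$ subject to: (1) $s(e)e=e=er(e)$; (2) $r(e)e^*=e^*=e^*s(e)$; (3) $e^*e=r(e)$ and $e^*f=0$ for edges $e\ne f$; (4) $v=\sum_{s(e)=v}ee^*$ for every regular vertex $v$. The unital ring $A$ (with product given by composition, $(fg)(x)=f(g(x))$) is left self-injective if it is injective as a left $A$-module. A homogeneous component of a semisimple module is the sum of all simple submodules isomorphic to a given simple submodule; homogeneous components of $L_L$ are two-sided ideals of $L$. $\mathbb{M}_n(K)$ is the algebra of $n\times n$ matrices over $K$; the direct sum is a ring direct sum and the isomorphism is one of $K$-algebras. *)

theory Defs
  imports
    "HOL-Library.Poly_Mapping"
    "HOL-Library.FuncSet"
    "HOL-Algebra.Module"
    "HOL-Algebra.QuotRing"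
    "Graph_Theory.Arc_Walk"
    "Jordan_Normal_Form.Matrix"
begin

section \<open>Graphs\<close>

text \<open>
  A directed graph \<open>(E\<^sup>0, E\<^sup>1, r, s)\<close> is a \<^typ>\<open>('v, 'e) pre_digraph\<close> \<open>E\<close> with
  \<open>wf_digraph E\<close>: the vertices are \<open>verts E\<close>, the edges are \<open>arcs E\<close>, and the source
  and range maps are \<open>tail E\<close> and \<open>head E\<close>, so \<open>out_arcs E v\<close> is the preimage of \<open>v\<close>
  under \<open>s\<close> and \<open>in_arcs E v\<close> its preimage under \<open>r\<close>. Infinite and parallel edges
  and loops are all allowed.
\<close>

definition row_finite :: "('v, 'e) pre_digraph \<Rightarrow> bool" where
  "row_finite E \<longleftrightarrow> (\<forall>v\<in>verts E. finite (out_arcs E v))"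

definition column_finite :: "('v, 'e) pre_digraph \<Rightarrow> bool" where
  "column_finite E \<longleftrightarrow> (\<forall>v\<in>verts E. finite (in_arcs E v))"

definition regular_vertex :: "('v, 'e) pre_digraph \<Rightarrow> 'v \<Rightarrow> bool" where
  "regular_vertex E v \<longleftrightarrow> v \<in> verts E \<and> out_arcs E v \<noteq> {} \<and> finite (out_arcs E v)"

text \<open>
  The library's \<^const>\<open>pre_digraph.cycle\<close> is a nonempty closed walk whose vertices after
  the first one are distinct. Since the walk is closed, these vertices are exactly the
  sources of its edges in cyclically shifted order. Loops count as cycles.
\<close>

definition acyclic_graph :: "('v, 'e) pre_digraph \<Rightarrow> bool" where
  "acyclic_graph E \<longleftrightarrow> (\<nexists>p. pre_digraph.cycle E p)"

definition right_infinite_path :: "('v, 'e) pre_digraph \<Rightarrow> (nat \<Rightarrow> 'e) \<Rightarrow> bool" where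
  "right_infinite_path E p \<longleftrightarrow> (\<forall>i. p i \<in> arcs E \<and> head E (p i) = tail E (p (Suc i)))"

definition left_infinite_path :: "('v, 'e) pre_digraph \<Rightarrow> (nat \<Rightarrow> 'e) \<Rightarrow> bool" where
  "left_infinite_path E p \<longleftrightarrow> (\<forall>i. p i \<in> arcs E \<and> head E (p (Suc i)) = tail E (p i))"


section \<open>Free algebras\<close>

text \<open>
  The free monoid, as a copy of the list type, so that \<open>'g free_word \<Rightarrow>\<^sub>0 'k\<close> with
  the convolution product of \<open>Poly_Mapping\<close> is the free unital algebra on \<open>'g\<close>.
\<close>

datatype 'g free_word = Word (letters: "'g list")

instantiation free_word :: (type) monoid_add
begin

definition zero_free_word :: "'a free_word" where
  "0 = Word []"

definition plus_free_word :: "'a free_word \<Rightarrow> 'a free_word \<Rightarrow> 'a free_word" where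
  "x + y = Word (letters x @ letters y)"

instance
  by standard (simp_all add: zero_free_word_def plus_free_word_def)

end

text \<open>The free unital \<open>'k\<close>-algebra on the set \<open>X\<close>.\<close>

definition free_algebra :: "'k itself \<Rightarrow> 'g set \<Rightarrow> ('g free_word \<Rightarrow>\<^sub>0 'k::field) ring" where
  "free_algebra (_ :: 'k itself) X =
    \<lparr>carrier = {p. \<forall>w\<in>Poly_Mapping.keys p. set (letters w) \<subseteq> X},
     monoid.mult = (*), one = 1, zero = 0, add = (+)\<rparr>"

definition gen :: "'g \<Rightarrow> ('g free_word \<Rightarrow>\<^sub>0 'k::field)" where
  "gen x = Poly_Mapping.single (Word [x]) 1"

definition const :: "'k \<Rightarrow> ('g free_word \<Rightarrow>\<^sub>0 'k::field)" where
  "const c = Poly_Mapping.single 0 c"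


section \<open>Leavitt path algebras\<close>

datatype ('v, 'e) lpa_gen = Vert 'v | Edge 'e | Ghost 'e

definition lpa_gens :: "('v, 'e) pre_digraph \<Rightarrow> ('v, 'e) lpa_gen set" where
  "lpa_gens E = Vert ` verts E \<union> Edge ` arcs E \<union> Ghost ` arcs E"

type_synonym ('v, 'e, 'k) lpa_free = "('v, 'e) lpa_gen free_word \<Rightarrow>\<^sub>0 'k"

text \<open>Each relation \<open>a = b\<close> is recorded as the element \<open>a - b\<close>.\<close>

inductive_set lpa_relations :: "('v, 'e) pre_digraph \<Rightarrow> ('v, 'e, 'k::field) lpa_free set"
  for E :: "('v, 'e) pre_digraph" where
  idem: "v \<in> verts E \<Longrightarrow>
    gen (Vert v) * gen (Vert v) - gen (Vert v) \<in> lpa_relations E"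
| orth: "v \<in> verts E \<Longrightarrow> w \<in> verts E \<Longrightarrow> v \<noteq> w \<Longrightarrow>
    gen (Vert v) * gen (Vert w) \<in> lpa_relations E"
| source_edge: "e \<in> arcs E \<Longrightarrow>
    gen (Vert (tail E e)) * gen (Edge e) - gen (Edge e) \<in> lpa_relations E"
| edge_range: "e \<in> arcs E \<Longrightarrow>
    gen (Edge e) * gen (Vert (head E e)) - gen (Edge e) \<in> lpa_relations E"
| range_ghost: "e \<in> arcs E \<Longrightarrow>
    gen (Vert (head E e)) * gen (Ghost e) - gen (Ghost e) \<in> lpa_relations E"
| ghost_source: "e \<in> arcs E \<Longrightarrow>
    gen (Ghost e) * gen (Vert (tail E e)) - gen (Ghost e) \<in> lpa_relations E"
| ghost_edge: "e \<in> arcs E \<Longrightarrow>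
    gen (Ghost e) * gen (Edge e) - gen (Vert (head E e)) \<in> lpa_relations E"
| ghost_edge_orth: "e \<in> arcs E \<Longrightarrow> f \<in> arcs E \<Longrightarrow> e \<noteq> f \<Longrightarrow>
    gen (Ghost e) * gen (Edge f) \<in> lpa_relations E"
| regular: "regular_vertex E v \<Longrightarrow>
    gen (Vert v) - (\<Sum>e\<in>out_arcs E v. gen (Edge e) * gen (Ghost e)) \<in> lpa_relations E"

definition lpa_ideal :: "('v, 'e) pre_digraph \<Rightarrow> ('v, 'e, 'k::field) lpa_free set" where
  "lpa_ideal E = genideal (free_algebra TYPE('k) (lpa_gens E)) (lpa_relations E)"

text \<open>
  \<open>L\<^sub>K(E)\<close> is in general not unital. The free non-unital algebra on the generators is the
  ideal of the free unital algebra consisting of the elements without constant term. All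
  relations lie in it, so they generate the same ideal in both algebras, and the algebra
  presented by them is the image of that ideal in the quotient of the free unital algebra.

  The scalar multiplication is multiplication by the class of a constant. The field \<open>one\<close>
  of the record is the class of 1, which belongs to the carrier only if it happens to be
  represented without constant term; nothing below refers to it.
\<close>

definition leavitt_path_algebra ::
    "'k itself \<Rightarrow> ('v, 'e) pre_digraph \<Rightarrow> ('k::field, ('v, 'e, 'k) lpa_free set) module" where
  "leavitt_path_algebra (_ :: 'k itself) E =
    (let F = free_algebra TYPE('k) (lpa_gens E); I = lpa_ideal E; Q = F Quot I in
     \<lparr>carrier = (\<lambda>p. I +>\<^bsub>F\<^esub> p) ` {p \<in> carrier F. Poly_Mapping.lookup p 0 = 0},
      monoid.mult = monoid.mult Q, one = one Q, zero = zero Q, add = add Q,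
      smult = (\<lambda>c x. (I +>\<^bsub>F\<^esub> const c) \<otimes>\<^bsub>Q\<^esub> x)\<rparr>)"


section \<open>Modules over noncommutative rings\<close>

text \<open>
  The library's locale \<^locale>\<open>module\<close> requires a commutative ring, so only its record type
  is used. A right module is represented by writing the action on the left: \<open>a \<odot> x\<close> stands
  for \<open>xa\<close>. Submodules (the library's \<^locale>\<open>submodule\<close>, which makes no assumption on the
  ring), homomorphisms, simplicity and so on do not depend on the side, nor on the
  existence of a unit in the ring.
\<close>

definition left_regular :: "('r, 'x) ring_scheme \<Rightarrow> ('r, 'r) module" where
  "left_regular R =
    \<lparr>carrier = carrier R, monoid.mult = monoid.mult R, one = one R, zero = zero R, add = add R,
     smult = (\<lambda>a x. a \<otimes>\<^bsub>R\<^esub> x)\<rparr>"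

definition right_regular :: "('r, 'x) ring_scheme \<Rightarrow> ('r, 'r) module" where
  "right_regular R =
    \<lparr>carrier = carrier R, monoid.mult = monoid.mult R, one = one R, zero = zero R, add = add R,
     smult = (\<lambda>a x. x \<otimes>\<^bsub>R\<^esub> a)\<rparr>"

definition mod_hom ::
    "('r, 'x) ring_scheme \<Rightarrow> ('r, 'm) module \<Rightarrow> ('r, 'n) module \<Rightarrow> ('m \<Rightarrow> 'n) set" where
  "mod_hom R M N =
    {f \<in> carrier M \<rightarrow> carrier N.
      (\<forall>x\<in>carrier M. \<forall>y\<in>carrier M. f (x \<oplus>\<^bsub>M\<^esub> y) = f x \<oplus>\<^bsub>N\<^esub> f y) \<and>
      (\<forall>a\<in>carrier R. \<forall>x\<in>carrier M. f (a \<odot>\<^bsub>M\<^esub> x) = a \<odot>\<^bsub>N\<^esub> f x)}"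

text \<open>Endomorphisms are made extensional so that equality is equality on the carrier.\<close>

definition End_ring :: "('r, 'x) ring_scheme \<Rightarrow> ('r, 'm) module \<Rightarrow> ('m \<Rightarrow> 'm) ring" where
  "End_ring R M =
    \<lparr>carrier = mod_hom R M M \<inter> extensional (carrier M),
     monoid.mult = (\<lambda>f g. \<lambda>x\<in>carrier M. f (g x)),
     one = (\<lambda>x\<in>carrier M. x),
     zero = (\<lambda>x\<in>carrier M. \<zero>\<^bsub>M\<^esub>),
     add = (\<lambda>f g. \<lambda>x\<in>carrier M. f x \<oplus>\<^bsub>M\<^esub> g x)\<rparr>"


subsection \<open>Injectivity\<close>

locale left_module = R?: ring R + M?: abelian_group M
  for R :: "('r, 'x) ring_scheme" (structure) and M :: "('r, 'm) module" (structure) +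
  assumes smult_closed: "a \<in> carrier R \<Longrightarrow> x \<in> carrier M \<Longrightarrow> a \<odot>\<^bsub>M\<^esub> x \<in> carrier M"
    and smult_l_distr: "a \<in> carrier R \<Longrightarrow> b \<in> carrier R \<Longrightarrow> x \<in> carrier M \<Longrightarrow>
      (a \<oplus>\<^bsub>R\<^esub> b) \<odot>\<^bsub>M\<^esub> x = a \<odot>\<^bsub>M\<^esub> x \<oplus>\<^bsub>M\<^esub> b \<odot>\<^bsub>M\<^esub> x"
    and smult_r_distr: "a \<in> carrier R \<Longrightarrow> x \<in> carrier M \<Longrightarrow> y \<in> carrier M \<Longrightarrow>
      a \<odot>\<^bsub>M\<^esub> (x \<oplus>\<^bsub>M\<^esub> y) = a \<odot>\<^bsub>M\<^esub> x \<oplus>\<^bsub>M\<^esub> a \<odot>\<^bsub>M\<^esub> y"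
    and smult_assoc: "a \<in> carrier R \<Longrightarrow> b \<in> carrier R \<Longrightarrow> x \<in> carrier M \<Longrightarrow>
      (a \<otimes>\<^bsub>R\<^esub> b) \<odot>\<^bsub>M\<^esub> x = a \<odot>\<^bsub>M\<^esub> (b \<odot>\<^bsub>M\<^esub> x)"
    and smult_one: "x \<in> carrier M \<Longrightarrow> \<one>\<^bsub>R\<^esub> \<odot>\<^bsub>M\<^esub> x = x"

text \<open>
  \<open>M\<close> is injective: every homomorphism into \<open>M\<close> extends along every monomorphism. As a
  formula cannot quantify over types, the test modules \<open>X\<close> and \<open>Y\<close> range over the modules
  whose elements have the type \<open>'t\<close>, which is a parameter.
\<close>

definition injective_module ::
    "'t itself \<Rightarrow> ('r, 'x) ring_scheme \<Rightarrow> ('r, 'm) module \<Rightarrow> bool" where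
  "injective_module (_ :: 't itself) R M \<longleftrightarrow> left_module R M \<and>
    (\<forall>(X :: ('r, 't) module) (Y :: ('r, 't) module). left_module R X \<longrightarrow> left_module R Y \<longrightarrow>
      (\<forall>i\<in>mod_hom R X Y. inj_on i (carrier X) \<longrightarrow>
        (\<forall>f\<in>mod_hom R X M. \<exists>g\<in>mod_hom R Y M. \<forall>x\<in>carrier X. g (i x) = f x)))"

text \<open>
  Here \<open>'t\<close> is arbitrary, and is enlarged by the element type \<open>'r\<close> of the ring: if \<open>'t\<close> is
  small (say finite), modules over \<open>'t\<close> alone would not suffice to test injectivity.
  With the summand \<open>'r\<close> there is, for every \<open>'t\<close>, an isomorphic copy of every left ideal of
  \<open>R\<close> among the test modules, so by Baer's criterion the notion does not depend on \<open>'t\<close>.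
\<close>

definition left_self_injective :: "'t itself \<Rightarrow> ('r, 'x) ring_scheme \<Rightarrow> bool" where
  "left_self_injective (_ :: 't itself) R \<longleftrightarrow>
    injective_module TYPE('r + 't) R (left_regular R)"


subsection \<open>Semisimple modules and artinian rings\<close>

definition simple_submodule :: "('r, 'x) ring_scheme \<Rightarrow> ('r, 'm) module \<Rightarrow> 'm set \<Rightarrow> bool" where
  "simple_submodule R M S \<longleftrightarrow> submodule S R M \<and> S \<noteq> {\<zero>\<^bsub>M\<^esub>} \<and>
    (\<forall>T. submodule T R M \<longrightarrow> T \<subseteq> S \<longrightarrow> T = {\<zero>\<^bsub>M\<^esub>} \<or> T = S)"

definition isomorphic_submodules ::
    "('r, 'x) ring_scheme \<Rightarrow> ('r, 'm) module \<Rightarrow> 'm set \<Rightarrow> 'm set \<Rightarrow> bool" where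
  "isomorphic_submodules R M S T \<longleftrightarrow>
    (\<exists>f\<in>mod_hom R (M\<lparr>carrier := S\<rparr>) (M\<lparr>carrier := T\<rparr>). bij_betw f S T)"

definition sum_of_submodules :: "('r, 'm) module \<Rightarrow> 'm set set \<Rightarrow> 'm set" where
  "sum_of_submodules M \<S> =
    {\<Oplus>\<^bsub>M\<^esub>S\<in>\<F>. x S | \<F> x. finite \<F> \<and> \<F> \<subseteq> \<S> \<and> (\<forall>S\<in>\<F>. x S \<in> S)}"

definition semisimple_module :: "('r, 'x) ring_scheme \<Rightarrow> ('r, 'm) module \<Rightarrow> bool" where
  "semisimple_module R M \<longleftrightarrow> carrier M = sum_of_submodules M {S. simple_submodule R M S}"

definition homogeneous_component ::
    "('r, 'x) ring_scheme \<Rightarrow> ('r, 'm) module \<Rightarrow> 'm set \<Rightarrow> 'm set" where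
  "homogeneous_component R M S =
    sum_of_submodules M {T. simple_submodule R M T \<and> isomorphic_submodules R M S T}"

definition artinian_module :: "('r, 'x) ring_scheme \<Rightarrow> ('r, 'm) module \<Rightarrow> bool" where
  "artinian_module R M \<longleftrightarrow>
    (\<forall>I :: nat \<Rightarrow> 'm set. (\<forall>n. submodule (I n) R M \<and> I (Suc n) \<subseteq> I n) \<longrightarrow>
      (\<exists>n. \<forall>m\<ge>n. I m = I n))"

text \<open>Descending chain condition on left ideals and on right ideals.\<close>

definition artinian_ring :: "('r, 'x) ring_scheme \<Rightarrow> bool" where
  "artinian_ring R \<longleftrightarrow> artinian_module R (left_regular R) \<and> artinian_module R (right_regular R)"


section \<open>Direct sums and isomorphisms of algebras\<close>

text \<open>
  The algebra of \<open>n \<times> n\<close> matrices over \<open>'k\<close> is \<^term>\<open>module_mat TYPE('k::field) n n\<close>.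
  Like a Leavitt path algebra, an infinite direct sum has no unit, and its \<open>one\<close> is the
  family of units, outside the carrier.
\<close>

definition direct_sum_algebra :: "'i set \<Rightarrow> ('i \<Rightarrow> ('k, 'a) module) \<Rightarrow> ('k, 'i \<Rightarrow> 'a) module" where
  "direct_sum_algebra \<Lambda> B =
    \<lparr>carrier = {x \<in> \<Pi>\<^sub>E i\<in>\<Lambda>. carrier (B i). finite {i\<in>\<Lambda>. x i \<noteq> \<zero>\<^bsub>B i\<^esub>}},
     monoid.mult = (\<lambda>x y. \<lambda>i\<in>\<Lambda>. x i \<otimes>\<^bsub>B i\<^esub> y i),
     one = (\<lambda>i\<in>\<Lambda>. \<one>\<^bsub>B i\<^esub>),
     zero = (\<lambda>i\<in>\<Lambda>. \<zero>\<^bsub>B i\<^esub>),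
     add = (\<lambda>x y. \<lambda>i\<in>\<Lambda>. x i \<oplus>\<^bsub>B i\<^esub> y i),
     smult = (\<lambda>c x. \<lambda>i\<in>\<Lambda>. c \<odot>\<^bsub>B i\<^esub> x i)\<rparr>"

text \<open>Isomorphism of \<open>'k\<close>-algebras, not required to be unital.\<close>

definition isomorphic_algebras :: "('k::field, 'a) module \<Rightarrow> ('k, 'b) module \<Rightarrow> bool" where
  "isomorphic_algebras B C \<longleftrightarrow>
    (\<exists>f. bij_betw f (carrier B) (carrier C) \<and>
      (\<forall>x\<in>carrier B. \<forall>y\<in>carrier B. f (x \<oplus>\<^bsub>B\<^esub> y) = f x \<oplus>\<^bsub>C\<^esub> f y) \<and>
      (\<forall>x\<in>carrier B. \<forall>y\<in>carrier B. f (x \<otimes>\<^bsub>B\<^esub> y) = f x \<otimes>\<^bsub>C\<^esub> f y) \<and>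
      (\<forall>c. \<forall>x\<in>carrier B. f (c \<odot>\<^bsub>B\<^esub> x) = c \<odot>\<^bsub>C\<^esub> f x))"

text \<open>
  \<open>B\<close> is isomorphic to a direct sum of matrix algebras of positive finite sizes. There is
  no loss of generality in taking the index set among the elements of \<open>B\<close>: the summands are
  nonzero, so any index set of such a decomposition embeds into \<open>B\<close>.
\<close>

definition direct_sum_of_matrix_algebras :: "('k::field, 'a) module \<Rightarrow> bool" where
  "direct_sum_of_matrix_algebras B \<longleftrightarrow>
    (\<exists>(\<Lambda> :: 'a set) n. (\<forall>i\<in>\<Lambda>. 0 < n i) \<and>
      isomorphic_algebras B (direct_sum_algebra \<Lambda> (\<lambda>i. module_mat TYPE('k) (n i) (n i))))"

end

(*
  The conditions on the ring L are linked to the graph by two solvability properties of L: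
  (1) for orthogonal idempotents e_0, e_1, ..., elements y_i of e_i L and u in L there is
  z in L with e_i z = y_i u for all i; (2) if v is idempotent, a lies in vLv and x a = 0
  implies x v = 0, then a z = v for some z. Both follow from self-injectivity of End(L_L),
  because the solution is obtained by extending a homomorphism on a left ideal, and from
  semisimplicity with artinian homogeneous components. Applied to vertices, to the
  idempotents f f^* for edges f, and to a = v - c for a cycle c at v, they force the
  conditions on the graph. Under these conditions the elements p q^* for paths p, q that
  end in the same sink are matrix units that span L, so that L is a direct sum of finite
  matrix algebras. For such an L, the ring End(L_L) consists of all block matrices, and a
  homomorphism into it can be extended column by column, by extending linear functionals
  over K.
*)
theory Submission
  imports Defs
begin

section \<open>Rings without unit and their one-sided ideals\<close>

text \<open>L has a unit only if E has finitely many vertices, so ideals, simplicity and matrix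
  coordinates are developed for rings without unit. An extended homomorphism yields an endomorphism
  of L, not an element; this explains the factor u in property (1). Isolating the two properties
  lets one argument serve both (i) and (ii). Why a solution z contradicts the graph: elements of L
  are finite combinations of monomials p q^*. So z is touched from the left by finitely many
  vertices only, and for the edges f leaving one vertex, f^* z f is the same multiple of the range
  of f for almost all f. Infinitely many vertices joined to one, or right-hand sides alternating
  between f f^* and 0, violate this. In the converse the decisive finiteness is that of a block, the
  set of paths ending in one sink: it makes A the full product of the matrix rings of the blocks,
  and a homomorphism into A the same as a family of K-linear functionals, one for each column. The
  relations do not show by themselves that vertices are nonzero; an explicit module does.\<close>

locale nonunital_ring = abelian_group R for R (structure) +
  assumes m_closed [simp, intro]: "x \<in> carrier R \<Longrightarrow> y \<in> carrier R \<Longrightarrow> x \<otimes> y \<in> carrier R"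
    and m_assoc: "x \<in> carrier R \<Longrightarrow> y \<in> carrier R \<Longrightarrow> z \<in> carrier R \<Longrightarrow>
      (x \<otimes> y) \<otimes> z = x \<otimes> (y \<otimes> z)"
    and l_distr: "x \<in> carrier R \<Longrightarrow> y \<in> carrier R \<Longrightarrow> z \<in> carrier R \<Longrightarrow>
      (x \<oplus> y) \<otimes> z = x \<otimes> z \<oplus> y \<otimes> z"
    and r_distr: "x \<in> carrier R \<Longrightarrow> y \<in> carrier R \<Longrightarrow> z \<in> carrier R \<Longrightarrow>
      z \<otimes> (x \<oplus> y) = z \<otimes> x \<oplus> z \<otimes> y"
begin

lemma l_null [simp]: "x \<in> carrier R \<Longrightarrow> \<zero> \<otimes> x = \<zero>"
  by (metis add.r_cancel_one l_distr l_zero m_closed zero_closed)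

lemma r_null [simp]: "x \<in> carrier R \<Longrightarrow> x \<otimes> \<zero> = \<zero>"
  by (metis add.r_cancel_one r_distr l_zero m_closed zero_closed)

lemma l_minus: "x \<in> carrier R \<Longrightarrow> y \<in> carrier R \<Longrightarrow> \<ominus> x \<otimes> y = \<ominus> (x \<otimes> y)"
  using l_distr[of "\<ominus> x" x y] by (simp add: l_neg minus_equality)

lemma r_minus: "x \<in> carrier R \<Longrightarrow> y \<in> carrier R \<Longrightarrow> x \<otimes> \<ominus> y = \<ominus> (x \<otimes> y)"
  using r_distr[of "\<ominus> y" y x] by (simp add: l_neg minus_equality)

lemma l_diff_distr:
  "x \<in> carrier R \<Longrightarrow> y \<in> carrier R \<Longrightarrow> z \<in> carrier R \<Longrightarrow> (x \<ominus> y) \<otimes> z = x \<otimes> z \<ominus> y \<otimes> z"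
  by (simp add: a_minus_def l_distr l_minus)

lemma r_diff_distr:
  "x \<in> carrier R \<Longrightarrow> y \<in> carrier R \<Longrightarrow> z \<in> carrier R \<Longrightarrow> z \<otimes> (x \<ominus> y) = z \<otimes> x \<ominus> z \<otimes> y"
  by (simp add: a_minus_def r_distr r_minus)

lemma diff_eq_zero_iff: "x \<in> carrier R \<Longrightarrow> y \<in> carrier R \<Longrightarrow> x \<ominus> y = \<zero> \<longleftrightarrow> x = y"
  by (metis a_minus_def add.inv_closed minus_equality minus_minus r_neg)

lemma finsum_r_distr:
  "finite S \<Longrightarrow> f \<in> S \<rightarrow> carrier R \<Longrightarrow> a \<in> carrier R \<Longrightarrow>
    a \<otimes> (\<Oplus>i\<in>S. f i) = (\<Oplus>i\<in>S. a \<otimes> f i)"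
  by (induction S rule: finite_induct) (auto simp: r_distr Pi_def)

lemma finsum_l_distr:
  "finite S \<Longrightarrow> f \<in> S \<rightarrow> carrier R \<Longrightarrow> a \<in> carrier R \<Longrightarrow>
    (\<Oplus>i\<in>S. f i) \<otimes> a = (\<Oplus>i\<in>S. f i \<otimes> a)"
  by (induction S rule: finite_induct) (auto simp: l_distr Pi_def)

end

lemma submodule_iff:
  fixes G :: "('r, 'm) module" (structure)
  assumes "abelian_group G"
  shows "submodule H R G \<longleftrightarrow> H \<subseteq> carrier G \<and> \<zero> \<in> H \<and> (\<forall>x\<in>H. \<forall>y\<in>H. x \<oplus> y \<in> H) \<and>
    (\<forall>x\<in>H. \<ominus> x \<in> H) \<and> (\<forall>a\<in>carrier R. \<forall>x\<in>H. a \<odot>\<^bsub>G\<^esub> x \<in> H)"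
proof -
  interpret abelian_group G by fact
  show ?thesis
    unfolding submodule_def submodule_axioms_def subgroup_def by (auto simp: a_inv_def)
qed

lemma regular_simps [simp]:
  "carrier (left_regular R) = carrier R" "zero (left_regular R) = zero R"
  "add (left_regular R) = add R" "smult (left_regular R) = monoid.mult R"
  "carrier (right_regular R) = carrier R" "zero (right_regular R) = zero R"
  "add (right_regular R) = add R" "smult (right_regular R) = (\<lambda>a x. x \<otimes>\<^bsub>R\<^esub> a)"
  "a_inv (left_regular R) = a_inv R" "a_inv (right_regular R) = a_inv R"
  "finsum (left_regular R) = finsum R" "finsum (right_regular R) = finsum R"
  by (auto simp: left_regular_def right_regular_def a_inv_def[abs_def] finsum_def[abs_def]
    m_inv_def[abs_def] finprod_def[abs_def] fun_eq_iff)

lemma abelian_group_cong: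
  assumes "abelian_group R" "carrier S = carrier R" "add S = add R" "zero S = zero R"
  shows "abelian_group S"
proof -
  interpret abelian_group R by fact
  show ?thesis
  proof (rule abelian_groupI)
    show "\<exists>y\<in>carrier S. y \<oplus>\<^bsub>S\<^esub> x = \<zero>\<^bsub>S\<^esub>" if "x \<in> carrier S" for x
      using that l_neg by (auto simp: assms(2-4))
  qed (auto simp: assms(2-4) a_ac)
qed

context nonunital_ring
begin

lemma abelian_group_regular:
  "abelian_group (left_regular R)" "abelian_group (right_regular R)"
  by (rule abelian_group_cong[OF abelian_group_axioms]; simp)+

definition right_ideal :: "'a set \<Rightarrow> bool" where
  "right_ideal I \<longleftrightarrow> submodule I R (right_regular R)"

lemma right_ideal_iff:
  "right_ideal I \<longleftrightarrow> I \<subseteq> carrier R \<and> \<zero> \<in> I \<and> (\<forall>x\<in>I. \<forall>y\<in>I. x \<oplus> y \<in> I) \<and>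
    (\<forall>x\<in>I. \<ominus> x \<in> I) \<and> (\<forall>a\<in>carrier R. \<forall>x\<in>I. x \<otimes> a \<in> I)"
  unfolding right_ideal_def submodule_iff[OF abelian_group_regular(2)] by simp

lemma left_submodule_iff:
  "submodule I R (left_regular R) \<longleftrightarrow> I \<subseteq> carrier R \<and> \<zero> \<in> I \<and> (\<forall>x\<in>I. \<forall>y\<in>I. x \<oplus> y \<in> I) \<and>
    (\<forall>x\<in>I. \<ominus> x \<in> I) \<and> (\<forall>a\<in>carrier R. \<forall>x\<in>I. a \<otimes> x \<in> I)"
  unfolding submodule_iff[OF abelian_group_regular(1)] by simp

end

lemma (in ring) nonunital_ring: "nonunital_ring R"
  by unfold_locales (simp_all add: m_assoc l_distr r_distr)

section \<open>Self-injectivity\<close>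

lemma left_self_injective_ring: "left_self_injective TYPE('t) R \<Longrightarrow> ring R"
  by (simp add: left_self_injective_def injective_module_def left_module_def)

text \<open>Test modules are taken inside the summand \<open>'r\<close> of the type \<open>'r + 't\<close>.\<close>

lemma left_self_injective_extend:
  fixes R :: "('r, 'x) ring_scheme" (structure)
  assumes inj: "left_self_injective TYPE('t) R"
    and I: "submodule I R (left_regular R)"
    and \<phi>: "\<phi> \<in> I \<rightarrow> carrier R"
    and \<phi>_add: "\<And>x y. x \<in> I \<Longrightarrow> y \<in> I \<Longrightarrow> \<phi> (x \<oplus> y) = \<phi> x \<oplus> \<phi> y"
    and \<phi>_mult: "\<And>a x. a \<in> carrier R \<Longrightarrow> x \<in> I \<Longrightarrow> \<phi> (a \<otimes> x) = a \<otimes> \<phi> x"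
  shows "\<exists>g\<in>carrier R. \<forall>x\<in>I. \<phi> x = x \<otimes> g"
proof -
  interpret ring R using inj by (rule left_self_injective_ring)
  interpret nonunital_ring R by (rule nonunital_ring)
  \<comment> \<open>A test module only needs its additive group and its scalar action, so the other
    record fields stay undefined. Tagging with \<open>Inl\<close> moves a left ideal into the type
    of test elements.\<close>
  define copy :: "'r set \<Rightarrow> ('r, 'r + 't) module" where
    "copy H = \<lparr>carrier = Inl ` H, monoid.mult = undefined, one = undefined, zero = Inl \<zero>,
      add = (\<lambda>a b. Inl (projl a \<oplus> projl b)), smult = (\<lambda>r a. Inl (r \<otimes> projl a))\<rparr>" for H
  have copy: "left_module R (copy H)" if "submodule H R (left_regular R)" for H
  proof -
    have H: "H \<subseteq> carrier R" "\<zero> \<in> H" "\<And>x y. x \<in> H \<Longrightarrow> y \<in> H \<Longrightarrow> x \<oplus> y \<in> H"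
      "\<And>x. x \<in> H \<Longrightarrow> \<ominus> x \<in> H" "\<And>a x. a \<in> carrier R \<Longrightarrow> x \<in> H \<Longrightarrow> a \<otimes> x \<in> H"
      using that by (auto simp: left_submodule_iff)
    have "abelian_group (copy H)"
    proof (rule abelian_groupI)
      fix x assume "x \<in> carrier (copy H)"
      then obtain h where "h \<in> H" "x = Inl h" by (auto simp: copy_def)
      then show "\<exists>y\<in>carrier (copy H). y \<oplus>\<^bsub>copy H\<^esub> x = \<zero>\<^bsub>copy H\<^esub>"
        using H by (intro bexI[of _ "Inl (\<ominus> h)"]) (auto simp: copy_def l_neg subsetD)
    qed (use H in \<open>auto simp: copy_def a_ac subsetD\<close>)
    then show ?thesis
      unfolding left_module_def left_module_axioms_def
      using H ring_axioms by (auto simp: copy_def subsetD l_distr r_distr m_assoc)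
  qed
  have IR: "I \<subseteq> carrier R" using I by (simp add: left_submodule_iff)
  have R: "submodule (carrier R) R (left_regular R)"
    by (simp add: left_submodule_iff)
  let ?X = "copy I" and ?Y = "copy (carrier R)"
  have i: "(\<lambda>x. x) \<in> mod_hom R ?X ?Y"
    using IR by (auto simp: mod_hom_def copy_def)
  have f: "(\<lambda>x. \<phi> (projl x)) \<in> mod_hom R ?X (left_regular R)"
    using \<phi> by (auto simp: mod_hom_def copy_def \<phi>_add \<phi>_mult)
  have "inj_on (\<lambda>x. x) (carrier ?X)" by simp
  from inj[unfolded left_self_injective_def injective_module_def, THEN conjunct2,
      rule_format, OF copy[OF I] copy[OF R] i this f]
  obtain g where g: "g \<in> mod_hom R ?Y (left_regular R)"
    and gf: "\<And>x. x \<in> carrier ?X \<Longrightarrow> g x = \<phi> (projl x)" by auto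
  \<comment> \<open>Baer's criterion read backwards: the extension lives on all of R, hence is right
    multiplication by its value at \<open>\<one>\<close>.\<close>
  have "\<phi> x = x \<otimes> g (Inl \<one>)" if "x \<in> I" for x
  proof -
    have "\<forall>a\<in>carrier R. \<forall>y\<in>carrier R. g (Inl (a \<otimes> y)) = a \<otimes> g (Inl y)"
      using g by (auto simp: mod_hom_def copy_def)
    then have "g (Inl (x \<otimes> \<one>)) = x \<otimes> g (Inl \<one>)" using that IR by blast
    then show ?thesis using gf[of "Inl x"] that IR by (auto simp: copy_def subsetD)
  qed
  moreover have "g (Inl \<one>) \<in> carrier R"
    using g by (auto simp: mod_hom_def copy_def)
  ultimately show ?thesis by blast
qed

section \<open>Two solvability properties\<close>

context nonunital_ring
begin

section \<open>Endomorphisms of the right regular module and the ring they form\<close>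

definition left_mult :: "'a \<Rightarrow> 'a \<Rightarrow> 'a" where
  "left_mult a = (\<lambda>x\<in>carrier R. a \<otimes> x)"

abbreviation End_right :: "('a \<Rightarrow> 'a) ring" where
  "End_right \<equiv> End_ring R (right_regular R)"

lemma End_right_iff:
  "F \<in> carrier End_right \<longleftrightarrow> F \<in> carrier R \<rightarrow> carrier R \<and> F \<in> extensional (carrier R) \<and>
    (\<forall>x\<in>carrier R. \<forall>y\<in>carrier R. F (x \<oplus> y) = F x \<oplus> F y) \<and>
    (\<forall>x\<in>carrier R. \<forall>a\<in>carrier R. F (x \<otimes> a) = F x \<otimes> a)"
  by (auto simp: End_ring_def mod_hom_def)

lemma End_rightD:
  assumes "F \<in> carrier End_right"
  shows "\<And>x. x \<in> carrier R \<Longrightarrow> F x \<in> carrier R"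
    and "\<And>x y. x \<in> carrier R \<Longrightarrow> y \<in> carrier R \<Longrightarrow> F (x \<oplus> y) = F x \<oplus> F y"
    and "\<And>x a. x \<in> carrier R \<Longrightarrow> a \<in> carrier R \<Longrightarrow> F (x \<otimes> a) = F x \<otimes> a"
    and "F \<zero> = \<zero>" and "\<And>x. x \<in> carrier R \<Longrightarrow> F (\<ominus> x) = \<ominus> F x"
    and "F \<in> extensional (carrier R)"
proof -
  note F = assms[unfolded End_right_iff]
  show *: "\<And>x. x \<in> carrier R \<Longrightarrow> F x \<in> carrier R"
    and a: "\<And>x y. x \<in> carrier R \<Longrightarrow> y \<in> carrier R \<Longrightarrow> F (x \<oplus> y) = F x \<oplus> F y"
    and m: "\<And>x a. x \<in> carrier R \<Longrightarrow> a \<in> carrier R \<Longrightarrow> F (x \<otimes> a) = F x \<otimes> a"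
    and "F \<in> extensional (carrier R)"
    using F by auto
  show z: "F \<zero> = \<zero>" using m[of \<zero> \<zero>] * by simp
  show "F (\<ominus> x) = \<ominus> F x" if "x \<in> carrier R" for x
    using a[of "\<ominus> x" x] * that z by (simp add: l_neg minus_equality)
qed

lemma End_right_eqI:
  assumes "F \<in> carrier End_right" "G \<in> carrier End_right" "\<And>x. x \<in> carrier R \<Longrightarrow> F x = G x"
  shows "F = G"
  using assms by (auto simp: End_right_iff intro: extensionalityI)

lemma End_right_simps:
  "x \<in> carrier R \<Longrightarrow> (F \<otimes>\<^bsub>End_right\<^esub> G) x = F (G x)"
  "x \<in> carrier R \<Longrightarrow> (F \<oplus>\<^bsub>End_right\<^esub> G) x = F x \<oplus> G x"
  "x \<in> carrier R \<Longrightarrow> \<one>\<^bsub>End_right\<^esub> x = x"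
  "x \<in> carrier R \<Longrightarrow> \<zero>\<^bsub>End_right\<^esub> x = \<zero>"
  by (auto simp: End_ring_def)

lemma End_right_closed:
  assumes "F \<in> carrier End_right" "G \<in> carrier End_right"
  shows "F \<otimes>\<^bsub>End_right\<^esub> G \<in> carrier End_right"
    and "F \<oplus>\<^bsub>End_right\<^esub> G \<in> carrier End_right"
proof -
  note F = End_rightD[OF assms(1)] and G = End_rightD[OF assms(2)]
  show "F \<otimes>\<^bsub>End_right\<^esub> G \<in> carrier End_right"
    unfolding End_right_iff using F G by (auto simp: End_right_simps, simp add: End_ring_def)
  show "F \<oplus>\<^bsub>End_right\<^esub> G \<in> carrier End_right"
    unfolding End_right_iff using F G
    by (auto simp: End_right_simps a_ac l_distr, simp add: End_ring_def)
qed

lemma ring_End_right: "ring End_right"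
proof (rule ringI)
  note D = End_rightD(1)
  show "abelian_group End_right"
  proof (rule abelian_groupI)
    show z: "\<zero>\<^bsub>End_right\<^esub> \<in> carrier End_right"
      by (auto simp: End_ring_def mod_hom_def)
    fix F assume F: "F \<in> carrier End_right"
    note F' = End_rightD[OF F]
    define G where "G = (\<lambda>x\<in>carrier R. \<ominus> F x)"
    have G: "G \<in> carrier End_right"
      using F' by (auto simp: End_right_iff G_def l_minus minus_add a_comm)
    show "\<exists>G\<in>carrier End_right. G \<oplus>\<^bsub>End_right\<^esub> F = \<zero>\<^bsub>End_right\<^esub>"
      using F' by (intro bexI[OF _ G] End_right_eqI[OF End_right_closed(2)[OF G F] z])
        (simp add: End_right_simps G_def l_neg)
    show "\<zero>\<^bsub>End_right\<^esub> \<oplus>\<^bsub>End_right\<^esub> F = F"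
      using F' by (intro End_right_eqI[OF End_right_closed(2)[OF z F] F])
        (simp add: End_right_simps)
  next
    fix F G assume FG: "F \<in> carrier End_right" "G \<in> carrier End_right"
    then show "F \<oplus>\<^bsub>End_right\<^esub> G = G \<oplus>\<^bsub>End_right\<^esub> F"
      by (intro End_right_eqI) (auto simp: End_right_closed End_right_simps a_comm D)
    fix H assume "H \<in> carrier End_right"
    with FG show "F \<oplus>\<^bsub>End_right\<^esub> G \<oplus>\<^bsub>End_right\<^esub> H = F \<oplus>\<^bsub>End_right\<^esub> (G \<oplus>\<^bsub>End_right\<^esub> H)"
      by (intro End_right_eqI) (auto simp: End_right_closed End_right_simps a_assoc D)
  qed (auto simp: End_right_closed)
  have one: "\<one>\<^bsub>End_right\<^esub> \<in> carrier End_right"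
    by (auto simp: End_ring_def mod_hom_def)
  show "monoid End_right"
  proof (rule monoidI)
    fix F assume F: "F \<in> carrier End_right"
    show "\<one>\<^bsub>End_right\<^esub> \<otimes>\<^bsub>End_right\<^esub> F = F" "F \<otimes>\<^bsub>End_right\<^esub> \<one>\<^bsub>End_right\<^esub> = F"
      using F one by (intro End_right_eqI; auto simp: End_right_closed End_right_simps D)+
    fix G H assume "G \<in> carrier End_right" "H \<in> carrier End_right"
    with F show "F \<otimes>\<^bsub>End_right\<^esub> G \<otimes>\<^bsub>End_right\<^esub> H = F \<otimes>\<^bsub>End_right\<^esub> (G \<otimes>\<^bsub>End_right\<^esub> H)"
      by (intro End_right_eqI) (auto simp: End_right_closed End_right_simps D)
  qed (auto simp: End_right_closed one)
  fix F G H assume "F \<in> carrier End_right" "G \<in> carrier End_right" "H \<in> carrier End_right"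
  then show "(F \<oplus>\<^bsub>End_right\<^esub> G) \<otimes>\<^bsub>End_right\<^esub> H =
      F \<otimes>\<^bsub>End_right\<^esub> H \<oplus>\<^bsub>End_right\<^esub> G \<otimes>\<^bsub>End_right\<^esub> H"
    "H \<otimes>\<^bsub>End_right\<^esub> (F \<oplus>\<^bsub>End_right\<^esub> G) =
      H \<otimes>\<^bsub>End_right\<^esub> F \<oplus>\<^bsub>End_right\<^esub> H \<otimes>\<^bsub>End_right\<^esub> G"
    by (intro End_right_eqI; auto simp: End_right_closed End_right_simps D End_rightD(2))+
qed

lemma left_mult_End: "a \<in> carrier R \<Longrightarrow> left_mult a \<in> carrier End_right"
  by (auto simp: End_right_iff left_mult_def r_distr m_assoc)

text \<open>Zero and additive inverses come for free: the endomorphism ring is unital even if R is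
  not, so they arise by multiplying with its zero and with minus its identity.\<close>

lemma End_left_submoduleI:
  assumes "I \<subseteq> carrier End_right" "I \<noteq> {}"
    and "\<And>F G. F \<in> I \<Longrightarrow> G \<in> I \<Longrightarrow> F \<oplus>\<^bsub>End_right\<^esub> G \<in> I"
    and "\<And>F G. F \<in> I \<Longrightarrow> G \<in> carrier End_right \<Longrightarrow> G \<otimes>\<^bsub>End_right\<^esub> F \<in> I"
  shows "submodule I End_right (left_regular End_right)"
proof -
  interpret A: ring End_right by (rule ring_End_right)
  interpret A: nonunital_ring End_right by (rule A.nonunital_ring)
  obtain F where F: "F \<in> I" using assms(2) by blast
  have "\<zero>\<^bsub>End_right\<^esub> \<in> I"
    using assms(4)[OF F A.zero_closed] F assms(1) by auto
  moreover have "\<ominus>\<^bsub>End_right\<^esub> G \<in> I" if "G \<in> I" for G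
  proof -
    have "\<ominus>\<^bsub>End_right\<^esub> \<one>\<^bsub>End_right\<^esub> \<otimes>\<^bsub>End_right\<^esub> G = \<ominus>\<^bsub>End_right\<^esub> G"
      using that assms(1) by (simp add: A.l_minus subset_iff)
    then show ?thesis using assms(4)[OF that, of "\<ominus>\<^bsub>End_right\<^esub> \<one>\<^bsub>End_right\<^esub>"] by simp
  qed
  ultimately show ?thesis using assms by (auto simp: A.left_submodule_iff)
qed

text \<open>Formally a solution is the infinite sum of all \<open>y i \<otimes> u\<close>. The
  factor \<open>u\<close> makes up for the absence of a unit: self-injectivity supplies an
  endomorphism, and only its values lie in R.\<close>

definition orthogonal_solvable :: bool where
  "orthogonal_solvable \<longleftrightarrow> (\<forall>e y u.
    (\<forall>i::nat. e i \<in> carrier R \<and> y i \<in> carrier R \<and> e i \<otimes> y i = y i) \<longrightarrow>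
    (\<forall>i j. e i \<otimes> e j = (if i = j then e i else \<zero>)) \<longrightarrow> u \<in> carrier R \<longrightarrow>
    (\<exists>z\<in>carrier R. \<forall>i. e i \<otimes> z = y i \<otimes> u))"

text \<open>In the corner with unit \<open>v\<close>: if right multiplication by \<open>a\<close> is
  injective on R v, then \<open>a\<close> has a right inverse. The polynomial ring K[x] violates
  this with 1 - x, and a closed path will imitate that.\<close>

definition corner_solvable :: bool where
  "corner_solvable \<longleftrightarrow> (\<forall>v\<in>carrier R. \<forall>a\<in>carrier R. v \<otimes> v = v \<longrightarrow> v \<otimes> a = a \<longrightarrow> a \<otimes> v = a \<longrightarrow>
    (\<forall>x\<in>carrier R. x \<otimes> a = \<zero> \<longrightarrow> x \<otimes> v = \<zero>) \<longrightarrow> (\<exists>z\<in>carrier R. a \<otimes> z = v))"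

text \<open>
  Both properties come from extending a homomorphism on a left ideal of the endomorphism
  ring, which then is right multiplication by some \<open>g\<close>. For the first property it
  sends \<open>left_mult (e i)\<close> to \<open>left_mult (y i)\<close> and \<open>z = g u\<close>; for the second it sends
  \<open>left_mult a\<close> to \<open>left_mult v\<close> and \<open>z = g v\<close>.
\<close>

lemma self_injective_imp_orthogonal_solvable:
  assumes inj: "left_self_injective TYPE('t) End_right"
  shows orthogonal_solvable
  unfolding orthogonal_solvable_def
proof (intro allI impI)
  fix e y :: "nat \<Rightarrow> 'a" and u
  assume "\<forall>i. e i \<in> carrier R \<and> y i \<in> carrier R \<and> e i \<otimes> y i = y i"
    and ee: "\<forall>i j. e i \<otimes> e j = (if i = j then e i else \<zero>)" and u: "u \<in> carrier R"
  then have e: "e i \<in> carrier R" and y: "y i \<in> carrier R" and ey: "e i \<otimes> y i = y i" for i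
    by auto
  \<comment> \<open>Sums over the indices below n. The \<open>es n\<close> are idempotents growing
    with n, so the left multiples of the \<open>left_mult (es n)\<close> form an increasing chain
    whose union is the left ideal generated by all \<open>left_mult (e i)\<close>.\<close>
  define es where "es = rec_nat \<zero> (\<lambda>n s. s \<oplus> e n)"
  define ys where "ys = rec_nat \<zero> (\<lambda>n s. s \<oplus> y n)"
  have es_simps: "es 0 = \<zero>" "es (Suc n) = es n \<oplus> e n" for n by (simp_all add: es_def)
  have ys_simps: "ys 0 = \<zero>" "ys (Suc n) = ys n \<oplus> y n" for n by (simp_all add: ys_def)
  have es: "es n \<in> carrier R" for n by (induction n) (simp_all add: es_simps e)
  have ys: "ys n \<in> carrier R" for n by (induction n) (simp_all add: ys_simps y)
  have ey': "e i \<otimes> y j = (if i = j then y i else \<zero>)" for i j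
    using ee ey e y m_assoc[of "e i" "e j" "y j"] by (cases "i = j") auto
  have eys: "e i \<otimes> ys n = (if i < n then y i else \<zero>)" for i n
    by (induction n) (auto simp: ys_simps r_distr e y ys ey' less_Suc_eq)
  have ees: "e i \<otimes> es n = (if i < n then e i else \<zero>)" for i n
    by (induction n) (use ee in \<open>auto simp: es_simps r_distr e es less_Suc_eq\<close>)
  have es_y: "es n \<otimes> y i = (if i < n then y i else \<zero>)" for i n
    by (induction n) (auto simp: es_simps l_distr e y es ey' less_Suc_eq)
  have es_e: "es n \<otimes> e i = (if i < n then e i else \<zero>)" for i n
    by (induction n) (use ee in \<open>auto simp: es_simps l_distr e es less_Suc_eq\<close>)
  \<comment> \<open>If F factors through \<open>es n\<close> and n \<le> N, then F (ys N x) = F (es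
    n ys N x) = F (ys n x). Hence the value assigned to F below does not depend on the
    bound.\<close>
  have es_ys: "n \<le> N \<Longrightarrow> es n \<otimes> ys N = ys n" for n N
  proof (induction N rule: dec_induct)
    case base
    have "m \<le> n \<Longrightarrow> es n \<otimes> ys m = ys m" for m
      by (induction m) (simp_all add: ys_simps r_distr ys es es_y y)
    then show ?case by simp
  qed (simp_all add: ys_simps r_distr ys es es_y y)
  have es_es: "n \<le> N \<Longrightarrow> es n \<otimes> es N = es n" for n N
  proof (induction N rule: dec_induct)
    case base
    have "m \<le> n \<Longrightarrow> es n \<otimes> es m = es m" for m
      by (induction m) (simp_all add: es_simps r_distr es es es_e e)
    then show ?case by simp
  qed (simp_all add: es_simps r_distr es es es_e e)
  \<comment> \<open>\<open>W F n\<close> says that F equals F after \<open>left_mult (es n)\<close>;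
    the homomorphism will send such an F to F after \<open>left_mult (ys n)\<close>.\<close>
  define W where "W F n \<longleftrightarrow> (\<forall>x\<in>carrier R. F (es n \<otimes> x) = F x)" for F :: "'a \<Rightarrow> 'a" and n
  have W_mono: "W F N" if "W F n" "n \<le> N" for F n N
  proof -
    have "F (es N \<otimes> x) = F (es n \<otimes> (es N \<otimes> x))" if "x \<in> carrier R" for x
      using \<open>W F n\<close> that es by (simp add: W_def)
    then show ?thesis using that es es_es[OF that(2)]
      by (simp add: W_def m_assoc[symmetric])
  qed
  define I where "I = {F \<in> carrier End_right. \<exists>n. W F n}"
  define \<phi> where "\<phi> F = (\<lambda>x\<in>carrier R. F (ys (SOME n. W F n) \<otimes> x))" for F
  have \<phi>: "\<phi> F = (\<lambda>x\<in>carrier R. F (ys n \<otimes> x))" if "W F n" for F n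
  proof -
    have *: "F (ys N \<otimes> x) = F (ys n \<otimes> x)" if "W F n" "n \<le> N" "x \<in> carrier R" for n N x
      using that es es_ys[OF that(2)] ys unfolding W_def
      by (metis m_assoc m_closed)
    have "W F (SOME n. W F n)" using that by (rule someI)
    with that show ?thesis unfolding \<phi>_def
      by (intro restrict_ext) (metis * nat_le_linear)
  qed
  have I: "submodule I End_right (left_regular End_right)"
  proof (rule End_left_submoduleI)
    have "W (left_mult \<zero>) 0" using es by (simp add: W_def left_mult_def)
    then show "I \<noteq> {}" using left_mult_End[of \<zero>] by (auto simp: I_def)
    fix F G assume F: "F \<in> I"
    then obtain n where n: "W F n" and FA: "F \<in> carrier End_right" by (auto simp: I_def)
    show "G \<otimes>\<^bsub>End_right\<^esub> F \<in> I" if "G \<in> carrier End_right"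
      using n FA that es
      by (auto simp: I_def W_def End_right_closed End_right_simps intro!: exI[of _ n])
    show "F \<oplus>\<^bsub>End_right\<^esub> G \<in> I" if GI: "G \<in> I"
    proof -
      obtain m where m: "W G m" and GA: "G \<in> carrier End_right" using GI by (auto simp: I_def)
      have "W F (max n m)" "W G (max n m)" using W_mono n m by auto
      then show ?thesis using FA GA es unfolding I_def W_def
        by (auto simp: End_right_closed End_right_simps intro!: exI[of _ "max n m"])
    qed
  qed (auto simp: I_def)
  have \<phi>_closed: "\<phi> F \<in> carrier End_right" if FI: "F \<in> I" for F
  proof -
    obtain n where n: "W F n" and FA: "F \<in> carrier End_right" using FI by (auto simp: I_def)
    show ?thesis unfolding \<phi>[OF n]
      using End_rightD[OF FA] ys by (auto simp: End_right_iff r_distr m_assoc[symmetric])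
  qed
  have "\<exists>g\<in>carrier End_right. \<forall>F\<in>I. \<phi> F = F \<otimes>\<^bsub>End_right\<^esub> g"
  proof (rule left_self_injective_extend[OF inj I])
    fix F G assume F: "F \<in> I" and G: "G \<in> I"
    then obtain n m where "W F n" "W G m" by (auto simp: I_def)
    then have N: "W F (max n m)" "W G (max n m)" using W_mono by auto
    then have "W (F \<oplus>\<^bsub>End_right\<^esub> G) (max n m)"
      using es by (simp add: W_def End_right_simps)
    then show "\<phi> (F \<oplus>\<^bsub>End_right\<^esub> G) = \<phi> F \<oplus>\<^bsub>End_right\<^esub> \<phi> G"
      using \<phi>[OF N(1)] \<phi>[OF N(2)] \<phi>[of "F \<oplus>\<^bsub>End_right\<^esub> G"] ys
      by (auto simp: End_ring_def intro!: restrict_ext)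
  next
    fix F G assume G: "G \<in> carrier End_right" and F: "F \<in> I"
    then obtain n where n: "W F n" and FA: "F \<in> carrier End_right" by (auto simp: I_def)
    then have "W (G \<otimes>\<^bsub>End_right\<^esub> F) n"
      using es by (simp add: W_def End_right_simps)
    then show "\<phi> (G \<otimes>\<^bsub>End_right\<^esub> F) = G \<otimes>\<^bsub>End_right\<^esub> \<phi> F"
      using \<phi>[OF n] \<phi>[of "G \<otimes>\<^bsub>End_right\<^esub> F"] ys
      by (auto simp: End_ring_def intro!: restrict_ext)
  qed (use \<phi>_closed in auto)
  then obtain g where g: "g \<in> carrier End_right"
    and \<phi>g: "\<And>F. F \<in> I \<Longrightarrow> \<phi> F = F \<otimes>\<^bsub>End_right\<^esub> g" by blast
  have "e i \<otimes> g u = y i \<otimes> u" for i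
  proof -
    \<comment> \<open>The bound is \<open>Suc i\<close> because \<open>es\<close> and
      \<open>ys\<close> sum over smaller indices; with it, e i times \<open>ys (Suc i)\<close> is y
      i.\<close>
    have W: "W (left_mult (e i)) (Suc i)"
      using e es ees by (auto simp: W_def left_mult_def m_assoc[symmetric])
    then have "left_mult (e i) \<in> I" using left_mult_End e by (auto simp: I_def)
    from fun_cong[OF \<phi>g[OF this], of u] show ?thesis
      using u e ys y End_rightD(1)[OF g u] eys[of i "Suc i"] unfolding \<phi>[OF W]
      by (simp add: End_right_simps left_mult_def m_assoc[symmetric])
  qed
  then show "\<exists>z\<in>carrier R. \<forall>i. e i \<otimes> z = y i \<otimes> u"
    using End_rightD(1)[OF g u] by blast
qed

lemma self_injective_imp_corner_solvable:
  assumes inj: "left_self_injective TYPE('t) End_right"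
  shows corner_solvable
  unfolding corner_solvable_def
proof (intro ballI impI)
  fix v a assume v: "v \<in> carrier R" and a: "a \<in> carrier R" and vv: "v \<otimes> v = v"
    and va: "v \<otimes> a = a" and av: "a \<otimes> v = a"
    and ann: "\<forall>x\<in>carrier R. x \<otimes> a = \<zero> \<longrightarrow> x \<otimes> v = \<zero>"
  interpret A: ring End_right by (rule ring_End_right)
  let ?l = left_mult
  note lm = left_mult_End[OF a] left_mult_End[OF v]
  define I where "I = {F \<otimes>\<^bsub>End_right\<^esub> ?l a | F. F \<in> carrier End_right}"
  define \<phi> where "\<phi> G = (SOME F. F \<in> carrier End_right \<and> G = F \<otimes>\<^bsub>End_right\<^esub> ?l a)
    \<otimes>\<^bsub>End_right\<^esub> ?l v" for G
  have \<phi>: "\<phi> (F \<otimes>\<^bsub>End_right\<^esub> ?l a) = F \<otimes>\<^bsub>End_right\<^esub> ?l v" if F: "F \<in> carrier End_right" for F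
  proof -
    \<comment> \<open>Well-definedness is the annihilator hypothesis for x = F v - F' v: equality
      after \<open>left_mult a\<close> means (F v - F' v) a = 0, whence F v = F' v, and this
      determines F (v x) = F v x.\<close>
    have *: "F' \<otimes>\<^bsub>End_right\<^esub> ?l v = F \<otimes>\<^bsub>End_right\<^esub> ?l v"
      if F': "F' \<in> carrier End_right" and eq: "F \<otimes>\<^bsub>End_right\<^esub> ?l a = F' \<otimes>\<^bsub>End_right\<^esub> ?l a" for F'
    proof (rule End_right_eqI)
      fix x assume x: "x \<in> carrier R"
      note FD = End_rightD[OF F] and FD' = End_rightD[OF F']
      have "F v \<otimes> a = F' v \<otimes> a"
        using fun_cong[OF eq, of v] FD(3)[OF v a] FD'(3)[OF v a] a v
        by (simp add: End_right_simps left_mult_def va av)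
      then have "(F v \<ominus> F' v) \<otimes> a = \<zero>"
        using FD(1) FD'(1) v a by (simp add: l_diff_distr diff_eq_zero_iff)
      then have "(F v \<ominus> F' v) \<otimes> v = \<zero>" using ann FD(1) FD'(1) v by simp
      then have "F v = F' v"
        using FD FD' v vv by (simp add: l_diff_distr diff_eq_zero_iff) metis
      then show "(F' \<otimes>\<^bsub>End_right\<^esub> ?l v) x = (F \<otimes>\<^bsub>End_right\<^esub> ?l v) x"
        using x v FD(3)[OF v x] FD'(3)[OF v x] by (simp add: End_right_simps left_mult_def)
    qed (use F F' lm in \<open>auto simp: End_right_closed\<close>)
    show ?thesis unfolding \<phi>_def
      using someI_ex[of "\<lambda>F'. F' \<in> carrier End_right \<and>
        F \<otimes>\<^bsub>End_right\<^esub> ?l a = F' \<otimes>\<^bsub>End_right\<^esub> ?l a"] F * by blast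
  qed
  have I: "submodule I End_right (left_regular End_right)"
  proof (rule End_left_submoduleI)
    show "I \<noteq> {}" using A.zero_closed by (auto simp: I_def)
    fix F G assume "F \<in> I"
    then obtain F' where F': "F' \<in> carrier End_right" "F = F' \<otimes>\<^bsub>End_right\<^esub> ?l a" by (auto simp: I_def)
    show "G \<otimes>\<^bsub>End_right\<^esub> F \<in> I" if "G \<in> carrier End_right"
      using F' that lm by (auto simp: I_def A.m_assoc[symmetric])
    assume "G \<in> I"
    then obtain G' where "G' \<in> carrier End_right" "G = G' \<otimes>\<^bsub>End_right\<^esub> ?l a" by (auto simp: I_def)
    then show "F \<oplus>\<^bsub>End_right\<^esub> G \<in> I"
      using F' lm by (auto simp: I_def A.l_distr[symmetric] intro!: exI[of _ "F' \<oplus>\<^bsub>End_right\<^esub> G'"])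
  qed (use lm in \<open>auto simp: I_def\<close>)
  have "\<exists>g\<in>carrier End_right. \<forall>F\<in>I. \<phi> F = F \<otimes>\<^bsub>End_right\<^esub> g"
  proof (rule left_self_injective_extend[OF inj I])
    show "\<phi> \<in> I \<rightarrow> carrier End_right" using lm by (auto simp: I_def \<phi>)
    fix F G assume "F \<in> I"
    then obtain F' where F': "F' \<in> carrier End_right" "F = F' \<otimes>\<^bsub>End_right\<^esub> ?l a" by (auto simp: I_def)
    show "\<phi> (G \<otimes>\<^bsub>End_right\<^esub> F) = G \<otimes>\<^bsub>End_right\<^esub> \<phi> F" if G: "G \<in> carrier End_right"
      using \<phi>[of "G \<otimes>\<^bsub>End_right\<^esub> F'"] F' G lm by (simp add: A.m_assoc \<phi>)
    assume "G \<in> I"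
    then obtain G' where "G' \<in> carrier End_right" "G = G' \<otimes>\<^bsub>End_right\<^esub> ?l a" by (auto simp: I_def)
    then show "\<phi> (F \<oplus>\<^bsub>End_right\<^esub> G) = \<phi> F \<oplus>\<^bsub>End_right\<^esub> \<phi> G"
      using \<phi>[of "F' \<oplus>\<^bsub>End_right\<^esub> G'"] F' lm by (simp add: A.l_distr \<phi>)
  qed
  then obtain g where g: "g \<in> carrier End_right"
    and \<phi>g: "\<And>F. F \<in> I \<Longrightarrow> \<phi> F = F \<otimes>\<^bsub>End_right\<^esub> g" by blast
  have one: "\<one>\<^bsub>End_right\<^esub> \<otimes>\<^bsub>End_right\<^esub> F = F" if "F \<in> carrier End_right" for F
    using that by simp
  have "?l a \<in> I" unfolding I_def using A.one_closed one[OF lm(1)] by force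
  moreover have "\<phi> (?l a) = ?l v"
    using \<phi>[OF A.one_closed] one[OF lm(1)] one[OF lm(2)] by simp
  ultimately have "?l v = ?l a \<otimes>\<^bsub>End_right\<^esub> g" using \<phi>g by metis
  from fun_cong[OF this, of v] have "a \<otimes> g v = v"
    using v vv a End_rightD(1)[OF g v] by (simp add: End_right_simps left_mult_def)
  then show "\<exists>z\<in>carrier R. a \<otimes> z = v" using End_rightD(1)[OF g v] by blast
qed

end

section \<open>Semisimple rings with artinian homogeneous components\<close>

context nonunital_ring
begin

section \<open>Right ideals: sums, simplicity, homogeneous components\<close>

lemma right_idealD:
  assumes "right_ideal I"
  shows "I \<subseteq> carrier R" "\<zero> \<in> I" "\<And>x y. x \<in> I \<Longrightarrow> y \<in> I \<Longrightarrow> x \<oplus> y \<in> I"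
    "\<And>x. x \<in> I \<Longrightarrow> \<ominus> x \<in> I" "\<And>x a. x \<in> I \<Longrightarrow> a \<in> carrier R \<Longrightarrow> x \<otimes> a \<in> I"
    "\<And>x. x \<in> I \<Longrightarrow> x \<in> carrier R"
  using assms by (auto simp: right_ideal_iff)

lemma right_ideal_finsum:
  assumes "right_ideal I" "finite F" "f \<in> F \<rightarrow> I"
  shows "(\<Oplus>i\<in>F. f i) \<in> I"
  using assms(2,3)
proof (induction F rule: finite_induct)
  note I = right_idealD[OF assms(1)]
  case (insert i F)
  from insert have f: "f i \<in> I" "f \<in> F \<rightarrow> I" "f \<in> F \<rightarrow> carrier R" using I(6) by auto
  then show ?case using insert I by (simp add: finsum_insert)
qed (simp add: right_idealD[OF assms(1)])

lemma right_ideal_inter: "right_ideal I \<Longrightarrow> right_ideal J \<Longrightarrow> right_ideal (I \<inter> J)"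
  by (auto simp: right_ideal_iff)

lemma right_ideal_principal: "a \<in> carrier R \<Longrightarrow> right_ideal ((\<otimes>) a ` carrier R)"
  unfolding right_ideal_iff
  by (auto simp: r_distr[symmetric] r_minus[symmetric] m_assoc intro!: image_eqI[of _ _ \<zero>])

definition ideal_sum :: "'a set \<Rightarrow> 'a set \<Rightarrow> 'a set" where
  "ideal_sum I J = {x \<oplus> y | x y. x \<in> I \<and> y \<in> J}"

lemma ideal_sumI: "x \<in> I \<Longrightarrow> y \<in> J \<Longrightarrow> x \<oplus> y \<in> ideal_sum I J"
  by (auto simp: ideal_sum_def)

lemma right_ideal_sum:
  assumes "right_ideal I" "right_ideal J"
  shows "right_ideal (ideal_sum I J)" and "I \<subseteq> ideal_sum I J" and "J \<subseteq> ideal_sum I J"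
proof -
  note I = right_idealD[OF assms(1)] and J = right_idealD[OF assms(2)]
  show "right_ideal (ideal_sum I J)"
    unfolding right_ideal_iff
  proof (intro conjI ballI)
    show "ideal_sum I J \<subseteq> carrier R" using I(6) J(6) by (auto simp: ideal_sum_def)
    show "\<zero> \<in> ideal_sum I J"
      unfolding ideal_sum_def using I(2) J(2) l_zero[OF zero_closed] by force
    fix z assume "z \<in> ideal_sum I J"
    then obtain x y where z: "x \<in> I" "y \<in> J" "z = x \<oplus> y" by (auto simp: ideal_sum_def)
    then have "\<ominus> z = \<ominus> x \<oplus> \<ominus> y" using I(6) J(6) by (simp add: minus_add)
    then show "\<ominus> z \<in> ideal_sum I J" using z I(4) J(4) by (simp add: ideal_sumI)
    show "z \<otimes> a \<in> ideal_sum I J" if "a \<in> carrier R" for a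
      using z I(5)[OF z(1) that] J(5)[OF z(2) that] I(6) J(6) that by (simp add: ideal_sumI l_distr)
    fix z' assume "z' \<in> ideal_sum I J"
    then obtain x' y' where z': "x' \<in> I" "y' \<in> J" "z' = x' \<oplus> y'" by (auto simp: ideal_sum_def)
    have "z \<oplus> z' = (x \<oplus> x') \<oplus> (y \<oplus> y')"
      using z z' I(6) J(6) by (simp add: a_ac)
    then show "z \<oplus> z' \<in> ideal_sum I J" using z z' I(3) J(3) by (simp add: ideal_sumI)
  qed
  show "I \<subseteq> ideal_sum I J"
  proof
    fix x assume "x \<in> I"
    then show "x \<in> ideal_sum I J"
      unfolding ideal_sum_def using J(2) r_zero[OF I(6)] by force
  qed
  show "J \<subseteq> ideal_sum I J"
  proof
    fix x assume "x \<in> J"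
    then show "x \<in> ideal_sum I J"
      unfolding ideal_sum_def using I(2) l_zero[OF J(6)] by force
  qed
qed

lemma ideal_sum_mono: "J \<subseteq> J' \<Longrightarrow> ideal_sum I J \<subseteq> ideal_sum I J'"
  by (auto simp: ideal_sum_def)

text \<open>The three claims together characterise the sum as the least right ideal containing every
  member; homogeneous components are handled through this property.\<close>

lemma sum_of_right_ideals:
  assumes "\<And>S. S \<in> \<S> \<Longrightarrow> right_ideal S"
  shows "right_ideal (sum_of_submodules (right_regular R) \<S>)"
    and "\<And>S. S \<in> \<S> \<Longrightarrow> S \<subseteq> sum_of_submodules (right_regular R) \<S>"
    and "\<And>J. right_ideal J \<Longrightarrow> (\<And>S. S \<in> \<S> \<Longrightarrow> S \<subseteq> J) \<Longrightarrow>
      sum_of_submodules (right_regular R) \<S> \<subseteq> J"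
proof -
  let ?T = "sum_of_submodules (right_regular R) \<S>"
  have T: "z \<in> ?T \<longleftrightarrow> (\<exists>\<F> x. z = (\<Oplus>S\<in>\<F>. x S) \<and> finite \<F> \<and> \<F> \<subseteq> \<S> \<and> (\<forall>S\<in>\<F>. x S \<in> S))" for z
    by (auto simp: sum_of_submodules_def)
  note D = right_idealD[OF assms]
  show "right_ideal ?T"
    unfolding right_ideal_iff
  proof (intro conjI ballI subsetI)
    show "\<zero> \<in> ?T" unfolding T by (rule exI[of _ "{}"]) simp
    fix z assume "z \<in> ?T"
    then obtain F x where z: "z = (\<Oplus>S\<in>F. x S)" "finite F" "F \<subseteq> \<S>" "\<And>S. S \<in> F \<Longrightarrow> x S \<in> S"
      unfolding T by blast
    have xR: "\<And>S. S \<in> F \<Longrightarrow> x S \<in> carrier R" using z D(6) by blast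
    then show zR: "z \<in> carrier R" using z(1) by auto
    show "z \<otimes> a \<in> ?T" if a: "a \<in> carrier R" for a
    proof -
      have "z \<otimes> a = (\<Oplus>S\<in>F. x S \<otimes> a)"
        using z xR a by (simp add: finsum_l_distr)
      then show ?thesis unfolding T using z a D(5) by (intro exI[of _ F] exI[of _ "\<lambda>S. x S \<otimes> a"]) auto
    qed
    show "\<ominus> z \<in> ?T"
    proof -
      have "z \<oplus> (\<Oplus>S\<in>F. \<ominus> x S) = (\<Oplus>S\<in>F. x S \<oplus> \<ominus> x S)"
        using z xR by (simp add: finsum_addf)
      also have "\<dots> = (\<Oplus>S\<in>F. \<zero>)" using xR by (intro finsum_cong') (auto simp: r_neg)
      also have "\<dots> = \<zero>" by simp
      finally have "\<ominus> z = (\<Oplus>S\<in>F. \<ominus> x S)" using zR xR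
        by (metis (no_types, lifting) Pi_I a_comm a_inv_closed finsum_closed minus_equality)
      then show ?thesis unfolding T using z D(4) by (intro exI[of _ F] exI[of _ "\<lambda>S. \<ominus> x S"]) auto
    qed
    fix z' assume "z' \<in> ?T"
    then obtain F' x' where z': "z' = (\<Oplus>S\<in>F'. x' S)" "finite F'" "F' \<subseteq> \<S>"
      "\<And>S. S \<in> F' \<Longrightarrow> x' S \<in> S" unfolding T by blast
    have xR': "\<And>S. S \<in> F' \<Longrightarrow> x' S \<in> carrier R" using z' D(6) by blast
    \<comment> \<open>Families over two different finite sets are padded with zeros to the union
      before they are added.\<close>
    let ?x = "\<lambda>S. if S \<in> F then x S else \<zero>" and ?x' = "\<lambda>S. if S \<in> F' then x' S else \<zero>"
    have "(\<Oplus>S\<in>F\<union>F'. ?x S \<oplus> ?x' S) = (\<Oplus>S\<in>F\<union>F'. ?x S) \<oplus> (\<Oplus>S\<in>F\<union>F'. ?x' S)"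
      using xR xR' by (intro finsum_addf) auto
    also have "(\<Oplus>S\<in>F\<union>F'. ?x S) = z" unfolding z(1)
      using z z' xR by (intro add.finprod_mono_neutral_cong_right) auto
    also have "(\<Oplus>S\<in>F\<union>F'. ?x' S) = z'" unfolding z'(1)
      using z z' xR' by (intro add.finprod_mono_neutral_cong_right) auto
    finally show "z \<oplus> z' \<in> ?T" unfolding T
      using z z' D(2,3) xR xR'
      by (intro exI[of _ "F \<union> F'"] exI[of _ "\<lambda>S. ?x S \<oplus> ?x' S"]) (auto simp: subset_iff)
  qed
  show "S \<subseteq> ?T" if S: "S \<in> \<S>" for S
  proof
    fix x assume x: "x \<in> S"
    then have "x = (\<Oplus>T\<in>{S}. x)" using D(6)[OF S] by simp
    then show "x \<in> ?T" unfolding T using x S by (intro exI[of _ "{S}"] exI[of _ "\<lambda>_. x"]) auto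
  qed
  show "?T \<subseteq> J" if "right_ideal J" "\<And>S. S \<in> \<S> \<Longrightarrow> S \<subseteq> J" for J
  proof
    fix z assume "z \<in> ?T"
    then obtain F x where z: "z = (\<Oplus>S\<in>F. x S)" "finite F" "F \<subseteq> \<S>" "\<And>S. S \<in> F \<Longrightarrow> x S \<in> S"
      unfolding T by blast
    then have "x \<in> F \<rightarrow> J" using that(2) by blast
    then show "z \<in> J" unfolding z(1) using that(1) z(2) by (intro right_ideal_finsum)
  qed
qed

abbreviation simple_right_ideal :: "'a set \<Rightarrow> bool" where
  "simple_right_ideal \<equiv> simple_submodule R (right_regular R)"

lemma simple_right_ideal_iff:
  "simple_right_ideal S \<longleftrightarrow> right_ideal S \<and> S \<noteq> {\<zero>} \<and>
    (\<forall>T. right_ideal T \<longrightarrow> T \<subseteq> S \<longrightarrow> T = {\<zero>} \<or> T = S)"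
  by (simp add: simple_submodule_def right_ideal_def)

lemma semisimple_obtain:
  assumes "semisimple_module R (right_regular R)" "u \<in> carrier R"
  obtains F x where "u = (\<Oplus>S\<in>F. x S)" "finite F"
    "\<And>S. S \<in> F \<Longrightarrow> simple_right_ideal S" "\<And>S. S \<in> F \<Longrightarrow> x S \<in> S"
proof -
  have "u \<in> sum_of_submodules (right_regular R) {S. simple_right_ideal S}"
    using assms unfolding semisimple_module_def by simp
  then show ?thesis unfolding sum_of_submodules_def using that by auto
qed

abbreviation component :: "'a set \<Rightarrow> 'a set" where
  "component \<equiv> homogeneous_component R (right_regular R)"

lemma component_props:
  shows "right_ideal (component S)"
    and "simple_right_ideal T \<Longrightarrow> isomorphic_submodules R (right_regular R) S T \<Longrightarrow> T \<subseteq> component S"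
    and "right_ideal J \<Longrightarrow> (\<And>T. simple_right_ideal T \<Longrightarrow>
      isomorphic_submodules R (right_regular R) S T \<Longrightarrow> T \<subseteq> J) \<Longrightarrow> component S \<subseteq> J"
  unfolding homogeneous_component_def
  by (rule sum_of_right_ideals; auto simp: simple_right_ideal_iff)+

lemma isomorphic_submodules_iff:
  "isomorphic_submodules R (right_regular R) S T \<longleftrightarrow>
    (\<exists>f. bij_betw f S T \<and> (\<forall>x\<in>S. \<forall>y\<in>S. f (x \<oplus> y) = f x \<oplus> f y) \<and>
      (\<forall>x\<in>S. \<forall>a\<in>carrier R. f (x \<otimes> a) = f x \<otimes> a))"
  by (auto simp: isomorphic_submodules_def mod_hom_def bij_betw_def)

text \<open>Half of Schur's lemma: preimages of right ideals are right ideals inside S, so by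
  simplicity the kernel vanishes and the image has no proper nonzero right ideals below it.\<close>

lemma simple_image:
  assumes S: "simple_right_ideal S" and f: "\<And>x. x \<in> S \<Longrightarrow> f x \<in> carrier R"
    and add: "\<And>x y. x \<in> S \<Longrightarrow> y \<in> S \<Longrightarrow> f (x \<oplus> y) = f x \<oplus> f y"
    and mult: "\<And>x a. x \<in> S \<Longrightarrow> a \<in> carrier R \<Longrightarrow> f (x \<otimes> a) = f x \<otimes> a"
    and u: "u \<in> S" "f u \<noteq> \<zero>"
  shows "simple_right_ideal (f ` S)" and "isomorphic_submodules R (right_regular R) S (f ` S)"
proof -
  have rS: "right_ideal S" and min: "\<And>T. right_ideal T \<Longrightarrow> T \<subseteq> S \<Longrightarrow> T = {\<zero>} \<or> T = S"
    using S by (auto simp: simple_right_ideal_iff)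
  note SD = right_idealD[OF rS]
  have f0: "f \<zero> = \<zero>" using mult[OF SD(2) zero_closed] f[OF SD(2)] by simp
  have fm: "f (\<ominus> x) = \<ominus> f x" if "x \<in> S" for x
    using add[of "\<ominus> x" x] SD f0 f that by (simp add: l_neg minus_equality)
  have pre: "right_ideal {s \<in> S. f s \<in> T}" if "right_ideal T" for T
    using SD right_idealD[OF that] f0 fm add mult by (auto simp: right_ideal_iff)
  have z: "right_ideal {\<zero>}" by (auto simp: right_ideal_iff)
  have ker: "{s \<in> S. f s \<in> {\<zero>}} = {\<zero>}"
    using min[OF pre[OF z]] u by auto
  have inj: "inj_on f S"
  proof (rule inj_onI)
    fix x y assume xy: "x \<in> S" "y \<in> S" "f x = f y"
    then have "f (x \<oplus> \<ominus> y) = \<zero>" using SD f by (simp add: add fm r_neg)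
    then have "x \<oplus> \<ominus> y \<in> {s \<in> S. f s \<in> {\<zero>}}" using xy SD by auto
    then have "x \<oplus> \<ominus> y = \<zero>" using ker by auto
    then show "x = y" using xy SD(6) by (simp add: a_minus_def[symmetric] diff_eq_zero_iff)
  qed
  then show "isomorphic_submodules R (right_regular R) S (f ` S)"
    unfolding isomorphic_submodules_iff using add mult by (auto simp: bij_betw_def)
  show "simple_right_ideal (f ` S)"
    unfolding simple_right_ideal_iff
  proof (intro conjI allI impI)
    show "right_ideal (f ` S)"
      using SD f f0 by (auto simp: right_ideal_iff add[symmetric] mult[symmetric] fm[symmetric]
        intro!: image_eqI[of _ _ \<zero>])
    show "f ` S \<noteq> {\<zero>}" using u by auto
    fix T assume T: "right_ideal T" "T \<subseteq> f ` S"
    then have "T = f ` {s \<in> S. f s \<in> T}" by auto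
    then show "T = {\<zero>} \<or> T = f ` S" using min[OF pre[OF T(1)]] f0 by force
  qed
qed

text \<open>The artinian property is asked of a component as a ring in its own right. Additive
  inverses are defined through the carrier of the record, so their agreement with those of R needs
  an argument.\<close>

lemma nonunital_ring_right_ideal:
  assumes "right_ideal H"
  shows "nonunital_ring (R\<lparr>carrier := H\<rparr>)"
    and "x \<in> H \<Longrightarrow> \<ominus>\<^bsub>R\<lparr>carrier := H\<rparr>\<^esub> x = \<ominus> x"
proof -
  note H = right_idealD[OF assms]
  have a: "abelian_group (R\<lparr>carrier := H\<rparr>)"
  proof (rule abelian_groupI)
    show "\<exists>y\<in>carrier (R\<lparr>carrier := H\<rparr>). y \<oplus>\<^bsub>R\<lparr>carrier := H\<rparr>\<^esub> x = \<zero>\<^bsub>R\<lparr>carrier := H\<rparr>\<^esub>"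
      if "x \<in> carrier (R\<lparr>carrier := H\<rparr>)" for x
      using that H(4) l_neg[OF H(6)] by (intro bexI[of _ "\<ominus> x"]) auto
  qed (use H in \<open>auto simp: a_ac\<close>)
  then show "nonunital_ring (R\<lparr>carrier := H\<rparr>)"
    unfolding nonunital_ring_def nonunital_ring_axioms_def
    using H(3,5,6) by (auto simp: m_assoc l_distr r_distr)
  interpret H: abelian_group "R\<lparr>carrier := H\<rparr>" by fact
  show "x \<in> H \<Longrightarrow> \<ominus>\<^bsub>R\<lparr>carrier := H\<rparr>\<^esub> x = \<ominus> x"
    using H.minus_equality[of "\<ominus> x" x] H by (simp add: l_neg)
qed

definition artinian_semisimple :: bool where
  "artinian_semisimple \<longleftrightarrow> semisimple_module R (right_regular R) \<and>
    (\<forall>S. simple_right_ideal S \<longrightarrow> artinian_ring (R\<lparr>carrier := component S\<rparr>))"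

text \<open>
  If \<open>u\<close> lies in a simple right ideal, then all \<open>y i \<otimes> u\<close> lie in one homogeneous component,
  and the chain of the right ideals annihilated by \<open>e 0, \<dots>, e (n - 1)\<close> in it is stationary.
  Hence almost all \<open>y i \<otimes> u\<close> vanish.
\<close>

lemma artinian_semisimple_imp_orthogonal_solvable:
  assumes artinian_semisimple
  shows orthogonal_solvable
  unfolding orthogonal_solvable_def
proof (intro allI impI)
  fix e y :: "nat \<Rightarrow> 'a" and u
  assume "\<forall>i. e i \<in> carrier R \<and> y i \<in> carrier R \<and> e i \<otimes> y i = y i"
    and ee: "\<forall>i j. e i \<otimes> e j = (if i = j then e i else \<zero>)" and u: "u \<in> carrier R"
  then have e: "e i \<in> carrier R" and y: "y i \<in> carrier R" and ey: "e i \<otimes> y i = y i" for i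
    by auto
  have ey': "e i \<otimes> y j = (if i = j then y i else \<zero>)" for i j
    using ee ey e y m_assoc[of "e i" "e j" "y j"] by (cases "i = j") auto
  \<comment> \<open>Solutions for different right-hand sides add up, so it suffices to treat
    elements of a simple right ideal.\<close>
  have simple: "\<exists>z\<in>carrier R. \<forall>i. e i \<otimes> z = y i \<otimes> w"
    if S: "simple_right_ideal S" and w: "w \<in> S" for S w
  proof -
    define H where "H = component S"
    note H = right_idealD[OF component_props(1)[of S], folded H_def]
    have rS: "right_ideal S" using S by (simp add: simple_right_ideal_iff)
    note SD = right_idealD[OF rS]
    \<comment> \<open>By Schur, y i S is zero or an isomorphic copy of S; in both cases it lies in
      the component of S.\<close>
    have yH: "y i \<otimes> w \<in> H" for i
    proof (cases "y i \<otimes> w = \<zero>")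
      case False
      have "simple_right_ideal ((\<otimes>) (y i) ` S)"
        "isomorphic_submodules R (right_regular R) S ((\<otimes>) (y i) ` S)"
        by (rule simple_image[OF S, of "(\<otimes>) (y i)" w];
          use y SD w False in \<open>simp add: r_distr m_assoc\<close>)+
      from component_props(2)[OF this] show ?thesis using w by (auto simp: H_def)
    qed (use H in simp)
    let ?H = "R\<lparr>carrier := H\<rparr>"
    interpret H: nonunital_ring ?H
      using component_props(1) unfolding H_def by (rule nonunital_ring_right_ideal)
    have inv: "x \<in> H \<Longrightarrow> \<ominus>\<^bsub>?H\<^esub> x = \<ominus> x" for x
      unfolding H_def by (rule nonunital_ring_right_ideal(2)[OF component_props(1)])
    define I where "I n = {x \<in> H. \<forall>i<n. e i \<otimes> x = \<zero>}" for n :: nat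
    have "H.right_ideal (I n)" for n
      unfolding H.right_ideal_iff using H e
      by (auto simp: I_def inv r_distr r_minus m_assoc[symmetric])
    then have "submodule (I n) ?H (right_regular ?H)" for n
      unfolding H.right_ideal_def .
    moreover have "I (Suc n) \<subseteq> I n" for n by (auto simp: I_def)
    moreover have "artinian_module ?H (right_regular ?H)"
      using assms S by (auto simp: artinian_semisimple_def artinian_ring_def H_def)
    ultimately obtain n where n: "\<And>m. m \<ge> n \<Longrightarrow> I m = I n"
      unfolding artinian_module_def by blast
    have y0: "y i \<otimes> w = \<zero>" if "i \<ge> n" for i
    proof -
      \<comment> \<open>Orthogonality puts y i w into \<open>I i\<close>. Where the chain is
        stationary, y i w also lies in \<open>I (Suc i)\<close>, and this means that e i y i w = y i
        w is zero.\<close>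
      have "y i \<otimes> w \<in> I i"
        using yH e y SD(6)[OF w] by (auto simp: I_def m_assoc[symmetric] ey')
      then have "y i \<otimes> w \<in> I (Suc i)" using n[of i] n[of "Suc i"] that by simp
      then show ?thesis using e y SD(6)[OF w] ey by (auto simp: I_def m_assoc[symmetric])
    qed
    have "e i \<otimes> (\<Oplus>j\<in>{..<n}. y j \<otimes> w) = y i \<otimes> w" for i
    proof -
      have "e i \<otimes> (\<Oplus>j\<in>{..<n}. y j \<otimes> w) = (\<Oplus>j\<in>{..<n}. if j = i then y i \<otimes> w else \<zero>)"
        using e y SD(6)[OF w]
        by (auto simp: finsum_r_distr m_assoc[symmetric] ey' intro!: finsum_cong')
      also have "\<dots> = y i \<otimes> w"
      proof (cases "i < n")
        case True
        then show ?thesis using y SD(6)[OF w]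
          by (intro add.finprod_singleton_swap[of i "{..<n}" "\<lambda>_. y i \<otimes> w"]) auto
      next
        case False
        then have "(\<Oplus>j\<in>{..<n}. if j = i then y i \<otimes> w else \<zero>) = (\<Oplus>j\<in>{..<n}. \<zero>)"
          by (intro finsum_cong') auto
        then show ?thesis using y0 False by simp
      qed
      finally show ?thesis .
    qed
    then show ?thesis using y SD(6)[OF w] by (intro bexI[of _ "\<Oplus>j\<in>{..<n}. y j \<otimes> w"]) auto
  qed
  have "semisimple_module R (right_regular R)" using assms by (simp add: artinian_semisimple_def)
  then obtain F x where F: "u = (\<Oplus>S\<in>F. x S)" "finite F"
    "\<And>S. S \<in> F \<Longrightarrow> simple_right_ideal S" "\<And>S. S \<in> F \<Longrightarrow> x S \<in> S"
    using semisimple_obtain u by metis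
  have xR: "\<And>S. S \<in> F \<Longrightarrow> x S \<in> carrier R"
    using F right_idealD(6) unfolding simple_right_ideal_iff by blast
  have "\<forall>S\<in>F. \<exists>z. z \<in> carrier R \<and> (\<forall>i. e i \<otimes> z = y i \<otimes> x S)"
    using simple F by blast
  then obtain z where z: "\<And>S. S \<in> F \<Longrightarrow> z S \<in> carrier R \<and> (\<forall>i. e i \<otimes> z S = y i \<otimes> x S)"
    by metis
  have "e i \<otimes> (\<Oplus>S\<in>F. z S) = y i \<otimes> u" for i
    unfolding F(1) using F(2) z xR e y by (simp add: finsum_r_distr) (auto intro!: finsum_cong')
  moreover have "(\<Oplus>S\<in>F. z S) \<in> carrier R" using z by (intro finsum_closed) auto
  ultimately show "\<exists>z\<in>carrier R. \<forall>i. e i \<otimes> z = y i \<otimes> u" by blast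
qed

text \<open>
  \<open>v = a \<otimes> z \<oplus> c\<close> with \<open>c\<close> in a right ideal \<open>C\<close> that meets \<open>a \<otimes> R\<close> trivially. Then
  \<open>c \<otimes> a = a \<ominus> a \<otimes> z \<otimes> a\<close> lies in the intersection, so \<open>c \<otimes> v = \<zero>\<close>.
\<close>

lemma semisimple_imp_corner_solvable:
  assumes ss: "semisimple_module R (right_regular R)"
  shows corner_solvable
  unfolding corner_solvable_def
proof (intro ballI impI)
  fix v a assume v: "v \<in> carrier R" and a: "a \<in> carrier R" and vv: "v \<otimes> v = v"
    and va: "v \<otimes> a = a" and av: "a \<otimes> v = a"
    and ann: "\<forall>x\<in>carrier R. x \<otimes> a = \<zero> \<longrightarrow> x \<otimes> v = \<zero>"
  let ?A = "(\<otimes>) a ` carrier R"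
  have A: "right_ideal ?A" using a by (rule right_ideal_principal)
  note AD = right_idealD[OF A]
  \<comment> \<open>A complement relative to finitely many simple right ideals is enough, since
    \<open>v\<close> is a finite sum of elements of such ideals. It is built by adding one of them
    at a time.\<close>
  have compl: "\<exists>C. right_ideal C \<and> ?A \<inter> C = {\<zero>} \<and> (\<forall>S\<in>F. S \<subseteq> ideal_sum ?A C)"
    if "finite F" "\<forall>S\<in>F. simple_right_ideal S" for F
    using that
  proof (induction F rule: finite_induct)
    case empty
    show ?case using AD by (intro exI[of _ "{\<zero>}"]) (auto simp: right_ideal_iff)
  next
    case (insert S F)
    then obtain C where C: "right_ideal C" "?A \<inter> C = {\<zero>}" "\<forall>S\<in>F. S \<subseteq> ideal_sum ?A C"
      by auto
    have S: "right_ideal S" "\<And>T. right_ideal T \<Longrightarrow> T \<subseteq> S \<Longrightarrow> T = {\<zero>} \<or> T = S"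
      using insert.prems by (auto simp: simple_right_ideal_iff)
    note CD = right_idealD[OF C(1)] and SD = right_idealD[OF S(1)]
    note AC = right_ideal_sum[OF A C(1)] and CS = right_ideal_sum[OF C(1) S(1)]
    show ?case
    proof (cases "S \<subseteq> ideal_sum ?A C")
      case True
      then show ?thesis using C by auto
    next
      case False
      \<comment> \<open>A simple S that is not contained in a R + C meets it trivially, so C can be
        enlarged by S without meeting a R.\<close>
      then have 0: "S \<inter> ideal_sum ?A C = {\<zero>}"
        using S(2)[OF right_ideal_inter[OF S(1) AC(1)]] by auto
      have "x = \<zero>" if xA: "x \<in> ?A" and x: "x \<in> ideal_sum C S" for x
      proof -
        obtain c s where cs: "c \<in> C" "s \<in> S" "x = c \<oplus> s" using x by (auto simp: ideal_sum_def)
        have cR: "c \<in> carrier R" "s \<in> carrier R" using cs CD(6) SD(6) by auto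
        then have "s = \<ominus> c \<oplus> (c \<oplus> s)" by (simp add: r_neg1)
        also have "\<dots> = x \<oplus> \<ominus> c" using cR cs(3) by (simp add: a_comm)
        finally have "s = x \<oplus> \<ominus> c" .
        then have "s \<in> ideal_sum ?A C" using xA cs(1) CD(4) by (auto simp: ideal_sum_def)
        then have "s = \<zero>" using 0 cs(2) by auto
        then have "x = c" using cs CD(6) by simp
        then show ?thesis using C(2) xA cs(1) by auto
      qed
      then have "?A \<inter> ideal_sum C S = {\<zero>}" using AD(2) right_idealD(2)[OF CS(1)] by blast
      moreover have "\<forall>T\<in>insert S F. T \<subseteq> ideal_sum ?A (ideal_sum C S)"
        using C(3) ideal_sum_mono[OF CS(2), of ?A] CS(3) right_ideal_sum(3)[OF A CS(1)] by blast
      ultimately show ?thesis using CS(1) by blast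
    qed
  qed
  obtain F x where F: "v = (\<Oplus>S\<in>F. x S)" "finite F"
    "\<And>S. S \<in> F \<Longrightarrow> simple_right_ideal S" "\<And>S. S \<in> F \<Longrightarrow> x S \<in> S"
    using semisimple_obtain ss v by metis
  have "\<forall>S\<in>F. simple_right_ideal S" using F(3) by (rule ballI)
  from compl[OF F(2) this] obtain C where C: "right_ideal C" "?A \<inter> C = {\<zero>}"
    "\<And>S. S \<in> F \<Longrightarrow> S \<subseteq> ideal_sum ?A C" by blast
  note CD = right_idealD[OF C(1)]
  have "x \<in> F \<rightarrow> ideal_sum ?A C" using F(4) C(3) by blast
  then have "v \<in> ideal_sum ?A C"
    unfolding F(1) by (intro right_ideal_finsum right_ideal_sum(1)[OF A C(1)] F(2))
  then obtain z c where z: "z \<in> carrier R" and c: "c \<in> C" and veq: "v = a \<otimes> z \<oplus> c"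
    by (auto simp: ideal_sum_def)
  have cR: "c \<in> carrier R" using CD c by blast
  have "v \<otimes> a = a \<otimes> (z \<otimes> a) \<oplus> c \<otimes> a"
    using z cR a by (simp add: veq l_distr m_assoc)
  then have "a = a \<otimes> (z \<otimes> a) \<oplus> c \<otimes> a" using va by simp
  then have "\<ominus> (a \<otimes> (z \<otimes> a)) \<oplus> a = c \<otimes> a"
    using r_neg1[of "a \<otimes> (z \<otimes> a)" "c \<otimes> a"] a z cR by simp
  moreover have "\<ominus> (a \<otimes> (z \<otimes> a)) \<in> ?A" "a \<in> ?A"
    using AD(4) a z av v by (auto intro: rev_image_eqI[of v])
  ultimately have "c \<otimes> a \<in> ?A" using AD(3) by metis
  moreover have "c \<otimes> a \<in> C" using c a CD by auto
  ultimately have "c \<otimes> a = \<zero>" using C(2) by auto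
  then have "c \<otimes> v = \<zero>" using ann cR by blast
  moreover have "v \<otimes> v = a \<otimes> (z \<otimes> v) \<oplus> c \<otimes> v"
    using z cR a v by (subst veq) (simp add: l_distr m_assoc)
  ultimately have "a \<otimes> (z \<otimes> v) = v" using a z v vv by (simp add: m_assoc)
  then show "\<exists>z\<in>carrier R. a \<otimes> z = v" using z v by blast
qed

end

section \<open>Algebras of block matrices\<close>

locale nonunital_algebra = nonunital_ring L for L :: "('k::field, 'a) module" (structure) +
  assumes smult_closed [simp, intro]: "x \<in> carrier L \<Longrightarrow> k \<odot> x \<in> carrier L"
    and smult_l_distr: "x \<in> carrier L \<Longrightarrow> (k + l) \<odot> x = k \<odot> x \<oplus> l \<odot> x"
    and smult_r_distr: "x \<in> carrier L \<Longrightarrow> y \<in> carrier L \<Longrightarrow> k \<odot> (x \<oplus> y) = k \<odot> x \<oplus> k \<odot> y"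
    and smult_assoc: "x \<in> carrier L \<Longrightarrow> (k * l) \<odot> x = k \<odot> (l \<odot> x)"
    and smult_one [simp]: "x \<in> carrier L \<Longrightarrow> 1 \<odot> x = x"
    and smult_mult_l: "x \<in> carrier L \<Longrightarrow> y \<in> carrier L \<Longrightarrow> (k \<odot> x) \<otimes> y = k \<odot> (x \<otimes> y)"
    and smult_mult_r: "x \<in> carrier L \<Longrightarrow> y \<in> carrier L \<Longrightarrow> x \<otimes> (k \<odot> y) = k \<odot> (x \<otimes> y)"
begin

lemma smult_zero_l [simp]: "x \<in> carrier L \<Longrightarrow> 0 \<odot> x = \<zero>"
  using smult_l_distr[of x 0 0] by simp

lemma smult_zero_r [simp]: "k \<odot> \<zero> = \<zero>"
  using smult_r_distr[of \<zero> \<zero> k] by simp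

lemma smult_minus_one: "x \<in> carrier L \<Longrightarrow> (- 1) \<odot> x = \<ominus> x"
  using smult_l_distr[of x "- 1" 1] by (simp add: minus_equality[symmetric])

lemma smult_eq_zero_iff: "x \<in> carrier L \<Longrightarrow> k \<odot> x = \<zero> \<longleftrightarrow> k = 0 \<or> x = \<zero>"
proof
  assume x: "x \<in> carrier L" and "k \<odot> x = \<zero>"
  moreover have "x = \<zero>" if "k \<noteq> 0"
    using smult_assoc[OF x, of "inverse k" k] that \<open>k \<odot> x = \<zero>\<close> x by simp
  ultimately show "k = 0 \<or> x = \<zero>" by blast
qed auto

end

lemma (in abelian_group) additive_finsum:
  assumes "finite S" "f \<in> S \<rightarrow> carrier G"
    and add: "\<And>x y. x \<in> carrier G \<Longrightarrow> y \<in> carrier G \<Longrightarrow> h (x \<oplus> y) = h x + (h y :: 'k::ab_group_add)"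
  shows "h (\<Oplus>i\<in>S. f i) = (\<Sum>i\<in>S. h (f i))"
  using assms(1,2)
proof (induction S rule: finite_induct)
  case empty
  then show ?case using add[of \<zero> \<zero>] by simp
next
  case (insert i S)
  then show ?case by (simp add: add Pi_def)
qed

text \<open>
  The algebra of matrices with finite support that are indexed by \<open>P\<close> and vanish outside the
  blocks of \<open>b\<close>, where \<open>c\<close> gives the entries.
\<close>

locale block_coordinates = nonunital_algebra L
  for L :: "('k::field, 'a) module" (structure) +
  fixes P :: "'p set" and b :: "'p \<Rightarrow> 'i" and c :: "'a \<Rightarrow> 'p \<Rightarrow> 'p \<Rightarrow> 'k"
  assumes finite_block: "p \<in> P \<Longrightarrow> finite {q\<in>P. b q = b p}"
    and c_inj: "x \<in> carrier L \<Longrightarrow> y \<in> carrier L \<Longrightarrow> c x = c y \<Longrightarrow> x = y"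
    and c_support: "x \<in> carrier L \<Longrightarrow> c x p q \<noteq> 0 \<Longrightarrow> p \<in> P \<and> q \<in> P \<and> b p = b q"
    and c_finite: "x \<in> carrier L \<Longrightarrow> finite {(p, q). c x p q \<noteq> 0}"
    and c_surj: "finite {(p, q). m p q \<noteq> 0} \<Longrightarrow>
      (\<And>p q. m p q \<noteq> 0 \<Longrightarrow> p \<in> P \<and> q \<in> P \<and> b p = b q) \<Longrightarrow> \<exists>x\<in>carrier L. c x = m"
    and c_add: "x \<in> carrier L \<Longrightarrow> y \<in> carrier L \<Longrightarrow> c (x \<oplus> y) p q = c x p q + c y p q"
    and c_smult: "x \<in> carrier L \<Longrightarrow> c (k \<odot> x) p q = k * c x p q"
    and c_mult: "x \<in> carrier L \<Longrightarrow> y \<in> carrier L \<Longrightarrow> p \<in> P \<Longrightarrow>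
      c (x \<otimes> y) p q = (\<Sum>r\<in>{r\<in>P. b r = b p}. c x p r * c y r q)"
begin

section \<open>Matrix coordinates, matrix units and rows\<close>

abbreviation block :: "'p \<Rightarrow> 'p set" where
  "block p \<equiv> {q\<in>P. b q = b p}"

lemma c_zero [simp]: "c \<zero> p q = 0"
  using c_smult[of \<zero> 0 p q] by simp

lemma c_finsum:
  "finite S \<Longrightarrow> f \<in> S \<rightarrow> carrier L \<Longrightarrow> c (\<Oplus>i\<in>S. f i) p q = (\<Sum>i\<in>S. c (f i) p q)"
  by (rule additive_finsum) (auto simp: c_add)

lemma c_eqI: "x \<in> carrier L \<Longrightarrow> y \<in> carrier L \<Longrightarrow> (\<And>p q. c x p q = c y p q) \<Longrightarrow> x = y"
  by (intro c_inj ext)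

lemma c_nonzero: "x \<in> carrier L \<Longrightarrow> x \<noteq> \<zero> \<Longrightarrow> \<exists>p q. c x p q \<noteq> 0"
  using c_eqI[of x \<zero>] by auto

text \<open>The matrix unit, unique by \<open>c_inj\<close>. It is unspecified unless p and q lie in
  P and in the same block.\<close>

definition unit :: "'p \<Rightarrow> 'p \<Rightarrow> 'a" where
  "unit p q = (SOME x. x \<in> carrier L \<and> c x = (\<lambda>p' q'. if p' = p \<and> q' = q then 1 else 0))"

lemma
  assumes "p \<in> P" "q \<in> block p"
  shows unit_closed: "unit p q \<in> carrier L"
    and c_unit: "c (unit p q) p' q' = (if p' = p \<and> q' = q then 1 else 0)"
proof -
  have "{(p', q'). (if p' = p \<and> q' = q then 1 else 0 :: 'k) \<noteq> 0} \<subseteq> {(p, q)}" by auto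
  then have "finite {(p', q'). (if p' = p \<and> q' = q then 1 else 0 :: 'k) \<noteq> 0}"
    by (rule finite_subset) simp
  moreover have "p' \<in> P \<and> q' \<in> P \<and> b p' = b q'"
    if "(if p' = p \<and> q' = q then 1 else 0 :: 'k) \<noteq> 0" for p' q'
    using that assms by (auto split: if_splits)
  ultimately have "\<exists>x\<in>carrier L. c x = (\<lambda>p' q'. if p' = p \<and> q' = q then 1 else 0)"
    by (rule c_surj)
  then have "\<exists>x. x \<in> carrier L \<and> c x = (\<lambda>p' q'. if p' = p \<and> q' = q then 1 else 0)"
    by blast
  then have "unit p q \<in> carrier L \<and> c (unit p q) = (\<lambda>p' q'. if p' = p \<and> q' = q then 1 else 0)"
    unfolding unit_def by (rule someI_ex)
  then show "unit p q \<in> carrier L" "c (unit p q) p' q' = (if p' = p \<and> q' = q then 1 else 0)"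
    by simp_all
qed

lemma c_mult':
  assumes "x \<in> carrier L" "y \<in> carrier L"
  shows "c (x \<otimes> y) p q = (if p \<in> P then \<Sum>r\<in>block p. c x p r * c y r q else 0)"
proof (cases "p \<in> P")
  case True
  then show ?thesis using c_mult[OF assms True] by simp
next
  case False
  then show ?thesis using c_support[OF m_closed[OF assms], of p q] by auto
qed

lemma c_unit_mult:
  assumes "p \<in> P" "q \<in> block p" "x \<in> carrier L"
  shows "c (unit p q \<otimes> x) p' s = (if p' = p then c x q s else 0)"
  using assms finite_block[OF assms(1)] unit_closed[OF assms(1,2)]
  by (auto simp: c_mult' c_unit if_distrib[of "\<lambda>x. x * _"] cong: if_cong)

lemma c_mult_unit:
  assumes "q \<in> P" "r \<in> block q" "x \<in> carrier L"
  shows "c (x \<otimes> unit q r) p s = (if s = r then c x p q else 0)"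
  using assms finite_block[of p] unit_closed[OF assms(1,2)] c_support[of x p q]
  by (cases "c x p q = 0") (auto simp: c_mult' c_unit if_distrib[of "\<lambda>x. _ * x"] cong: if_cong)

lemma unit_mult_unit:
  assumes "p \<in> P" "q \<in> block p" "r \<in> block p"
  shows "unit p q \<otimes> unit q r = unit p r"
  using assms by (intro c_eqI) (auto simp: unit_closed c_unit_mult c_unit)

abbreviation e :: "'p \<Rightarrow> 'a" where
  "e p \<equiv> unit p p"

text \<open>The sum of the \<open>e p\<close> over finitely many rows acts as a left unit on x,
  replacing the unit that L may lack.\<close>

lemma sum_of_rows:
  assumes x: "x \<in> carrier L" and F: "finite F" "F \<subseteq> P" "\<And>p q. c x p q \<noteq> 0 \<Longrightarrow> p \<in> F"
  shows "x = (\<Oplus>p\<in>F. e p \<otimes> x)"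
proof -
  have cl: "(\<lambda>p. e p \<otimes> x) \<in> F \<rightarrow> carrier L" using F x unit_closed by auto
  show ?thesis
  proof (rule c_eqI[OF x])
    show "(\<Oplus>p\<in>F. e p \<otimes> x) \<in> carrier L" using cl by simp
    fix p q
    have "c (\<Oplus>p\<in>F. e p \<otimes> x) p q = (\<Sum>p'\<in>F. if p' = p then c x p q else 0)"
      unfolding c_finsum[OF F(1) cl] using F(2) x by (intro sum.cong) (auto simp: c_unit_mult)
    also have "\<dots> = c x p q" using F by auto
    finally show "c x p q = c (\<Oplus>p\<in>F. e p \<otimes> x) p q" by simp
  qed
qed

lemma finite_rows: "x \<in> carrier L \<Longrightarrow> finite {p. \<exists>q. c x p q \<noteq> 0}"
  using finite_imageI[OF c_finite[of x], of fst] by (rule finite_subset[rotated]) (auto simp: image_iff)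

definition row :: "'p \<Rightarrow> 'a set" where
  "row p = {x\<in>carrier L. e p \<otimes> x = x}"

lemma right_ideal_row: "p \<in> P \<Longrightarrow> right_ideal (row p)"
  using unit_closed[of p p]
  by (auto simp: right_ideal_iff row_def r_distr r_minus m_assoc[symmetric])

lemma e_mult_in_row: "p \<in> P \<Longrightarrow> x \<in> carrier L \<Longrightarrow> e p \<otimes> x \<in> row p"
  using unit_closed[of p p] unit_mult_unit[of p p p] by (simp add: row_def m_assoc[symmetric])

lemma c_row: "p \<in> P \<Longrightarrow> x \<in> row p \<Longrightarrow> p' \<noteq> p \<Longrightarrow> c x p' q = 0"
  using c_unit_mult[of p p x p' q] by (auto simp: row_def)

text \<open>If x in \<open>row p\<close> has entry k \<noteq> 0 at (p, q), then multiplying x by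
  \<open>unit q p\<close> from the right gives k times \<open>e p\<close>. So every nonzero right
  ideal inside the row contains its generator \<open>e p\<close>.\<close>

lemma simple_row:
  assumes p: "p \<in> P"
  shows "simple_right_ideal (row p)"
  unfolding simple_right_ideal_iff
proof (intro conjI allI impI)
  show "right_ideal (row p)" by (rule right_ideal_row[OF p])
  have ep: "e p \<in> carrier L" using p by (simp add: unit_closed)
  have "e p \<noteq> \<zero>" using c_unit[of p p p p] p by auto
  then show "row p \<noteq> {\<zero>}" using unit_mult_unit[of p p p] p ep by (auto simp: row_def)
  fix T assume T: "right_ideal T" "T \<subseteq> row p"
  note TD = right_idealD[OF T(1)]
  show "T = {\<zero>} \<or> T = row p"
  proof (cases "T = {\<zero>}")
    case False
    then obtain x where x: "x \<in> T" "x \<noteq> \<zero>" using TD(2) by auto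
    then have xL: "x \<in> carrier L" and xr: "x \<in> row p" using TD T by auto
    obtain p' q where "c x p' q \<noteq> 0" using c_nonzero xL x by blast
    then have pq: "c x p q \<noteq> 0" using c_row[OF p xr] by metis
    then have q: "q \<in> P" "p \<in> block q" using c_support[OF xL pq] by auto
    note u = unit_closed[OF q]
    have "x \<otimes> unit q p = c x p q \<odot> e p"
      using u q ep xL p c_row[OF p xr] by (intro c_eqI) (auto simp: c_mult_unit c_smult c_unit)
    then have "e p = inverse (c x p q) \<odot> (x \<otimes> unit q p)"
      using pq ep by (simp add: smult_assoc[symmetric])
    also have "\<dots> = x \<otimes> (inverse (c x p q) \<odot> unit q p)"
      using u xL by (simp add: smult_mult_r)
    finally have "e p \<in> T" using TD(5)[OF x(1)] u by simp
    have "row p \<subseteq> T"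
    proof
      fix y assume "y \<in> row p"
      then have "e p \<otimes> y = y" "y \<in> carrier L" by (simp_all add: row_def)
      with TD(5)[OF \<open>e p \<in> T\<close>] show "y \<in> T" by metis
    qed
    with T(2) show ?thesis by blast
  qed simp
qed

lemma semisimple: "semisimple_module L (right_regular L)"
proof -
  let ?T = "sum_of_submodules (right_regular L) {S. simple_right_ideal S}"
  have T1: "right_ideal ?T"
    by (rule sum_of_right_ideals) (simp add: simple_right_ideal_iff)
  have T2: "S \<subseteq> ?T" if "simple_right_ideal S" for S
    using that by (intro sum_of_right_ideals) (simp_all add: simple_right_ideal_iff)
  have "x \<in> ?T" if x: "x \<in> carrier L" for x
  proof -
    let ?F = "{p. \<exists>q. c x p q \<noteq> 0}"
    have F: "?F \<subseteq> P" using c_support[OF x] by blast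
    have "e p \<otimes> x \<in> ?T" if "p \<in> P" for p
      using T2[OF simple_row[OF that]] e_mult_in_row[OF that x] by auto
    then have "(\<lambda>p. e p \<otimes> x) \<in> ?F \<rightarrow> ?T" using F by blast
    then have "(\<Oplus>p\<in>?F. e p \<otimes> x) \<in> ?T" by (rule right_ideal_finsum[OF T1 finite_rows[OF x]])
    moreover have "x = (\<Oplus>p\<in>?F. e p \<otimes> x)"
      by (rule sum_of_rows[OF x finite_rows[OF x] F]) blast
    ultimately show ?thesis by simp
  qed
  then show ?thesis using right_idealD(1)[OF T1] by (auto simp: semisimple_module_def)
qed

definition block_ideal :: "'p \<Rightarrow> 'a set" where
  "block_ideal p = {x\<in>carrier L. \<forall>p' q. b p' \<noteq> b p \<longrightarrow> c x p' q = 0}"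

lemma right_ideal_block_ideal: "right_ideal (block_ideal p)"
proof -
  have m: "c (\<ominus> x) p' q = - c x p' q" if "x \<in> carrier L" for x p' q
    using c_smult[OF that, of "- 1"] that by (simp add: smult_minus_one)
  show ?thesis
    unfolding right_ideal_iff
  proof (intro conjI ballI)
    fix x a assume "x \<in> block_ideal p" "a \<in> carrier L"
    then show "x \<otimes> a \<in> block_ideal p" by (simp add: block_ideal_def c_mult')
  qed (auto simp: block_ideal_def c_add m)
qed

text \<open>A nonzero entry in row p is moved by \<open>unit p' p\<close> into row p', so by Schur's
  lemma S is isomorphic to \<open>row p'\<close>. A simple right ideal is thus isomorphic to all
  rows of any block it touches.\<close>

lemma image_in_row:
  assumes S: "simple_right_ideal S" and x: "x \<in> S" and xpq: "c x p q \<noteq> 0" and p': "p' \<in> block p"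
  shows "(\<otimes>) (unit p' p) ` S = row p'" and "isomorphic_submodules L (right_regular L) S (row p')"
    and "\<And>s. s \<in> S \<Longrightarrow> unit p' p \<otimes> s = \<zero> \<Longrightarrow> s = \<zero>"
proof -
  have rS: "right_ideal S" using S by (simp add: simple_right_ideal_iff)
  note SD = right_idealD[OF rS]
  have pP: "p \<in> P" using c_support[OF SD(6)[OF x] xpq] by simp
  with p' have p: "p' \<in> P" "p \<in> block p'" by auto
  note u = unit_closed[OF p]
  have nz: "unit p' p \<otimes> x \<noteq> \<zero>"
    using c_unit_mult[OF p SD(6)[OF x], of p' q] xpq by auto
  note im = simple_image[OF S, of "(\<otimes>) (unit p' p)" x]
  have im1: "simple_right_ideal ((\<otimes>) (unit p' p) ` S)"
    and im2: "isomorphic_submodules L (right_regular L) S ((\<otimes>) (unit p' p) ` S)"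
    by (rule im; use u SD x nz in \<open>simp add: r_distr m_assoc\<close>)+
  have "e p' \<otimes> (unit p' p \<otimes> s) = unit p' p \<otimes> s" if "s \<in> S" for s
    using u unit_closed[of p' p'] p unit_mult_unit[of p' p' p] SD(6)[OF that]
    by (simp add: m_assoc[symmetric])
  then have "(\<otimes>) (unit p' p) ` S \<subseteq> row p'" using SD u by (auto simp: row_def)
  then show eq: "(\<otimes>) (unit p' p) ` S = row p'"
    using im1 simple_row[OF p(1)] unfolding simple_right_ideal_iff by blast
  then show "isomorphic_submodules L (right_regular L) S (row p')" using im2 by simp
  fix s assume s: "s \<in> S" "unit p' p \<otimes> s = \<zero>"
  have "right_ideal {s \<in> S. unit p' p \<otimes> s = \<zero>}"
    using SD u by (auto simp: right_ideal_iff r_distr r_minus m_assoc[symmetric])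
  moreover have "{s \<in> S. unit p' p \<otimes> s = \<zero>} \<noteq> S" using x nz by auto
  ultimately have "{s \<in> S. unit p' p \<otimes> s = \<zero>} = {\<zero>}"
    using S unfolding simple_right_ideal_iff by blast
  then show "s = \<zero>" using s by auto
qed

text \<open>The component contains all rows of the block, hence the block ideal. Conversely an
  isomorphism from S onto T is left multiplication by an element supported in the single column p,
  and such a product cannot leave the block.\<close>

lemma component_eq_block_ideal:
  assumes S: "simple_right_ideal S"
  shows "\<exists>p\<in>P. component S = block_ideal p"
proof -
  have rS: "right_ideal S" and S0: "S \<noteq> {\<zero>}" using S by (auto simp: simple_right_ideal_iff)
  note SD = right_idealD[OF rS]
  obtain x where x: "x \<in> S" "x \<noteq> \<zero>" using SD(2) S0 by auto
  then obtain p q where pq: "c x p q \<noteq> 0" using c_nonzero SD(6) by blast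
  have p: "p \<in> P" using c_support[OF SD(6)[OF x(1)] pq] by simp
  note ep = unit_closed[of p p]
  have rows: "row p' \<subseteq> component S" if "p' \<in> block p" for p'
  proof -
    from that have "p' \<in> P" by simp
    from component_props(2)[OF simple_row[OF this] image_in_row(2)[OF S x(1) pq that]]
    show ?thesis .
  qed
  note im = image_in_row[OF S x(1) pq, of p]
  have "component S \<subseteq> block_ideal p"
  proof (rule component_props(3)[OF right_ideal_block_ideal], rule subsetI)
    fix T t assume T: "simple_right_ideal T" "isomorphic_submodules L (right_regular L) S T"
      and t: "t \<in> T"
    obtain f where f: "bij_betw f S T"
      and fm: "\<forall>x\<in>S. \<forall>a\<in>carrier L. f (x \<otimes> a) = f x \<otimes> a"
      using T(2) unfolding isomorphic_submodules_iff by blast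
    have TL: "T \<subseteq> carrier L" using T(1) by (simp add: simple_right_ideal_iff right_ideal_iff)
    obtain s where s: "s \<in> S" "t = f s" using f t unfolding bij_betw_def by blast
    have "e p \<in> row p" using p ep unit_mult_unit[of p p p] by (simp add: row_def)
    then have "e p \<in> (\<otimes>) (e p) ` S" using im(1) p by simp
    \<comment> \<open>Then s = s0 (e p s) for every s in S: the difference lies in S and is killed
      by \<open>e p\<close>, which is injective on S. Applying f gives f s = (f s0 e p) s.\<close>
    then obtain s0 where s0: "s0 \<in> S" "e p = e p \<otimes> s0" by blast
    have epL: "e p \<in> carrier L" using ep p by simp
    have "e p \<otimes> (s \<ominus> s0 \<otimes> (e p \<otimes> s)) = e p \<otimes> s \<ominus> e p \<otimes> s0 \<otimes> (e p \<otimes> s)"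
      using SD(6)[OF s(1)] SD(6)[OF s0(1)] epL by (simp add: r_diff_distr m_assoc)
    also have "e p \<otimes> s0 \<otimes> (e p \<otimes> s) = e p \<otimes> (e p \<otimes> s)" using s0(2) by simp
    also have "\<dots> = e p \<otimes> s" using unit_mult_unit[of p p p] p epL SD(6)[OF s(1)]
      by (simp add: m_assoc[symmetric])
    finally have "e p \<otimes> (s \<ominus> s0 \<otimes> (e p \<otimes> s)) = \<zero>"
      using SD(6)[OF s(1)] epL by (simp add: diff_eq_zero_iff)
    moreover have "s \<ominus> s0 \<otimes> (e p \<otimes> s) \<in> S"
      unfolding a_minus_def using SD(3,4,5) s s0 epL SD(6)[OF s(1)] by simp
    ultimately have "s = s0 \<otimes> (e p \<otimes> s)"
      using im(3)[of "s \<ominus> s0 \<otimes> (e p \<otimes> s)"] p SD(6)[OF s(1)] SD(6)[OF s0(1)] epL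
      by (simp add: diff_eq_zero_iff)
    then have "t = f s0 \<otimes> (e p \<otimes> s)"
      using fm[rule_format, OF s0(1), of "e p \<otimes> s"] epL SD(6)[OF s(1)] s(2) by simp
    moreover have "f s0 \<in> carrier L" using f s0 TL by (auto simp: bij_betw_def)
    ultimately have teq: "t = f s0 \<otimes> e p \<otimes> s" and fs0: "f s0 \<otimes> e p \<in> carrier L"
      and "f s0 \<in> carrier L"
      using epL SD(6)[OF s(1)] by (simp_all add: m_assoc)
    then have col: "c (f s0 \<otimes> e p) p' r = (if r = p then c (f s0) p' p else 0)" for p' r
      using p by (intro c_mult_unit) auto
    have "b p' = b p" if ct: "c t p' r \<noteq> 0" for p' r
    proof (rule ccontr)
      assume "b p' \<noteq> b p"
      then have "c (f s0 \<otimes> e p) p' r' = 0" if "r' \<in> block p'" for r'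
        using that col by auto
      then have "c t p' r = 0" unfolding teq using fs0 SD(6)[OF s(1)] by (simp add: c_mult')
      with ct show False by contradiction
    qed
    then show "t \<in> block_ideal p" using t TL unfolding block_ideal_def by blast
  qed
  moreover have "block_ideal p \<subseteq> component S"
  proof
    fix y assume y: "y \<in> block_ideal p"
    then have yL: "y \<in> carrier L" by (simp add: block_ideal_def)
    have yb: "\<And>p' q. c y p' q \<noteq> 0 \<Longrightarrow> p' \<in> block p"
      using y c_support[OF yL] unfolding block_ideal_def by blast
    have "(\<lambda>p'. e p' \<otimes> y) \<in> block p \<rightarrow> component S"
      using rows e_mult_in_row[OF _ yL] by blast
    then have "(\<Oplus>p'\<in>block p. e p' \<otimes> y) \<in> component S"
      by (rule right_ideal_finsum[OF component_props(1) finite_block[OF p]])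
    moreover have "y = (\<Oplus>p'\<in>block p. e p' \<otimes> y)"
      by (rule sum_of_rows[OF yL finite_block[OF p] _ yb]) auto
    ultimately show "y \<in> component S" by simp
  qed
  ultimately show ?thesis using p by blast
qed

end

text \<open>
  Descending chains of subspaces of a finite-dimensional coordinate space are stationary:
  compare the subspaces \<open>{x. x j = 0}\<close> of the chain and whether the coordinate \<open>j\<close> is a pivot.
\<close>

lemma coordinate_subspaces_dcc:
  fixes V :: "nat \<Rightarrow> ('j \<Rightarrow> 'k::field) set"
  assumes "finite B" and "\<And>n. V (Suc n) \<subseteq> V n"
    and "\<And>n x y. x \<in> V n \<Longrightarrow> y \<in> V n \<Longrightarrow> (\<lambda>j. x j + y j) \<in> V n"
    and "\<And>n x k. x \<in> V n \<Longrightarrow> (\<lambda>j. k * x j) \<in> V n"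
    and "\<And>n. (\<lambda>j. 0) \<in> V n"
    and "\<And>n x j. x \<in> V n \<Longrightarrow> j \<notin> B \<Longrightarrow> x j = 0"
  shows "\<exists>n. \<forall>m\<ge>n. V m = V n"
  using assms
proof (induction B arbitrary: V rule: finite_induct)
  case empty
  then have "V n = {\<lambda>j. 0}" for n by (auto simp: fun_eq_iff)
  then show ?case by auto
next
  case (insert j B)
  note V = insert.prems
  have "\<exists>n. \<forall>m\<ge>n. {x \<in> V m. x j = 0} = {x \<in> V n. x j = 0}"
  proof (rule insert.IH)
    fix n x i assume "x \<in> {x \<in> V n. x j = 0}" "i \<notin> B"
    then show "x i = 0" using V(5)[of x n i] by (cases "i = j") auto
  qed (use V in auto)
  then obtain n where n: "\<And>m. m \<ge> n \<Longrightarrow> {x \<in> V m. x j = 0} = {x \<in> V n. x j = 0}" by blast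
  have mono: "V m' \<subseteq> V m" if "m \<le> m'" for m m'
    using lift_Suc_antimono_le[of V m m', OF V(1) that] .
  \<comment> \<open>If coordinate j is still attained at level m', a multiple of y clears it in any
    x of V m, and the remainder lies in the part x j = 0 of the chain, which is already
    stationary.\<close>
  have pivot: "V m = V m'" if "n \<le> m" "m \<le> m'" and y: "y \<in> V m'" "y j \<noteq> 0" for m m' y
  proof
    show "V m' \<subseteq> V m" using mono that by blast
    show "V m \<subseteq> V m'"
    proof
      fix x assume x: "x \<in> V m"
      let ?z = "\<lambda>i. x i + (- x j / y j) * y i"
      have "y \<in> V m" using mono[OF that(2)] y(1) by (rule subsetD)
      then have "?z \<in> V m" by (rule V(2)[OF x V(3)])
      then have "?z \<in> {x \<in> V m. x j = 0}" using y by simp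
      also have "\<dots> = {x \<in> V m'. x j = 0}" using n[of m] n[of m'] that(1,2) by simp
      finally have "?z \<in> V m'" by simp
      then have "(\<lambda>i. ?z i + (x j / y j) * y i) \<in> V m'" by (rule V(2)[OF _ V(3)[OF y(1)]])
      then show "x \<in> V m'" by simp
    qed
  qed
  show ?case
  proof (cases "\<forall>m\<ge>n. \<exists>y\<in>V m. y j \<noteq> 0")
    case True
    have "V m = V n" if m: "m \<ge> n" for m
    proof -
      from True m obtain y where "y \<in> V m" "y j \<noteq> 0" by blast
      from pivot[OF order_refl m this] show ?thesis by simp
    qed
    then show ?thesis by blast
  next
    case False
    then obtain m where m: "m \<ge> n" "\<forall>y\<in>V m. y j = 0" by auto
    have "V m' = V m" if "m' \<ge> m" for m'
    proof -
      have "{x \<in> V m'. x j = 0} = {x \<in> V m. x j = 0}" using n[of m] n[of m'] m(1) that by simp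
      then show ?thesis using m(2) mono[OF that] by blast
    qed
    then show ?thesis by blast
  qed
qed

section \<open>The homogeneous components are artinian rings\<close>

context block_coordinates
begin

text \<open>A finite block has a unit u, and k x = (k u) x = x (k u) shows that one-sided ideals of
  the component are K-subspaces. They sit in a space of finite dimension.\<close>

lemma block_ideal_artinian:
  assumes p: "p \<in> P"
  shows "artinian_ring (L\<lparr>carrier := block_ideal p\<rparr>)"
proof -
  let ?H = "L\<lparr>carrier := block_ideal p\<rparr>"
  interpret H: nonunital_ring ?H
    by (rule nonunital_ring_right_ideal(1)[OF right_ideal_block_ideal])
  have "\<exists>u\<in>carrier L. c u = (\<lambda>q r. if q = r \<and> q \<in> block p then 1 else 0)"
  proof (rule c_surj)
    show "finite {(q, r). (if q = r \<and> q \<in> block p then 1 else 0 :: 'k) \<noteq> 0}"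
      by (rule finite_subset[OF _ finite_cartesian_product[OF finite_block[OF p] finite_block[OF p]]])
        (auto split: if_splits)
  qed (auto split: if_splits)
  then obtain u where u: "u \<in> carrier L"
    and cu: "\<And>q r. c u q r = (if q = r \<and> q \<in> block p then 1 else 0)"
    by auto
  have blk: "q \<in> block p \<and> r \<in> block p" if "x \<in> block_ideal p" "c x q r \<noteq> 0" for x q r
  proof -
    have "x \<in> carrier L" "b q = b p" using that unfolding block_ideal_def by blast+
    then show ?thesis using c_support[of x q r] that(2) by simp
  qed
  have ux: "(k \<odot> u) \<otimes> x = k \<odot> x" and xu: "x \<otimes> (k \<odot> u) = k \<odot> x" if x: "x \<in> block_ideal p" for k x
  proof -
    have xL: "x \<in> carrier L" using x by (rule right_idealD(6)[OF right_ideal_block_ideal])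
    have cx: "(if q \<in> block p then c x q r else 0) = c x q r"
      "(if r \<in> block p then c x q r else 0) = c x q r" for q r
      using blk[OF x, of q r] by auto
    have "c u q s * c x s r = (if s = q then c x q r else 0)" for q r s
      using cx(1)[of q r] by (auto simp: cu)
    then have "c (u \<otimes> x) q r = c x q r" for q r
      using c_support[OF xL, of q r] finite_block[of q] xL u by (auto simp: c_mult')
    then have "u \<otimes> x = x" using u xL by (intro c_eqI) auto
    moreover have "c x q s * c u s r = (if s = r then c x q r else 0)" for q r s
      using cx(2)[of r q] by (auto simp: cu)
    then have "c (x \<otimes> u) q r = c x q r" for q r
      using c_support[OF xL, of q r] finite_block[of q] xL u
      by (cases "c x q r = 0") (auto simp: c_mult')
    then have "x \<otimes> u = x" using u xL by (intro c_eqI) auto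
    ultimately show "(k \<odot> u) \<otimes> x = k \<odot> x" "x \<otimes> (k \<odot> u) = k \<odot> x"
      using u xL by (simp_all add: smult_mult_l smult_mult_r)
  qed
  have kuH: "k \<odot> u \<in> block_ideal p" for k
    using u by (auto simp: block_ideal_def c_smult cu split: if_splits)
  have dcc: "\<exists>n. \<forall>m\<ge>n. I m = I n"
    if I: "\<And>n. I (Suc n) \<subseteq> I n" "\<And>n. I n \<subseteq> block_ideal p" "\<And>n. \<zero> \<in> I n"
      "\<And>n x y. x \<in> I n \<Longrightarrow> y \<in> I n \<Longrightarrow> x \<oplus> y \<in> I n" "\<And>n x k. x \<in> I n \<Longrightarrow> k \<odot> x \<in> I n"
    for I :: "nat \<Rightarrow> 'a set"
  proof -
    have IL: "x \<in> carrier L" if "x \<in> I n" for x n using I(2) that by (auto simp: block_ideal_def)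
    define d where "d x = (\<lambda>(q, r). c x q r)" for x
    have "\<exists>n. \<forall>m\<ge>n. d ` I m = d ` I n"
    proof (rule coordinate_subspaces_dcc[of "block p \<times> block p"])
      show "(\<lambda>j. 0) \<in> d ` I n" for n
        using I(3)[of n] by (intro image_eqI[of _ _ \<zero>]) (auto simp: d_def fun_eq_iff)
      fix n x k assume "x \<in> d ` I n"
      then obtain x' where x': "x' \<in> I n" "x = d x'" by auto
      then show "(\<lambda>j. k * x j) \<in> d ` I n"
        using I(5)[of x' n k] IL by (intro image_eqI[of _ _ "k \<odot> x'"]) (auto simp: d_def fun_eq_iff c_smult)
      show "x j = 0" if "j \<notin> block p \<times> block p" for j
      proof -
        have "x' \<in> block_ideal p" using I(2) x'(1) by (rule subsetD)
        from blk[OF this, of "fst j" "snd j"] show ?thesis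
          using that by (cases j) (auto simp: d_def x'(2))
      qed
      fix y assume "y \<in> d ` I n"
      then obtain y' where y': "y' \<in> I n" "y = d y'" by auto
      then show "(\<lambda>j. x j + y j) \<in> d ` I n"
        using I(4)[of x' n y'] x' IL
        by (intro image_eqI[of _ _ "x' \<oplus> y'"]) (auto simp: d_def fun_eq_iff c_add)
    qed (use I(1) finite_block[OF p] in auto)
    then obtain n where n: "\<And>m. m \<ge> n \<Longrightarrow> d ` I m = d ` I n" by blast
    have "inj_on d (carrier L)"
      by (auto intro!: inj_onI c_eqI simp: d_def fun_eq_iff)
    then have "I m = I n" if "m \<ge> n" for m
      using n[OF that] inj_on_image_eq_iff[of d "carrier L" "I m" "I n"] IL by blast
    then show ?thesis by blast
  qed
  show ?thesis
    unfolding artinian_ring_def artinian_module_def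
  proof (intro conjI allI impI)
    fix I :: "nat \<Rightarrow> 'a set"
    assume "\<forall>n. submodule (I n) ?H (left_regular ?H) \<and> I (Suc n) \<subseteq> I n"
    then show "\<exists>n. \<forall>m\<ge>n. I m = I n"
      using kuH ux by (intro dcc) (auto simp: H.left_submodule_iff subset_iff, metis)
  next
    fix I :: "nat \<Rightarrow> 'a set"
    assume "\<forall>n. submodule (I n) ?H (right_regular ?H) \<and> I (Suc n) \<subseteq> I n"
    then have "\<forall>n. H.right_ideal (I n) \<and> I (Suc n) \<subseteq> I n" by (simp add: H.right_ideal_def)
    then show "\<exists>n. \<forall>m\<ge>n. I m = I n"
      using kuH xu by (intro dcc) (auto simp: H.right_ideal_iff subset_iff, metis)
  qed
qed

theorem artinian_semisimple: artinian_semisimple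
  unfolding artinian_semisimple_def
  using semisimple component_eq_block_ideal block_ideal_artinian by metis

end

section \<open>Self-injectivity of the endomorphism ring of an algebra of block matrices\<close>

text \<open>Scalar multiplication is a parameter with axioms on V only, because it will be the
  action of k times the matrix unit at (q, q), and this idempotent acts as identity only on its
  image. The extension comes from Zorn's lemma.\<close>

lemma functional_extension:
  fixes G (structure) and sc :: "'k::field \<Rightarrow> 'y \<Rightarrow> 'y" and f :: "'y \<Rightarrow> 'k"
  assumes "abelian_group G" and V: "V \<subseteq> carrier G" "\<zero> \<in> V"
    and V_add: "\<And>x y. x \<in> V \<Longrightarrow> y \<in> V \<Longrightarrow> x \<oplus> y \<in> V" and V_sc: "\<And>k x. x \<in> V \<Longrightarrow> sc k x \<in> V"
    and sc_add: "\<And>k l x. x \<in> V \<Longrightarrow> sc (k + l) x = sc k x \<oplus> sc l x"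
    and sc_distr: "\<And>k x y. x \<in> V \<Longrightarrow> y \<in> V \<Longrightarrow> sc k (x \<oplus> y) = sc k x \<oplus> sc k y"
    and sc_mult: "\<And>k l x. x \<in> V \<Longrightarrow> sc (k * l) x = sc k (sc l x)"
    and sc_one: "\<And>x. x \<in> V \<Longrightarrow> sc 1 x = x"
    and U: "U \<subseteq> V" "\<zero> \<in> U" "\<And>x y. x \<in> U \<Longrightarrow> y \<in> U \<Longrightarrow> x \<oplus> y \<in> U"
      "\<And>k x. x \<in> U \<Longrightarrow> sc k x \<in> U"
    and f_add: "\<And>x y. x \<in> U \<Longrightarrow> y \<in> U \<Longrightarrow> f (x \<oplus> y) = f x + f y"
    and f_sc: "\<And>k x. x \<in> U \<Longrightarrow> f (sc k x) = k * f x"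
  shows "\<exists>g. (\<forall>x\<in>U. g x = f x) \<and> (\<forall>x\<in>V. \<forall>y\<in>V. g (x \<oplus> y) = g x + g y) \<and>
    (\<forall>k. \<forall>x\<in>V. g (sc k x) = k * g x)"
proof -
  interpret abelian_group G by fact
  have VG: "x \<in> V \<Longrightarrow> x \<in> carrier G" for x using V by blast
  have sc0: "sc 0 x = \<zero>" if "x \<in> V" for x
  proof -
    have "sc 0 x \<oplus> sc 0 x = sc 0 x" using sc_add[OF that, of 0 0] by simp
    then show ?thesis using VG[OF V_sc[OF that, of 0]] by simp
  qed
  have sc_neg: "sc (- k) x = \<ominus> sc k x" if "x \<in> V" for k x
  proof -
    have "sc (- k) x \<oplus> sc k x = \<zero>" using sc_add[OF that, of "- k" k] sc0[OF that] by simp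
    then show ?thesis using VG[OF V_sc[OF that]] by (simp add: minus_equality)
  qed
  \<comment> \<open>A linear relation that relates zero only to 0 is the graph of a partial
    functional. With graphs, upper bounds of chains are plain unions.\<close>
  define lin where "lin S \<longleftrightarrow> S \<subseteq> V \<times> UNIV \<and> (\<forall>x a y b. (x, a) \<in> S \<longrightarrow> (y, b) \<in> S \<longrightarrow>
    (x \<oplus> y, a + b) \<in> S) \<and> (\<forall>x a k. (x, a) \<in> S \<longrightarrow> (sc k x, k * a) \<in> S) \<and>
    (\<forall>a. (\<zero>, a) \<in> S \<longrightarrow> a = 0)" for S :: "('y \<times> 'k) set"
  have linD: "x \<in> V" "(x \<oplus> y, a + b') \<in> S" "(sc k x, k * a) \<in> S"
    if "lin S" "(x, a) \<in> S" "(y, b') \<in> S" for S x a y b' k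
    using that unfolding lin_def by blast+
  have lin_zero: "a = 0" if "lin S" "(\<zero>, a) \<in> S" for S a
    using that unfolding lin_def by blast
  define D where "D = (\<lambda>x. (x, f x)) ` U"
  have f0: "f \<zero> = 0" using f_sc[OF U(2), of 0] sc0[OF V(2)] by simp
  have linD0: "lin D" using U f_add f_sc f0 by (auto simp: lin_def D_def)
  have "\<exists>M\<in>{S. lin S \<and> D \<subseteq> S}. \<forall>X\<in>{S. lin S \<and> D \<subseteq> S}. M \<subseteq> X \<longrightarrow> X = M"
  proof (rule subset_Zorn_nonempty)
    show "{S. lin S \<and> D \<subseteq> S} \<noteq> {}" using linD0 by blast
    fix \<C> assume ne: "\<C> \<noteq> {}" and chain: "subset.chain {S. lin S \<and> D \<subseteq> S} \<C>"
    have C: "\<And>S. S \<in> \<C> \<Longrightarrow> lin S" "\<And>S. S \<in> \<C> \<Longrightarrow> D \<subseteq> S"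
      and tot: "\<And>S T. S \<in> \<C> \<Longrightarrow> T \<in> \<C> \<Longrightarrow> S \<subseteq> T \<or> T \<subseteq> S"
      using chain by (auto simp: subset_chain_def)
    have "lin (\<Union>\<C>)"
      unfolding lin_def
    proof (intro conjI allI impI)
      show "\<Union>\<C> \<subseteq> V \<times> UNIV" using C(1) unfolding lin_def by blast
      show "(sc k x, k * a) \<in> \<Union>\<C>" if "(x, a) \<in> \<Union>\<C>" for x a k
      proof -
        from that obtain S where S: "S \<in> \<C>" "(x, a) \<in> S" by blast
        from linD(3)[OF C(1)[OF S(1)] S(2) S(2)] S(1) show ?thesis by blast
      qed
      show "a = 0" if "(\<zero>, a) \<in> \<Union>\<C>" for a
        using that lin_zero[OF C(1)] by blast
      fix x a y b assume "(x, a) \<in> \<Union>\<C>" "(y, b) \<in> \<Union>\<C>"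
      then obtain S T where ST: "S \<in> \<C>" "T \<in> \<C>" "(x, a) \<in> S" "(y, b) \<in> T" by (elim UnionE)
      from tot[OF ST(1,2)] have W: "S \<union> T \<in> \<C>"
        using ST(1,2) by (auto simp: Un_absorb1 Un_absorb2)
      have "(x \<oplus> y, a + b) \<in> S \<union> T"
        using ST(3,4) by (intro linD(2)[OF C(1)[OF W]]) simp_all
      with W show "(x \<oplus> y, a + b) \<in> \<Union>\<C>" by (rule UnionI)
    qed
    then show "\<Union>\<C> \<in> {S. lin S \<and> D \<subseteq> S}" using ne C(2) by blast
  qed
  then obtain M where M': "M \<in> {S. lin S \<and> D \<subseteq> S}" "\<forall>X\<in>{S. lin S \<and> D \<subseteq> S}. M \<subseteq> X \<longrightarrow> X = M"
    by (rule bexE)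
  have M: "lin M" "D \<subseteq> M" using M'(1) by simp_all
  have max: "X = M" if "lin X" "D \<subseteq> X" "M \<subseteq> X" for X using M'(2) that by simp
  have uniq: "a = a'" if "(x, a) \<in> M" "(x, a') \<in> M" for x a a'
  proof -
    have x: "x \<in> V" using linD(1)[OF M(1) that] .
    have "(x \<oplus> sc (- 1) x, a + (- 1) * a') \<in> M"
      by (rule linD(2)[OF M(1) that(1) linD(3)[OF M(1) that(2,2)]])
    also have "x \<oplus> sc (- 1) x = \<zero>" using VG[OF x] by (simp add: sc_neg[OF x] sc_one[OF x] r_neg)
    finally show ?thesis using lin_zero[OF M(1)] by force
  qed
  have 00: "(\<zero>, 0) \<in> M" using M(2) U(2) f0 by (force simp: D_def)
  have total: "\<exists>a. (y, a) \<in> M" if y: "y \<in> V" for y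
  proof (rule ccontr)
    assume no: "\<nexists>a. (y, a) \<in> M"
    \<comment> \<open>Extension of M by the one vector y, which receives the value 0. A
      representation of zero with k \<noteq> 0 would place y in the domain of M.\<close>
    define X where "X = {(x \<oplus> sc k y, a) | x a k. (x, a) \<in> M}"
    have XI: "(x, a) \<in> M \<Longrightarrow> z = x \<oplus> sc k y \<Longrightarrow> (z, a) \<in> X" for x a k z
      by (auto simp: X_def)
    have MX: "M \<subseteq> X"
    proof clarify
      fix x a assume x: "(x, a) \<in> M"
      then show "(x, a) \<in> X"
        using XI[OF x, of x 0] sc0[OF y] VG[OF linD(1)[OF M(1) x x]] by simp
    qed
    have "lin X"
      unfolding lin_def
    proof (intro conjI allI impI)
      show "X \<subseteq> V \<times> UNIV" using linD(1)[OF M(1)] V_add V_sc[OF y] by (auto simp: X_def)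
      show "a = 0" if aX: "(\<zero>, a) \<in> X" for a
      proof -
        obtain x k where xk: "(x, a) \<in> M" "\<zero> = x \<oplus> sc k y" using aX by (auto simp: X_def)
        have x: "x \<in> V" using linD(1)[OF M(1) xk(1) xk(1)] .
        show ?thesis
      proof (cases "k = 0")
        case True
        then show ?thesis
          using xk sc0[OF y] VG[OF x] lin_zero[OF M(1)] by auto
      next
        case False
        have "sc k y = \<ominus> x"
          using xk(2) VG[OF x] VG[OF V_sc[OF y]] by (metis a_comm minus_equality minus_minus)
        then have "y = sc (inverse k) (sc (- 1) x)"
          using sc_mult[OF y, of "inverse k" k] sc_one[OF y] False sc_neg[OF x, of 1] sc_one[OF x]
          by simp
        moreover have "(sc (inverse k) (sc (- 1) x), inverse k * (- 1 * a)) \<in> M"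
          by (rule linD(3)[OF M(1) linD(3)[OF M(1) xk(1) xk(1)] xk(1)])
        ultimately have "(y, inverse k * (- 1 * a)) \<in> M" by (simp only:)
        then show ?thesis using no by blast
      qed
      qed
      fix z a assume "(z, a) \<in> X"
      then obtain x k where xk: "(x, a) \<in> M" "z = x \<oplus> sc k y" by (auto simp: X_def)
      have x: "x \<in> V" using linD(1)[OF M(1) xk(1) xk(1)] .
      show "(sc l z, l * a) \<in> X" for l
      proof (rule XI[OF linD(3)[OF M(1) xk(1) xk(1)]])
        show "sc l z = sc l x \<oplus> sc (l * k) y"
          unfolding xk(2) sc_distr[OF x V_sc[OF y]] sc_mult[OF y] ..
      qed
      fix z' a' assume "(z', a') \<in> X"
      then obtain x' k' where xk': "(x', a') \<in> M" "z' = x' \<oplus> sc k' y" by (auto simp: X_def)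
      have x': "x' \<in> V" using linD(1)[OF M(1) xk'(1) xk'(1)] .
      have "z \<oplus> z' = (x \<oplus> x') \<oplus> sc (k + k') y"
        using VG[OF x] VG[OF x'] VG[OF V_sc[OF y]] by (simp add: xk xk' sc_add[OF y] a_ac)
      then show "(z \<oplus> z', a + a') \<in> X"
        by (rule XI[OF linD(2)[OF M(1) xk(1) xk'(1)]])
    qed
    then have "X = M" using max MX M(2) by blast
    moreover have "(y, 0) \<in> X" using XI[OF 00, of y 1] sc_one[OF y] VG[OF y] by simp
    ultimately show False using no by blast
  qed
  define g where "g x = (THE a. (x, a) \<in> M)" for x
  have g: "g x = a" if "(x, a) \<in> M" for x a
    unfolding g_def using that uniq by blast
  have gM: "(x, g x) \<in> M" if "x \<in> V" for x
  proof -
    from total[OF that] obtain a where "(x, a) \<in> M" ..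
    then show ?thesis using g[of x a] by simp
  qed
  have "g x = f x" if "x \<in> U" for x using that M(2) by (intro g) (auto simp: D_def)
  moreover have "g (x \<oplus> y) = g x + g y" if "x \<in> V" "y \<in> V" for x y
    using that by (intro g linD(2)[OF M(1) gM gM])
  moreover have "g (sc k x) = k * g x" if "x \<in> V" for x k
    using linD(3)[OF M(1) gM[OF that] gM[OF that]] by (intro g)
  ultimately show ?thesis by blast
qed

lemma (in left_module) smult_zero_l: "x \<in> carrier M \<Longrightarrow> \<zero>\<^bsub>R\<^esub> \<odot>\<^bsub>M\<^esub> x = \<zero>\<^bsub>M\<^esub>"
  using smult_l_distr[of "\<zero>\<^bsub>R\<^esub>" "\<zero>\<^bsub>R\<^esub>" x] smult_closed[of "\<zero>\<^bsub>R\<^esub>" x] by simp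

lemma (in left_module) smult_zero_r: "a \<in> carrier R \<Longrightarrow> a \<odot>\<^bsub>M\<^esub> \<zero>\<^bsub>M\<^esub> = \<zero>\<^bsub>M\<^esub>"
  using smult_r_distr[of a "\<zero>\<^bsub>M\<^esub>" "\<zero>\<^bsub>M\<^esub>"] smult_closed[of a "\<zero>\<^bsub>M\<^esub>"] by simp

section \<open>Endomorphisms as block matrices with unrestricted support\<close>

context block_coordinates
begin

text \<open>F (e q) = F (e q) e q has only column q, and these columns describe F. Outside P, where
  \<open>e q\<close> is unspecified, the entry is set to 0.\<close>

definition entry :: "('a \<Rightarrow> 'a) \<Rightarrow> 'p \<Rightarrow> 'p \<Rightarrow> 'k" where
  "entry F p q = (if q \<in> P then c (F (e q)) p q else 0)"

lemma eL: "q \<in> P \<Longrightarrow> e q \<in> carrier L"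
  by (simp add: unit_closed)

text \<open>With E the finite sum of the \<open>e p\<close> over the nonzero rows of x one has x = E
  x and so F x = (F E) x. On these rows the columns of F E agree with the entries of F.\<close>

lemma c_End:
  assumes F: "F \<in> carrier End_right" and x: "x \<in> carrier L"
  shows "c (F x) p s = (if p \<in> P then \<Sum>r\<in>block p. entry F p r * c x r s else 0)"
proof (cases "p \<in> P")
  case True
  note FD = End_rightD[OF F]
  let ?R = "{p. \<exists>q. c x p q \<noteq> 0}"
  let ?E = "\<Oplus>p\<in>?R. e p"
  have R: "?R \<subseteq> P" using c_support[OF x] by blast
  have ecl: "e \<in> ?R \<rightarrow> carrier L" using R eL by blast
  then have E: "?E \<in> carrier L" by simp
  have "x = (\<Oplus>p\<in>?R. e p \<otimes> x)"
    by (rule sum_of_rows[OF x finite_rows[OF x] R]) blast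
  then have Ex: "?E \<otimes> x = x" by (simp add: finsum_l_distr[OF finite_rows[OF x] ecl x])
  have Ee: "?E \<otimes> e r = e r" if "r \<in> ?R" for r
  proof -
    have rP: "r \<in> P" using R that by blast
    show ?thesis
    proof (rule c_eqI)
      show "?E \<otimes> e r \<in> carrier L" "e r \<in> carrier L" using E eL[OF rP] by auto
      fix p q
      have "c (?E \<otimes> e r) p q = (if q = r then c ?E p r else 0)"
        using rP E by (intro c_mult_unit) auto
      also have "c ?E p r = (\<Sum>s\<in>?R. if s = r then (if p = r then 1 else 0) else 0)"
        unfolding c_finsum[OF finite_rows[OF x] ecl] using R by (intro sum.cong) (auto simp: c_unit subset_iff)
      also have "\<dots> = (if p = r then 1 else 0)"
        using finite_rows[OF x] that by (simp only: sum.delta) simp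
      finally show "c (?E \<otimes> e r) p q = c (e r) p q" using rP by (simp add: c_unit)
    qed
  qed
  have eqr: "entry F p r * c x r s = c (F ?E) p r * c x r s" for r
  proof (cases "c x r s = 0")
    case False
    then have r: "r \<in> ?R" "r \<in> P" using R by blast+
    have "F (e r) = F ?E \<otimes> e r" using FD(3)[OF E eL[OF r(2)]] Ee[OF r(1)] by simp
    then show ?thesis using r(2) c_mult_unit[of r r "F ?E" p r] FD(1)[OF E] by (simp add: entry_def)
  qed simp
  have "c (F x) p s = (\<Sum>r\<in>block p. c (F ?E) p r * c x r s)"
    using FD(3)[OF E x] c_mult'[OF FD(1)[OF E] x, of p s] True Ex by simp
  then show ?thesis using True by (simp only: eqr if_True)
next
  case False
  then show ?thesis using c_support[OF End_rightD(1)[OF F x], of p s] by auto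
qed

lemma entry_support:
  assumes "F \<in> carrier End_right" "entry F p q \<noteq> 0"
  shows "p \<in> P" "q \<in> P" "b p = b q"
  using assms c_support[OF End_rightD(1)[OF assms(1) eL], of q p q]
  by (auto simp: entry_def split: if_splits)

lemma End_eqI:
  assumes "F \<in> carrier End_right" "G \<in> carrier End_right" "\<And>p q. entry F p q = entry G p q"
  shows "F = G"
  using assms by (intro End_right_eqI c_eqI) (auto simp: c_End End_rightD(1))

lemma entry_add:
  assumes "F \<in> carrier End_right" "G \<in> carrier End_right"
  shows "entry (F \<oplus>\<^bsub>End_right\<^esub> G) p q = entry F p q + entry G p q"
  using assms eL[of q] by (simp add: entry_def End_right_simps c_add End_rightD(1))

lemma entry_mult:
  assumes "F \<in> carrier End_right" "G \<in> carrier End_right"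
  shows "entry (F \<otimes>\<^bsub>End_right\<^esub> G) p q = (if p \<in> P then \<Sum>r\<in>block p. entry F p r * entry G r q else 0)"
proof (cases "q \<in> P")
  case True
  then show ?thesis
    using assms eL[of q] by (simp add: entry_def[of _ _ q] End_right_simps c_End[OF assms(1)] End_rightD(1))
qed (simp add: entry_def)

text \<open>The support of \<open>m\<close> may be infinite: x in L has finite support and column r
  of \<open>m\<close> lives in the finite block of r, so the product of \<open>m\<close> and x has
  finite support again. Hence A is the full product of the matrix rings of the blocks.\<close>

lemma entry_surj:
  assumes m: "\<And>p q. m p q \<noteq> 0 \<Longrightarrow> p \<in> P \<and> q \<in> P \<and> b p = b q"
  shows "\<exists>F\<in>carrier End_right. \<forall>p q. entry F p q = m p q"
proof -
  define M where "M x p s = (if p \<in> P then \<Sum>r\<in>block p. m p r * c x r s else 0)" for x p s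
  have M_nz: "\<exists>r. m p r \<noteq> 0 \<and> c x r s \<noteq> 0" if "M x p s \<noteq> 0" for x p s
  proof (rule ccontr)
    assume "\<nexists>r. m p r \<noteq> 0 \<and> c x r s \<noteq> 0"
    then have "m p r * c x r s = 0" for r by auto
    then have "M x p s = 0" unfolding M_def by (simp only: sum.neutral_const if_cancel)
    then show False using that by contradiction
  qed
  have ex: "\<exists>y. y \<in> carrier L \<and> c y = M x" if x: "x \<in> carrier L" for x
  proof -
    have "\<exists>y\<in>carrier L. c y = M x"
    proof (rule c_surj)
      let ?S = "{(p, q). c x p q \<noteq> 0}"
      have "{(p, s). M x p s \<noteq> 0} \<subseteq> (\<Union>(r, s)\<in>?S. (\<lambda>p. (p, s)) ` block r)"
      proof clarify
        fix p s assume "M x p s \<noteq> 0"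
        then obtain r where r: "m p r \<noteq> 0" "c x r s \<noteq> 0" using M_nz by blast
        then show "(p, s) \<in> (\<Union>(r, s)\<in>?S. (\<lambda>p. (p, s)) ` block r)"
          using m[OF r(1)] by auto
      qed
      moreover have "finite (\<Union>(r, s)\<in>?S. (\<lambda>p. (p, s)) ` block r)"
        using c_finite[OF x] c_support[OF x] finite_block by (intro finite_UN_I) auto
      ultimately show "finite {(p, s). M x p s \<noteq> 0}" by (rule finite_subset)
      fix p s assume "M x p s \<noteq> 0"
      then obtain r where r: "m p r \<noteq> 0" "c x r s \<noteq> 0" using M_nz by blast
      then show "p \<in> P \<and> s \<in> P \<and> b p = b s" using m[OF r(1)] c_support[OF x r(2)] by auto
    qed
    then show ?thesis by blast
  qed
  define F where "F = (\<lambda>x\<in>carrier L. SOME y. y \<in> carrier L \<and> c y = M x)"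
  have F: "F x \<in> carrier L" "c (F x) = M x" if "x \<in> carrier L" for x
    using someI_ex[OF ex[OF that]] that by (simp_all add: F_def)
  have FA: "F \<in> carrier End_right"
    unfolding End_right_iff
  proof (intro conjI ballI)
    fix x y assume xy: "x \<in> carrier L" "y \<in> carrier L"
    show "F (x \<oplus> y) = F x \<oplus> F y"
      using xy F by (intro c_eqI) (auto simp: c_add M_def algebra_simps sum.distrib)
    show "F (x \<otimes> y) = F x \<otimes> y"
    proof (rule c_eqI)
      fix p s
      have "c (F (x \<otimes> y)) p s = (if p \<in> P then \<Sum>r\<in>block p. \<Sum>t\<in>block p. m p r * (c x r t * c y t s) else 0)"
        using xy by (simp add: F M_def c_mult' sum_distrib_left)
      also have "\<dots> = (if p \<in> P then \<Sum>t\<in>block p. (\<Sum>r\<in>block p. m p r * c x r t) * c y t s else 0)"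
        by (subst sum.swap) (simp add: sum_distrib_right mult.assoc)
      also have "\<dots> = c (F x \<otimes> y) p s" using xy F by (simp add: c_mult' M_def)
      finally show "c (F (x \<otimes> y)) p s = c (F x \<otimes> y) p s" .
    qed (use xy F in auto)
  qed (use F in \<open>auto simp: F_def\<close>)
  have "entry F p q = m p q" for p q
  proof (cases "q \<in> P")
    case True
    have "c (F (e q)) p q = M (e q) p q" using F(2)[OF eL[OF True]] by simp
    also have "\<dots> = (if p \<in> P then \<Sum>r\<in>block p. if r = q then m p q else 0 else 0)"
      unfolding M_def using True by (intro if_cong sum.cong refl) (auto simp: c_unit)
    also have "\<dots> = m p q" using finite_block[of p] m[of p q] True by (cases "m p q = 0") auto
    finally show ?thesis using True by (simp add: entry_def)
  next
    case False
    then show ?thesis using m[of p q] by (auto simp: entry_def)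
  qed
  then show ?thesis using FA by blast
qed

text \<open>A scalar multiple of a matrix unit, seen inside A. A ring record has no scalar action,
  so the maps \<open>unit_map k q q\<close> play the role of the scalars.\<close>

definition unit_map :: "'k \<Rightarrow> 'p \<Rightarrow> 'p \<Rightarrow> 'a \<Rightarrow> 'a" where
  "unit_map k q p = left_mult (k \<odot> unit q p)"

lemma unit_map_closed: "q \<in> P \<Longrightarrow> p \<in> block q \<Longrightarrow> unit_map k q p \<in> carrier End_right"
  by (simp add: unit_map_def left_mult_End unit_closed)

lemma entry_unit_map:
  assumes q: "q \<in> P" "p \<in> block q"
  shows "entry (unit_map k q p) p' r = (if p' = q \<and> r = p then k else 0)"
proof (cases "r \<in> P")
  case True
  then have "entry (unit_map k q p) p' r = k * c (unit q p \<otimes> e r) p' r"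
    using unit_closed[OF q] eL[OF True]
    by (simp add: entry_def unit_map_def left_mult_def smult_mult_l c_smult)
  then show ?thesis using c_unit_mult[OF q eL[OF True]] True by (auto simp: c_unit)
next
  case False
  then show ?thesis using q by (auto simp: entry_def)
qed

lemma entry_unit_map_mult:
  assumes q: "q \<in> P" "p \<in> block q" and F: "F \<in> carrier End_right"
  shows "entry (unit_map k q p \<otimes>\<^bsub>End_right\<^esub> F) q' r = (if q' = q then k * entry F p r else 0)"
proof -
  have "entry (unit_map k q p \<otimes>\<^bsub>End_right\<^esub> F) q' r =
      (if q' \<in> P then \<Sum>s\<in>block q'. if s = p then (if q' = q then k * entry F p r else 0) else 0 else 0)"
    unfolding entry_mult[OF unit_map_closed[OF q] F]
    by (intro if_cong sum.cong refl) (simp add: entry_unit_map[OF q])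
  then show ?thesis using finite_block[of q'] q by auto
qed

lemma unit_map_mult_unit_map:
  assumes "q \<in> P" "p \<in> block q" "r \<in> block q"
  shows "unit_map k q p \<otimes>\<^bsub>End_right\<^esub> unit_map l p r = unit_map (k * l) q r"
  using assms
  by (intro End_eqI End_right_closed)
    (auto simp: unit_map_closed entry_unit_map_mult entry_unit_map)

lemma unit_map_add:
  assumes "q \<in> P" "p \<in> block q"
  shows "unit_map (k + l) q p = unit_map k q p \<oplus>\<^bsub>End_right\<^esub> unit_map l q p"
  using assms
  by (intro End_eqI End_right_closed) (auto simp: unit_map_closed entry_add entry_unit_map)

text \<open>Let E be the matrix unit at (q, p). A homomorphism h into A satisfies entry (h y) p q =
  entry (h (E y)) q q, so it is determined by the functionals y \<mapsto> entry (h y) q q on the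
  images of the diagonal idempotents. Extending f means extending one K-linear functional for each
  q.\<close>

lemma injective_End_right: "injective_module TYPE('t) End_right (left_regular End_right)"
  unfolding injective_module_def
proof (intro conjI allI impI ballI)
  let ?A = End_right
  interpret A: ring ?A by (rule ring_End_right)
  interpret A: nonunital_ring ?A by (rule A.nonunital_ring)
  show "left_module ?A (left_regular ?A)"
    unfolding left_module_def left_module_axioms_def
    using A.ring_axioms A.abelian_group_regular(1) by (simp add: A.l_distr A.r_distr A.m_assoc)
  fix X Y :: "('a \<Rightarrow> 'a, 't) module" and i f
  assume "left_module ?A X" "left_module ?A Y" and i: "i \<in> mod_hom ?A X Y"
    and inj: "inj_on i (carrier X)" and f: "f \<in> mod_hom ?A X (left_regular ?A)"
  then interpret X: left_module ?A X + Y: left_module ?A Y by simp_all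
  have iY: "\<And>x. x \<in> carrier X \<Longrightarrow> i x \<in> carrier Y"
    and i_add: "\<And>x y. x \<in> carrier X \<Longrightarrow> y \<in> carrier X \<Longrightarrow> i (x \<oplus>\<^bsub>X\<^esub> y) = i x \<oplus>\<^bsub>Y\<^esub> i y"
    and i_sm: "\<And>a x. a \<in> carrier ?A \<Longrightarrow> x \<in> carrier X \<Longrightarrow> i (a \<odot>\<^bsub>X\<^esub> x) = a \<odot>\<^bsub>Y\<^esub> i x"
    using i by (auto simp: mod_hom_def)
  have fA: "\<And>x. x \<in> carrier X \<Longrightarrow> f x \<in> carrier ?A"
    and f_add: "\<And>x y. x \<in> carrier X \<Longrightarrow> y \<in> carrier X \<Longrightarrow> f (x \<oplus>\<^bsub>X\<^esub> y) = f x \<oplus>\<^bsub>?A\<^esub> f y"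
    and f_sm: "\<And>a x. a \<in> carrier ?A \<Longrightarrow> x \<in> carrier X \<Longrightarrow> f (a \<odot>\<^bsub>X\<^esub> x) = a \<otimes>\<^bsub>?A\<^esub> f x"
    using f by (auto simp: mod_hom_def)
  have i_zero: "i \<zero>\<^bsub>X\<^esub> = \<zero>\<^bsub>Y\<^esub>"
    using i_sm[OF A.zero_closed X.zero_closed] X.smult_zero_l Y.smult_zero_l iY by simp
  have inv_i: "\<And>x. x \<in> carrier X \<Longrightarrow> inv_into (carrier X) i (i x) = x"
    using inj by simp
  \<comment> \<open>The images of the idempotent at q in Y and in X, written as sets of fixed
    points; these are the vector spaces on which the functionals live.\<close>
  define V where "V q = {y\<in>carrier Y. unit_map 1 q q \<odot>\<^bsub>Y\<^esub> y = y}" for q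
  define W where "W q = {x\<in>carrier X. unit_map 1 q q \<odot>\<^bsub>X\<^esub> x = x}" for q
  have ext: "\<exists>g. (\<forall>x\<in>W q. g (i x) = entry (f x) q q) \<and>
      (\<forall>x\<in>V q. \<forall>y\<in>V q. g (x \<oplus>\<^bsub>Y\<^esub> y) = g x + g y) \<and>
      (\<forall>k. \<forall>x\<in>V q. g (unit_map k q q \<odot>\<^bsub>Y\<^esub> x) = k * g x)" if q: "q \<in> P" for q
  proof -
    have uA: "unit_map k q q \<in> carrier ?A" for k using q by (simp add: unit_map_closed)
    have uu: "unit_map k q q \<otimes>\<^bsub>?A\<^esub> unit_map l q q = unit_map (k * l) q q" for k l
      using q by (simp add: unit_map_mult_unit_map)
    have VY: "y \<in> V q \<Longrightarrow> y \<in> carrier Y" and V1: "y \<in> V q \<Longrightarrow> unit_map 1 q q \<odot>\<^bsub>Y\<^esub> y = y" for y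
      by (simp_all add: V_def)
    have WX: "x \<in> W q \<Longrightarrow> x \<in> carrier X" and W1: "x \<in> W q \<Longrightarrow> unit_map 1 q q \<odot>\<^bsub>X\<^esub> x = x" for x
      by (simp_all add: W_def)
    have W_add: "x \<oplus>\<^bsub>X\<^esub> y \<in> W q" if "x \<in> W q" "y \<in> W q" for x y
      using that uA by (simp add: W_def X.smult_r_distr)
    have W_sm: "unit_map k q q \<odot>\<^bsub>X\<^esub> x \<in> W q" if "x \<in> W q" for x k
      using that uA by (simp add: W_def X.smult_closed X.smult_assoc[symmetric] uu)
    \<comment> \<open>The functional to be extended, transported along the injection i to its image
      in Y.\<close>
    define f0 where "f0 y = entry (f (inv_into (carrier X) i y)) q q" for y
    have f0: "f0 (i x) = entry (f x) q q" if "x \<in> carrier X" for x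
      using inv_i[OF that] by (simp add: f0_def)
    have "\<exists>g. (\<forall>x\<in>i ` W q. g x = f0 x) \<and>
      (\<forall>x\<in>V q. \<forall>y\<in>V q. g (x \<oplus>\<^bsub>Y\<^esub> y) = g x + g y) \<and>
      (\<forall>k. \<forall>x\<in>V q. g (unit_map k q q \<odot>\<^bsub>Y\<^esub> x) = k * g x)"
    proof (rule functional_extension[where G = Y])
      show "abelian_group Y" by (rule Y.abelian_group_axioms)
      show "V q \<subseteq> carrier Y" by (auto simp: V_def)
      show "\<zero>\<^bsub>Y\<^esub> \<in> V q" using uA by (simp add: V_def Y.smult_zero_r)
      show "x \<oplus>\<^bsub>Y\<^esub> y \<in> V q" if "x \<in> V q" "y \<in> V q" for x y
        using that uA by (simp add: V_def Y.smult_r_distr)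
      show "unit_map k q q \<odot>\<^bsub>Y\<^esub> x \<in> V q" if "x \<in> V q" for x k
        using that uA by (simp add: V_def Y.smult_closed Y.smult_assoc[symmetric] uu)
      show "unit_map (k + l) q q \<odot>\<^bsub>Y\<^esub> x = unit_map k q q \<odot>\<^bsub>Y\<^esub> x \<oplus>\<^bsub>Y\<^esub> unit_map l q q \<odot>\<^bsub>Y\<^esub> x"
        if "x \<in> V q" for x k l
        using VY[OF that] uA q by (simp add: unit_map_add Y.smult_l_distr)
      show "unit_map k q q \<odot>\<^bsub>Y\<^esub> (x \<oplus>\<^bsub>Y\<^esub> y) =
          unit_map k q q \<odot>\<^bsub>Y\<^esub> x \<oplus>\<^bsub>Y\<^esub> unit_map k q q \<odot>\<^bsub>Y\<^esub> y"
        if "x \<in> V q" "y \<in> V q" for x y k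
        using VY[OF that(1)] VY[OF that(2)] uA by (simp add: Y.smult_r_distr)
      show "unit_map (k * l) q q \<odot>\<^bsub>Y\<^esub> x = unit_map k q q \<odot>\<^bsub>Y\<^esub> (unit_map l q q \<odot>\<^bsub>Y\<^esub> x)"
        if "x \<in> V q" for x k l
        using VY[OF that] uA by (simp add: Y.smult_assoc[symmetric] uu)
      show "unit_map 1 q q \<odot>\<^bsub>Y\<^esub> x = x" if "x \<in> V q" for x using V1[OF that] .
      show "i ` W q \<subseteq> V q"
        using uA iY i_sm[OF uA, symmetric] by (auto simp: V_def W_def)
      have "\<zero>\<^bsub>X\<^esub> \<in> W q" using uA by (simp add: W_def X.smult_zero_r)
      then show "\<zero>\<^bsub>Y\<^esub> \<in> i ` W q" using i_zero by (metis imageI)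
      fix x assume "x \<in> i ` W q"
      then obtain x' where x': "x = i x'" "x' \<in> W q" by blast
      note xX = WX[OF x'(2)]
      show "unit_map k q q \<odot>\<^bsub>Y\<^esub> x \<in> i ` W q" for k
        unfolding x'(1) i_sm[OF uA xX, symmetric] using W_sm[OF x'(2)] by (rule imageI)
      show "f0 (unit_map k q q \<odot>\<^bsub>Y\<^esub> x) = k * f0 x" for k
        unfolding x'(1) i_sm[OF uA xX, symmetric] f0[OF xX] f0[OF X.smult_closed[OF uA xX]]
        using q by (simp add: f_sm[OF uA xX] entry_unit_map_mult fA xX)
      fix y assume "y \<in> i ` W q"
      then obtain y' where y': "y = i y'" "y' \<in> W q" by blast
      note yX = WX[OF y'(2)]
      show "x \<oplus>\<^bsub>Y\<^esub> y \<in> i ` W q"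
        unfolding x'(1) y'(1) i_add[OF xX yX, symmetric] using W_add[OF x'(2) y'(2)] by (rule imageI)
      show "f0 (x \<oplus>\<^bsub>Y\<^esub> y) = f0 x + f0 y"
        unfolding x'(1) y'(1) i_add[OF xX yX, symmetric] f0[OF xX] f0[OF yX] f0[OF X.a_closed[OF xX yX]]
        by (simp add: f_add xX yX entry_add fA)
    qed
    then obtain g where g: "\<forall>x\<in>i ` W q. g x = f0 x"
      "\<forall>x\<in>V q. \<forall>y\<in>V q. g (x \<oplus>\<^bsub>Y\<^esub> y) = g x + g y"
      "\<forall>k. \<forall>x\<in>V q. g (unit_map k q q \<odot>\<^bsub>Y\<^esub> x) = k * g x"
      by blast
    from g(1) f0 WX have "\<forall>x\<in>W q. g (i x) = entry (f x) q q" by simp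
    with g(2,3) show ?thesis by blast
  qed
  then obtain g where g_ext: "\<And>q x. q \<in> P \<Longrightarrow> x \<in> W q \<Longrightarrow> g q (i x) = entry (f x) q q"
    and g_add: "\<And>q x y. q \<in> P \<Longrightarrow> x \<in> V q \<Longrightarrow> y \<in> V q \<Longrightarrow> g q (x \<oplus>\<^bsub>Y\<^esub> y) = g q x + g q y"
    and g_sm: "\<And>q k x. q \<in> P \<Longrightarrow> x \<in> V q \<Longrightarrow> g q (unit_map k q q \<odot>\<^bsub>Y\<^esub> x) = k * g q x"
  proof -
    have "\<forall>q\<in>P. \<exists>g. (\<forall>x\<in>W q. g (i x) = entry (f x) q q) \<and>
      (\<forall>x\<in>V q. \<forall>y\<in>V q. g (x \<oplus>\<^bsub>Y\<^esub> y) = g x + g y) \<and>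
      (\<forall>k. \<forall>x\<in>V q. g (unit_map k q q \<odot>\<^bsub>Y\<^esub> x) = k * g x)"
      by (intro ballI ext)
    from bchoice[OF this] obtain g where
      "\<forall>q\<in>P. (\<forall>x\<in>W q. g q (i x) = entry (f x) q q) \<and>
      (\<forall>x\<in>V q. \<forall>y\<in>V q. g q (x \<oplus>\<^bsub>Y\<^esub> y) = g q x + g q y) \<and>
      (\<forall>k. \<forall>x\<in>V q. g q (unit_map k q q \<odot>\<^bsub>Y\<^esub> x) = k * g q x)" ..
    then show ?thesis by (intro that[of g]) blast+
  qed
  have uV: "unit_map k q p \<odot>\<^bsub>Y\<^esub> y \<in> V q" if "q \<in> P" "p \<in> block q" "y \<in> carrier Y" for k q p y
    using that by (simp add: V_def Y.smult_closed unit_map_closed Y.smult_assoc[symmetric] unit_map_mult_unit_map)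
  define m where "m y p q = (if q \<in> P \<and> p \<in> block q then g q (unit_map 1 q p \<odot>\<^bsub>Y\<^esub> y) else 0)" for y p q
  have "\<exists>F. F \<in> carrier ?A \<and> (\<forall>p q. entry F p q = m y p q)" for y
  proof -
    have "p \<in> P \<and> q \<in> P \<and> b p = b q" if "m y p q \<noteq> 0" for p q
      using that by (simp add: m_def split: if_splits)
    from entry_surj[of "m y", OF this] show ?thesis by blast
  qed
  then have "\<exists>h. \<forall>y. h y \<in> carrier ?A \<and> (\<forall>p q. entry (h y) p q = m y p q)"
    by (intro choice allI)
  then obtain h where "\<forall>y. h y \<in> carrier ?A \<and> (\<forall>p q. entry (h y) p q = m y p q)" ..
  then have hA: "\<And>y. h y \<in> carrier ?A" and h: "\<And>y p q. entry (h y) p q = m y p q"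
    by blast+
  have "h \<in> mod_hom ?A Y (left_regular ?A)"
    unfolding mod_hom_def
  proof (intro CollectI conjI ballI)
    show "h \<in> carrier Y \<rightarrow> carrier (left_regular ?A)" using hA by simp
    fix y assume y: "y \<in> carrier Y"
    show "h (y \<oplus>\<^bsub>Y\<^esub> z) = h y \<oplus>\<^bsub>left_regular ?A\<^esub> h z" if "z \<in> carrier Y" for z
      using y that hA
      by (intro End_eqI)
        (auto simp: entry_add h m_def Y.smult_r_distr unit_map_closed g_add uV)
    show "h (F \<odot>\<^bsub>Y\<^esub> y) = F \<odot>\<^bsub>left_regular ?A\<^esub> h y" if F: "F \<in> carrier ?A" for F
    proof (rule End_eqI)
      fix p q
      show "entry (h (F \<odot>\<^bsub>Y\<^esub> y)) p q = entry (F \<odot>\<^bsub>left_regular ?A\<^esub> h y) p q"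
      proof (cases "q \<in> P \<and> p \<in> block q")
        case True
        then have q: "q \<in> P" "p \<in> block q" and p: "p \<in> P" by auto
        have bp: "r \<in> block q" if "r \<in> block p" for r using that q by simp
        let ?s = "\<lambda>r. unit_map (entry F p r) q r"
        have sA: "?s \<in> block p \<rightarrow> carrier ?A" using q bp by (auto simp: unit_map_closed)
        \<comment> \<open>Multiplying F by the matrix unit at (q, p) moves row p of F to row q, a
          combination of the matrix units at (q, r). The sum is finite because r stays in the block
          of p, so the functional g q can be applied term by term.\<close>
        have "unit_map 1 q p \<otimes>\<^bsub>?A\<^esub> F = (\<Oplus>\<^bsub>?A\<^esub>r\<in>block p. ?s r)"
        proof (rule End_eqI)
          show "unit_map 1 q p \<otimes>\<^bsub>?A\<^esub> F \<in> carrier ?A"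
            using q F by (intro End_right_closed unit_map_closed)
          show "(\<Oplus>\<^bsub>?A\<^esub>r\<in>block p. ?s r) \<in> carrier ?A" using sA by (rule A.finsum_closed)
          fix q' t
          have "entry (\<Oplus>\<^bsub>?A\<^esub>r\<in>block p. ?s r) q' t = (\<Sum>r\<in>block p. entry (?s r) q' t)"
            by (rule A.additive_finsum[OF finite_block[OF p] sA]) (rule entry_add)
          also have "\<dots> = (\<Sum>r\<in>block p. if r = t then (if q' = q then entry F p t else 0) else 0)"
            using q bp by (intro sum.cong refl) (auto simp: entry_unit_map)
          also have "\<dots> = (if q' = q then entry F p t else 0)"
            using finite_block[OF p] entry_support[OF F, of p t] by (cases "entry F p t = 0") auto
          finally show "entry (unit_map 1 q p \<otimes>\<^bsub>?A\<^esub> F) q' t = entry (\<Oplus>\<^bsub>?A\<^esub>r\<in>block p. ?s r) q' t"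
            using entry_unit_map_mult[OF q F] by simp
        qed
        then have "m (F \<odot>\<^bsub>Y\<^esub> y) p q = g q ((\<Oplus>\<^bsub>?A\<^esub>r\<in>block p. ?s r) \<odot>\<^bsub>Y\<^esub> y)"
          using True y F by (simp add: m_def Y.smult_assoc[symmetric] unit_map_closed)
        also have "\<dots> = (\<Sum>r\<in>block p. g q (?s r \<odot>\<^bsub>Y\<^esub> y))"
        proof -
          \<comment> \<open>\<open>g q\<close> is additive only on \<open>V q\<close>; the inserted
            factor \<open>unit_map 1 q q\<close> makes \<open>?g\<close> additive on all of
            A.\<close>
          let ?g = "\<lambda>B. g q ((unit_map 1 q q \<otimes>\<^bsub>?A\<^esub> B) \<odot>\<^bsub>Y\<^esub> y)"
          have uA: "unit_map 1 q q \<in> carrier ?A" using q by (simp add: unit_map_closed)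
          have gs: "g q (B \<odot>\<^bsub>Y\<^esub> y) = ?g B" if "B \<in> carrier ?A" "unit_map 1 q q \<otimes>\<^bsub>?A\<^esub> B = B" for B
            using that by simp
          have V: "(unit_map 1 q q \<otimes>\<^bsub>?A\<^esub> B) \<odot>\<^bsub>Y\<^esub> y \<in> V q" if "B \<in> carrier ?A" for B
            using uV[OF q(1), of q "B \<odot>\<^bsub>Y\<^esub> y" 1] q uA y that by (simp add: Y.smult_assoc Y.smult_closed)
          have us: "unit_map 1 q q \<otimes>\<^bsub>?A\<^esub> ?s r = ?s r" if "r \<in> block p" for r
            using q bp[OF that] by (simp add: unit_map_mult_unit_map)
          have "unit_map 1 q q \<otimes>\<^bsub>?A\<^esub> (\<Oplus>\<^bsub>?A\<^esub>r\<in>block p. ?s r) = (\<Oplus>\<^bsub>?A\<^esub>r\<in>block p. ?s r)"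
            unfolding A.finsum_r_distr[OF finite_block[OF p] sA uA]
            using us sA by (intro A.finsum_cong') auto
          then have "g q ((\<Oplus>\<^bsub>?A\<^esub>r\<in>block p. ?s r) \<odot>\<^bsub>Y\<^esub> y) = ?g (\<Oplus>\<^bsub>?A\<^esub>r\<in>block p. ?s r)" by simp
          also have "\<dots> = (\<Sum>r\<in>block p. ?g (?s r))"
          proof (rule A.additive_finsum[OF finite_block[OF p] sA])
            fix B C assume BC: "B \<in> carrier ?A" "C \<in> carrier ?A"
            have "(unit_map 1 q q \<otimes>\<^bsub>?A\<^esub> (B \<oplus>\<^bsub>?A\<^esub> C)) \<odot>\<^bsub>Y\<^esub> y =
                (unit_map 1 q q \<otimes>\<^bsub>?A\<^esub> B) \<odot>\<^bsub>Y\<^esub> y \<oplus>\<^bsub>Y\<^esub> (unit_map 1 q q \<otimes>\<^bsub>?A\<^esub> C) \<odot>\<^bsub>Y\<^esub> y"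
              using BC uA y by (simp add: A.r_distr Y.smult_l_distr)
            then show "?g (B \<oplus>\<^bsub>?A\<^esub> C) = ?g B + ?g C" using g_add[OF q(1) V V] BC by simp
          qed
          also have "\<dots> = (\<Sum>r\<in>block p. g q (?s r \<odot>\<^bsub>Y\<^esub> y))"
            using us by (intro sum.cong refl) simp
          finally show ?thesis .
        qed
        also have "\<dots> = (\<Sum>r\<in>block p. entry F p r * m y r q)"
        proof (intro sum.cong refl)
          fix r assume r: "r \<in> block p"
          have "?s r = unit_map (entry F p r) q q \<otimes>\<^bsub>?A\<^esub> unit_map 1 q r"
            using q bp[OF r] by (simp add: unit_map_mult_unit_map)
          then show "g q (?s r \<odot>\<^bsub>Y\<^esub> y) = entry F p r * m y r q"
            using q bp[OF r] y g_sm[OF q(1) uV[OF q(1) bp[OF r] y]]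
            by (simp add: Y.smult_assoc unit_map_closed m_def)
        qed
        finally show ?thesis
          using p by (simp add: h entry_mult[OF F hA])
      next
        case False
        then have "entry F p r * m y r q = 0" for r
          using entry_support[OF F, of p r] by (cases "entry F p r = 0") (auto simp: m_def)
        then have "entry (F \<otimes>\<^bsub>?A\<^esub> h y) p q = 0"
          by (simp only: entry_mult[OF F hA] h sum.neutral_const if_cancel)
        then show ?thesis using False by (auto simp: h m_def)
      qed
    qed (use hA F in auto)
  qed
  moreover have "h (i x) = f x" if x: "x \<in> carrier X" for x
  proof (rule End_eqI)
    fix p q
    show "entry (h (i x)) p q = entry (f x) p q"
    proof (cases "q \<in> P \<and> p \<in> block q")
      case True
      then have q: "q \<in> P" "p \<in> block q" by auto
      have "unit_map 1 q p \<odot>\<^bsub>X\<^esub> x \<in> W q"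
        using q x by (simp add: W_def X.smult_closed unit_map_closed X.smult_assoc[symmetric] unit_map_mult_unit_map)
      then have "m (i x) p q = entry (f (unit_map 1 q p \<odot>\<^bsub>X\<^esub> x)) q q"
        using q x g_ext[OF q(1)] by (simp add: m_def i_sm[symmetric] unit_map_closed)
      then show ?thesis using q x by (simp add: h f_sm unit_map_closed entry_unit_map_mult fA)
    next
      case False
      then show ?thesis using entry_support[OF fA[OF x], of p q]
        by (cases "entry (f x) p q = 0") (auto simp: h m_def)
    qed
  qed (use hA fA x in auto)
  ultimately show "\<exists>g\<in>mod_hom ?A Y (left_regular ?A). \<forall>x\<in>carrier X. g (i x) = f x" by blast
qed

theorem left_self_injective_End_right: "left_self_injective TYPE('t) End_right"
  unfolding left_self_injective_def by (rule injective_End_right)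

end

section \<open>Direct sums of matrix algebras and matrix units\<close>

context nonunital_algebra
begin

lemma direct_sum_imp_block_coordinates:
  assumes "direct_sum_of_matrix_algebras L"
  shows "\<exists>(P :: ('a \<times> nat) set) c. block_coordinates L P fst c"
proof -
  obtain \<Lambda> :: "'a set" and n where
    iso: "isomorphic_algebras L (direct_sum_algebra \<Lambda> (\<lambda>i. module_mat TYPE('k) (n i) (n i)))"
    using assms unfolding direct_sum_of_matrix_algebras_def by blast
  let ?D = "direct_sum_algebra \<Lambda> (\<lambda>i. module_mat TYPE('k) (n i) (n i))"
  obtain f where F: "bij_betw f (carrier L) (carrier ?D) \<and>
      (\<forall>x\<in>carrier L. \<forall>y\<in>carrier L. f (x \<oplus> y) = f x \<oplus>\<^bsub>?D\<^esub> f y) \<and>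
      (\<forall>x\<in>carrier L. \<forall>y\<in>carrier L. f (x \<otimes> y) = f x \<otimes>\<^bsub>?D\<^esub> f y) \<and>
      (\<forall>k. \<forall>x\<in>carrier L. f (k \<odot> x) = k \<odot>\<^bsub>?D\<^esub> f x)"
    using iso unfolding isomorphic_algebras_def ..
  then have f: "bij_betw f (carrier L) (carrier ?D)"
    and f_add: "\<And>x y. x \<in> carrier L \<Longrightarrow> y \<in> carrier L \<Longrightarrow> f (x \<oplus> y) = f x \<oplus>\<^bsub>?D\<^esub> f y"
    and f_mult: "\<And>x y. x \<in> carrier L \<Longrightarrow> y \<in> carrier L \<Longrightarrow> f (x \<otimes> y) = f x \<otimes>\<^bsub>?D\<^esub> f y"
    and f_smult: "\<And>k x. x \<in> carrier L \<Longrightarrow> f (k \<odot> x) = k \<odot>\<^bsub>?D\<^esub> f x"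
    by simp_all
  define P where "P = Sigma \<Lambda> (\<lambda>i. {..<n i})"
  define c where "c x p q = (if p \<in> P \<and> q \<in> P \<and> fst p = fst q
    then f x (fst p) $$ (snd p, snd q) else 0)" for x p q
  have P: "p \<in> P \<longleftrightarrow> fst p \<in> \<Lambda> \<and> snd p < n (fst p)" for p
    by (cases p) (auto simp: P_def)
  have D: "y \<in> carrier ?D \<longleftrightarrow> y \<in> extensional \<Lambda> \<and> (\<forall>i\<in>\<Lambda>. y i \<in> carrier_mat (n i) (n i)) \<and>
      finite {i\<in>\<Lambda>. y i \<noteq> 0\<^sub>m (n i) (n i)}" for y
    by (auto simp: direct_sum_algebra_def module_mat_simps PiE_def Pi_def)
  have fD: "f x \<in> carrier ?D" if "x \<in> carrier L" for x
    using f that by (auto simp: bij_betw_def)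
  have fm: "f x i \<in> carrier_mat (n i) (n i)" if "x \<in> carrier L" "i \<in> \<Lambda>" for x i
    using fD[OF that(1)] that(2) D by blast
  have dim: "dim_row (f x i) = n i" "dim_col (f x i) = n i" if "x \<in> carrier L" "i \<in> \<Lambda>" for x i
    using fm[OF that] by auto
  have blk: "{q\<in>P. fst q = fst p} = Pair (fst p) ` {..<n (fst p)}" if "p \<in> P" for p
    using that by (auto simp: P image_iff prod_eq_iff)
  have c: "c x (i, s) (i, t) = f x i $$ (s, t)" if "i \<in> \<Lambda>" "s < n i" "t < n i" for x i s t
    using that by (simp add: c_def P)
  have "block_coordinates L P fst c"
  proof unfold_locales
    show "finite {q\<in>P. fst q = fst p}" if "p \<in> P" for p by (simp add: blk[OF that])
  next
    fix x y assume xy: "x \<in> carrier L" "y \<in> carrier L" "c x = c y"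
    have "f x = f y"
    proof (rule extensionalityI[of _ \<Lambda>])
      show "f x \<in> extensional \<Lambda>" "f y \<in> extensional \<Lambda>" using fD xy D by blast+
      fix i assume i: "i \<in> \<Lambda>"
      have "f x i $$ (s, t) = f y i $$ (s, t)" if "s < n i" "t < n i" for s t
        using c[OF i that, of x] c[OF i that, of y] xy(3) by simp
      then show "f x i = f y i"
        using fm[OF xy(1) i] fm[OF xy(2) i] by (intro eq_matI) auto
    qed
    then show "x = y" using f xy by (auto simp: bij_betw_def inj_on_def)
  next
    fix x p q assume "x \<in> carrier L" "c x p q \<noteq> 0"
    then show "p \<in> P \<and> q \<in> P \<and> fst p = fst q" by (auto simp: c_def split: if_splits)
  next
    fix x assume x: "x \<in> carrier L"
    let ?I = "{i\<in>\<Lambda>. f x i \<noteq> 0\<^sub>m (n i) (n i)}"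
    let ?S = "Sigma ?I (\<lambda>i. {..<n i})"
    have "{(p, q). c x p q \<noteq> 0} \<subseteq> ?S \<times> ?S"
    proof (rule subrelI)
      fix p q assume "(p, q) \<in> {(p, q). c x p q \<noteq> 0}"
      then obtain i s t where nz: "c x (i, s) (i, t) \<noteq> 0" and pq: "p = (i, s)" "q = (i, t)"
        and i: "i \<in> \<Lambda>" "s < n i" "t < n i"
        by (cases p; cases q) (auto simp: c_def P split: if_splits)
      then have "f x i \<noteq> 0\<^sub>m (n i) (n i)" by (auto simp: c)
      then show "(p, q) \<in> ?S \<times> ?S" using i by (auto simp: pq)
    qed
    moreover have "finite ?S" using fD[OF x] by (auto simp: D)
    ultimately show "finite {(p, q). c x p q \<noteq> 0}" by (meson finite_SigmaI finite_subset)
  next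
    fix m :: "'a \<times> nat \<Rightarrow> 'a \<times> nat \<Rightarrow> 'k"
    assume fin: "finite {(p, q). m p q \<noteq> 0}"
      and supp: "\<And>p q. m p q \<noteq> 0 \<Longrightarrow> p \<in> P \<and> q \<in> P \<and> fst p = fst q"
    define y where "y = (\<lambda>i\<in>\<Lambda>. mat (n i) (n i) (\<lambda>(s, t). m (i, s) (i, t)))"
    have "{i\<in>\<Lambda>. y i \<noteq> 0\<^sub>m (n i) (n i)} \<subseteq> (\<lambda>(p, q). fst p) ` {(p, q). m p q \<noteq> 0}"
    proof clarify
      fix i assume i: "i \<in> \<Lambda>" "y i \<noteq> 0\<^sub>m (n i) (n i)"
      have "\<exists>s<n i. \<exists>t<n i. m (i, s) (i, t) \<noteq> 0"
      proof (rule ccontr)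
        assume "\<not> ?thesis"
        then have "y i = 0\<^sub>m (n i) (n i)" using i(1) by (intro eq_matI) (auto simp: y_def)
        with i show False by blast
      qed
      then show "i \<in> (\<lambda>(p, q). fst p) ` {(p, q). m p q \<noteq> 0}" by force
    qed
    then have "finite {i\<in>\<Lambda>. y i \<noteq> 0\<^sub>m (n i) (n i)}"
      by (rule finite_subset[OF _ finite_imageI[OF fin]])
    moreover have "y \<in> extensional \<Lambda>" "\<forall>i\<in>\<Lambda>. y i \<in> carrier_mat (n i) (n i)"
      by (simp_all add: y_def)
    ultimately have "y \<in> carrier ?D" unfolding D by blast
    then have "y \<in> f ` carrier L" unfolding bij_betw_imp_surj_on[OF f] .
    then obtain x where x: "x \<in> carrier L" "f x = y" by blast
    have "c x p q = m p q" for p q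
    proof (cases "p \<in> P \<and> q \<in> P \<and> fst p = fst q")
      case True
      then show ?thesis by (cases p; cases q) (auto simp: c x(2) y_def P)
    next
      case False
      then show ?thesis using supp[of p q] by (auto simp: c_def)
    qed
    then show "\<exists>x\<in>carrier L. c x = m" using x(1) by (intro bexI[of _ x] ext)
  next
    fix x y p q assume xy: "x \<in> carrier L" "y \<in> carrier L"
    show "c (x \<oplus> y) p q = c x p q + c y p q"
    proof (cases "p \<in> P \<and> q \<in> P \<and> fst p = fst q")
      case True
      then show ?thesis using xy
        by (auto simp: dim c_def P f_add[OF xy] direct_sum_algebra_def module_mat_simps)
    qed (auto simp: c_def)
  next
    fix x k p q assume x: "x \<in> carrier L"
    show "c (k \<odot> x) p q = k * c x p q"
    proof (cases "p \<in> P \<and> q \<in> P \<and> fst p = fst q")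
      case True
      then show ?thesis using x
        by (auto simp: dim c_def P f_smult[OF x] direct_sum_algebra_def module_mat_simps)
    qed (auto simp: c_def)
  next
    fix x y p q assume xy: "x \<in> carrier L" "y \<in> carrier L" and p: "p \<in> P"
    show "c (x \<otimes> y) p q = (\<Sum>r\<in>{r\<in>P. fst r = fst p}. c x p r * c y r q)"
    proof (cases "q \<in> P \<and> fst p = fst q")
      case True
      obtain i s t where pq: "p = (i, s)" "q = (i, t)" and i: "i \<in> \<Lambda>" "s < n i" "t < n i"
        using True p by (cases p; cases q) (auto simp: P)
      have "c (x \<otimes> y) p q = (\<Sum>j<n i. f x i $$ (s, j) * f y i $$ (j, t))"
        using xy i by (auto simp: dim pq c f_mult[OF xy] direct_sum_algebra_def module_mat_simps
          scalar_prod_def lessThan_atLeast0 intro!: sum.cong)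
      also have "\<dots> = (\<Sum>j<n i. c x p (i, j) * c y (i, j) q)"
        using i by (intro sum.cong refl) (simp add: pq c)
      also have "\<dots> = (\<Sum>r\<in>{r\<in>P. fst r = fst p}. c x p r * c y r q)"
        unfolding blk[OF p] by (subst sum.reindex) (auto simp: pq inj_on_def)
      finally show ?thesis .
    next
      case False
      then have "c x p r * c y r q = 0" for r by (auto simp: c_def)
      moreover have "c (x \<otimes> y) p q = 0" using False by (auto simp: c_def)
      ultimately show ?thesis by (simp only: sum.neutral_const)
    qed
  qed
  then show ?thesis by blast
qed

text \<open>Block labels are elements of L because \<open>direct_sum_of_matrix_algebras\<close>
  takes its index set from there. Each finite block is enumerated to turn its part of the
  coordinates into a matrix indexed by numbers.\<close>

lemma block_coordinates_imp_direct_sum: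
  assumes "block_coordinates L P (b :: 'p \<Rightarrow> 'a) c"
  shows "direct_sum_of_matrix_algebras L"
proof -
  interpret block_coordinates L P b c by fact
  define \<Lambda> where "\<Lambda> = b ` P"
  define B where "B i = {p\<in>P. b p = i}" for i
  define n where "n i = card (B i)" for i
  have finB: "finite (B i)" if "i \<in> \<Lambda>" for i
    using that finite_block by (auto simp: \<Lambda>_def B_def)
  have n_pos: "0 < n i" if "i \<in> \<Lambda>" for i
    using finB[OF that] that by (auto simp: n_def card_gt_0_iff \<Lambda>_def B_def)
  have "\<exists>h. bij_betw h {..<n i} (B i)" if "i \<in> \<Lambda>" for i
    using ex_bij_betw_nat_finite[OF finB[OF that]] by (auto simp: n_def lessThan_atLeast0)
  then have "\<forall>i\<in>\<Lambda>. \<exists>h. bij_betw h {..<n i} (B i)" by blast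
  from bchoice[OF this] obtain h where h: "\<And>i. i \<in> \<Lambda> \<Longrightarrow> bij_betw (h i) {..<n i} (B i)" by blast
  have hB: "h i s \<in> B i" if "i \<in> \<Lambda>" "s < n i" for i s
    using h[OF that(1)] that(2) by (auto simp: bij_betw_def)
  have hP: "h i s \<in> P" "b (h i s) = i" if "i \<in> \<Lambda>" "s < n i" for i s
    using hB[OF that] by (auto simp: B_def)
  have hex: "\<exists>s<n i. h i s = p" if "p \<in> P" "b p = i" for p i
  proof -
    have i: "i \<in> \<Lambda>" using that by (auto simp: \<Lambda>_def)
    have "p \<in> h i ` {..<n i}" using h[OF i] that by (simp add: bij_betw_def B_def)
    then show ?thesis by auto
  qed
  define D where "D = direct_sum_algebra \<Lambda> (\<lambda>i. module_mat TYPE('k) (n i) (n i))"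
  define f where "f x = (\<lambda>i\<in>\<Lambda>. mat (n i) (n i) (\<lambda>(s, t). c x (h i s) (h i t)))" for x
  have D: "y \<in> carrier D \<longleftrightarrow> y \<in> extensional \<Lambda> \<and> (\<forall>i\<in>\<Lambda>. y i \<in> carrier_mat (n i) (n i)) \<and>
      finite {i\<in>\<Lambda>. y i \<noteq> 0\<^sub>m (n i) (n i)}" for y
    by (auto simp: D_def direct_sum_algebra_def module_mat_simps PiE_def Pi_def)
  have "bij_betw f (carrier L) (carrier D)"
    unfolding bij_betw_def
  proof
    show "inj_on f (carrier L)"
    proof (rule inj_onI)
      fix x y assume xy: "x \<in> carrier L" "y \<in> carrier L" "f x = f y"
      show "x = y"
      proof (rule c_eqI[OF xy(1,2)])
        fix p q
        show "c x p q = c y p q"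
        proof (cases "p \<in> P \<and> q \<in> P \<and> b p = b q")
          case True
          then have i: "b p \<in> \<Lambda>" by (auto simp: \<Lambda>_def)
          obtain s t where st: "s < n (b p)" "h (b p) s = p" "t < n (b p)" "h (b p) t = q"
            using hex[of p "b p"] hex[of q "b p"] True by auto
          have "f x (b p) $$ (s, t) = f y (b p) $$ (s, t)" using xy(3) by simp
          then show ?thesis using st i by (simp add: f_def)
        next
          case False
          then show ?thesis using c_support[OF xy(1), of p q] c_support[OF xy(2), of p q]
            by (cases "c x p q = 0"; cases "c y p q = 0") auto
        qed
      qed
    qed
    show "f ` carrier L = carrier D"
    proof (intro equalityI subsetI)
      fix y assume "y \<in> f ` carrier L"
      then obtain x where x: "x \<in> carrier L" "y = f x" by blast
      have "{i\<in>\<Lambda>. f x i \<noteq> 0\<^sub>m (n i) (n i)} \<subseteq> (\<lambda>(p, q). b p) ` {(p, q). c x p q \<noteq> 0}"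
      proof clarify
        fix i assume i: "i \<in> \<Lambda>" "f x i \<noteq> 0\<^sub>m (n i) (n i)"
        have "\<exists>s<n i. \<exists>t<n i. c x (h i s) (h i t) \<noteq> 0"
        proof (rule ccontr)
          assume "\<not> ?thesis"
          then have "f x i = 0\<^sub>m (n i) (n i)" using i(1) by (intro eq_matI) (auto simp: f_def)
          with i show False by blast
        qed
        then obtain s t where "s < n i" "c x (h i s) (h i t) \<noteq> 0" by blast
        then show "i \<in> (\<lambda>(p, q). b p) ` {(p, q). c x p q \<noteq> 0}"
          using hP(2)[OF i(1)] by force
      qed
      then have "finite {i\<in>\<Lambda>. f x i \<noteq> 0\<^sub>m (n i) (n i)}"
        by (rule finite_subset[OF _ finite_imageI[OF c_finite[OF x(1)]]])
      moreover have "f x \<in> extensional \<Lambda>" "\<forall>i\<in>\<Lambda>. f x i \<in> carrier_mat (n i) (n i)"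
        by (simp_all add: f_def)
      ultimately show "y \<in> carrier D" unfolding D x(2) by blast
    next
      fix y assume y: "y \<in> carrier D"
      define g where "g i = inv_into {..<n i} (h i)" for i
      have g: "g i (h i s) = s" if "i \<in> \<Lambda>" "s < n i" for i s
        using h[OF that(1)] that(2) by (simp add: g_def bij_betw_def)
      define m where "m p q = (if p \<in> P \<and> q \<in> P \<and> b p = b q
        then y (b p) $$ (g (b p) p, g (b p) q) else 0)" for p q
      have "\<exists>x\<in>carrier L. c x = m"
      proof (rule c_surj)
        let ?I = "{i\<in>\<Lambda>. y i \<noteq> 0\<^sub>m (n i) (n i)}"
        have gn: "g (b p) q < n (b p)" if pq: "p \<in> P" "q \<in> P" "b p = b q" for p q
        proof -
          obtain s where s: "s < n (b p)" "h (b p) s = q"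
            using hex[OF pq(2) pq(3)[symmetric]] by blast
          have "b p \<in> \<Lambda>" using pq by (auto simp: \<Lambda>_def)
          from g[OF this s(1)] s show ?thesis by simp
        qed
        have "{(p, q). m p q \<noteq> 0} \<subseteq> (\<Union>i\<in>?I. B i) \<times> (\<Union>i\<in>?I. B i)"
        proof (rule subrelI)
          fix p q assume "(p, q) \<in> {(p, q). m p q \<noteq> 0}"
          then have nz: "m p q \<noteq> 0" by simp
          then have pq: "p \<in> P" "q \<in> P" "b p = b q" by (auto simp: m_def split: if_splits)
          then have "y (b p) \<noteq> 0\<^sub>m (n (b p)) (n (b p))"
            using nz gn[OF pq] gn[of p p] by (auto simp: m_def)
          then have "b p \<in> ?I" using pq by (auto simp: \<Lambda>_def)
          then show "(p, q) \<in> (\<Union>i\<in>?I. B i) \<times> (\<Union>i\<in>?I. B i)" using pq by (auto simp: B_def)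
        qed
        moreover have "finite (\<Union>i\<in>?I. B i)" using y finB by (auto simp: D)
        ultimately show "finite {(p, q). m p q \<noteq> 0}" by (meson finite_SigmaI finite_subset)
      qed (auto simp: m_def split: if_splits)
      then obtain x where x: "x \<in> carrier L" "c x = m" by blast
      have "f x = y"
      proof (rule extensionalityI[of _ \<Lambda>])
        show "f x \<in> extensional \<Lambda>" "y \<in> extensional \<Lambda>" using y by (auto simp: f_def D)
        fix i assume i: "i \<in> \<Lambda>"
        then have "y i \<in> carrier_mat (n i) (n i)" using y D by blast
        then show "f x i = y i"
          using i by (intro eq_matI) (auto simp: f_def x(2) m_def hP g)
      qed
      then show "y \<in> f ` carrier L" using x(1) by blast
    qed
  qed
  moreover have "f (x \<oplus> y) = f x \<oplus>\<^bsub>D\<^esub> f y" if "x \<in> carrier L" "y \<in> carrier L" for x y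
    using that unfolding D_def direct_sum_algebra_def module_mat_simps
    by (auto simp: f_def c_add intro!: restrict_ext eq_matI)
  moreover have "f (k \<odot> x) = k \<odot>\<^bsub>D\<^esub> f x" if "x \<in> carrier L" for x k
    using that unfolding D_def direct_sum_algebra_def module_mat_simps
    by (auto simp: f_def c_smult intro!: restrict_ext eq_matI)
  moreover have "f (x \<otimes> y) = f x \<otimes>\<^bsub>D\<^esub> f y" if xy: "x \<in> carrier L" "y \<in> carrier L" for x y
  proof -
    have "f (x \<otimes> y) i = f x i * f y i" if i: "i \<in> \<Lambda>" for i
    proof (rule eq_matI)
      fix s t assume "s < dim_row (f x i * f y i)" "t < dim_col (f x i * f y i)"
      then have st: "s < n i" "t < n i" using i by (simp_all add: f_def)
      have "f (x \<otimes> y) i $$ (s, t) = (\<Sum>r\<in>B i. c x (h i s) r * c y r (h i t))"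
        using i st xy hP[OF i st(1)] by (simp add: f_def c_mult B_def)
      also have "\<dots> = (\<Sum>j<n i. c x (h i s) (h i j) * c y (h i j) (h i t))"
        using h[OF i] by (subst sum.reindex_bij_betw[symmetric, of "h i" "{..<n i}" "B i"]) simp_all
      also have "\<dots> = (f x i * f y i) $$ (s, t)"
        using st i by (auto simp: f_def scalar_prod_def lessThan_atLeast0 intro!: sum.cong)
      finally show "f (x \<otimes> y) i $$ (s, t) = (f x i * f y i) $$ (s, t)" .
    qed (use i in \<open>auto simp: f_def\<close>)
    then show ?thesis
      unfolding D_def direct_sum_algebra_def module_mat_simps
      by (intro extensionalityI[of _ \<Lambda>]) (auto simp: f_def)
  qed
  ultimately have "isomorphic_algebras L D" unfolding isomorphic_algebras_def by blast
  then show ?thesis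
    unfolding direct_sum_of_matrix_algebras_def D_def using n_pos by blast
qed

text \<open>Linear independence is a consequence: the coordinate k of x at (p, q) is recovered from
  u p p x u q q = k u p q, and it is unique since u p q \<noteq> 0.\<close>

lemma matrix_units_imp_block_coordinates:
  fixes u :: "'p \<Rightarrow> 'p \<Rightarrow> 'a" and b :: "'p \<Rightarrow> 'i"
  assumes fin: "\<And>p. p \<in> P \<Longrightarrow> finite {q\<in>P. b q = b p}"
    and u: "\<And>p q. p \<in> P \<Longrightarrow> q \<in> P \<Longrightarrow> b p = b q \<Longrightarrow> u p q \<in> carrier L"
    and u_nz: "\<And>p q. p \<in> P \<Longrightarrow> q \<in> P \<Longrightarrow> b p = b q \<Longrightarrow> u p q \<noteq> \<zero>"
    and u_mult: "\<And>p q r s. p \<in> P \<Longrightarrow> q \<in> P \<Longrightarrow> b p = b q \<Longrightarrow> r \<in> P \<Longrightarrow> s \<in> P \<Longrightarrow> b r = b s \<Longrightarrow>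
      u p q \<otimes> u r s = (if q = r then u p s else \<zero>)"
    and span: "\<And>S. \<zero> \<in> S \<Longrightarrow> (\<And>p q. p \<in> P \<Longrightarrow> q \<in> P \<Longrightarrow> b p = b q \<Longrightarrow> u p q \<in> S) \<Longrightarrow>
      (\<And>x y. x \<in> S \<Longrightarrow> y \<in> S \<Longrightarrow> x \<oplus> y \<in> S) \<Longrightarrow> (\<And>k x. x \<in> S \<Longrightarrow> k \<odot> x \<in> S) \<Longrightarrow> carrier L \<subseteq> S"
  shows "\<exists>c. block_coordinates L P b c"
proof -
  define B where "B = {(p, q). p \<in> P \<and> q \<in> P \<and> b p = b q}"
  have B: "(p, q) \<in> B \<longleftrightarrow> p \<in> P \<and> q \<in> P \<and> b p = b q" for p q by (simp add: B_def)
  have BB: "(p, p) \<in> B" "(q, q) \<in> B" if "(p, q) \<in> B" for p q using that by (auto simp: B)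
  have uB: "u p q \<in> carrier L" if "(p, q) \<in> B" for p q using that u by (simp add: B)
  have um: "u p q \<otimes> u r s = (if q = r then u p s else \<zero>)" if "(p, q) \<in> B" "(r, s) \<in> B" for p q r s
    using that u_mult by (simp add: B)
  have cancel: "k = l" if "(p, q) \<in> B" "k \<odot> u p q = l \<odot> u p q" for k l p q
  proof -
    have "(k + (- l)) \<odot> u p q = k \<odot> u p q \<oplus> (- l) \<odot> u p q"
      by (rule smult_l_distr[OF uB[OF that(1)]])
    also have "(- l) \<odot> u p q = \<ominus> (l \<odot> u p q)"
      using uB[OF that(1)] smult_assoc[OF uB[OF that(1)], of "- 1" l] by (simp add: smult_minus_one)
    finally have "(k + (- l)) \<odot> u p q = \<zero>" using that(2) uB[OF that(1)] by (simp add: r_neg)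
    then show ?thesis using u_nz uB[OF that(1)] that(1) by (auto simp: smult_eq_zero_iff B)
  qed
  have span_all: "Q x" if "x \<in> carrier L" "Q \<zero>" "\<And>p q. (p, q) \<in> B \<Longrightarrow> Q (u p q)"
    "\<And>x y. x \<in> carrier L \<Longrightarrow> y \<in> carrier L \<Longrightarrow> Q x \<Longrightarrow> Q y \<Longrightarrow> Q (x \<oplus> y)"
    "\<And>k x. x \<in> carrier L \<Longrightarrow> Q x \<Longrightarrow> Q (k \<odot> x)" for Q x
  proof -
    have "carrier L \<subseteq> {x \<in> carrier L. Q x}"
      by (rule span) (use that u in \<open>auto simp: B\<close>)
    then show ?thesis using that(1) by blast
  qed
  \<comment> \<open>The factors on the two sides annihilate every matrix unit other than u p
    q.\<close>
  have ex: "\<exists>k. u p p \<otimes> x \<otimes> u q q = k \<odot> u p q" if pq: "(p, q) \<in> B" and x: "x \<in> carrier L" for p q x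
    using x
  proof (rule span_all)
    note c = uB[OF BB(1)[OF pq]] uB[OF BB(2)[OF pq]] uB[OF pq]
    show "\<exists>k. u p p \<otimes> \<zero> \<otimes> u q q = k \<odot> u p q" using c by (intro exI[of _ 0]) simp
    show "\<exists>k. u p p \<otimes> u r s \<otimes> u q q = k \<odot> u p q" if "(r, s) \<in> B" for r s
    proof (cases "r = p \<and> s = q")
      case True
      then show ?thesis using um[OF BB(1)[OF pq] pq] um[OF pq BB(2)[OF pq]] c
        by (intro exI[of _ 1]) simp
    next
      case False
      then have "u p p \<otimes> u r s \<otimes> u q q = \<zero>"
        using um[OF BB(1)[OF pq] that] um[OF that BB(2)[OF pq]] c uB[OF that]
        by (cases "r = p") (simp_all add: m_assoc)
      then show ?thesis using c by (intro exI[of _ 0]) simp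
    qed
    fix x y assume xy: "x \<in> carrier L" "y \<in> carrier L"
    show "\<exists>l. u p p \<otimes> (k \<odot> x) \<otimes> u q q = l \<odot> u p q"
      if "\<exists>k. u p p \<otimes> x \<otimes> u q q = k \<odot> u p q" for k
    proof -
      from that obtain l where "u p p \<otimes> x \<otimes> u q q = l \<odot> u p q" ..
      then have "u p p \<otimes> (k \<odot> x) \<otimes> u q q = (k * l) \<odot> u p q"
        using xy c by (simp add: smult_mult_l smult_mult_r smult_assoc)
      then show ?thesis ..
    qed
    assume "\<exists>k. u p p \<otimes> x \<otimes> u q q = k \<odot> u p q" "\<exists>k. u p p \<otimes> y \<otimes> u q q = k \<odot> u p q"
    then obtain k l where "u p p \<otimes> x \<otimes> u q q = k \<odot> u p q" "u p p \<otimes> y \<otimes> u q q = l \<odot> u p q"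
      by blast
    then have "u p p \<otimes> (x \<oplus> y) \<otimes> u q q = (k + l) \<odot> u p q"
      using xy c by (simp add: l_distr r_distr smult_l_distr)
    then show "\<exists>k. u p p \<otimes> (x \<oplus> y) \<otimes> u q q = k \<odot> u p q" ..
  qed
  define c where "c x p q = (if (p, q) \<in> B then THE k. u p p \<otimes> x \<otimes> u q q = k \<odot> u p q else 0)" for x p q
  have cI: "c x p q = k" if "(p, q) \<in> B" "u p p \<otimes> x \<otimes> u q q = k \<odot> u p q" for x p q k
    unfolding c_def using that cancel[OF that(1)] by (auto intro!: the_equality)
  have c: "u p p \<otimes> x \<otimes> u q q = c x p q \<odot> u p q" if "(p, q) \<in> B" "x \<in> carrier L" for x p q
    using ex[OF that] cI[OF that(1)] by metis
  have c_off: "c x p q = 0" if "(p, q) \<notin> B" for x p q using that by (simp add: c_def)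
  have c_add: "c (x \<oplus> y) p q = c x p q + c y p q" if xy: "x \<in> carrier L" "y \<in> carrier L" for x y p q
  proof (cases "(p, q) \<in> B")
    case True
    then show ?thesis using xy uB[OF True] uB[OF BB(1)[OF True]] uB[OF BB(2)[OF True]] c[OF True]
      by (intro cI) (simp_all add: l_distr r_distr smult_l_distr)
  qed (simp add: c_off)
  have c_smult: "c (k \<odot> x) p q = k * c x p q" if x: "x \<in> carrier L" for x k p q
  proof (cases "(p, q) \<in> B")
    case True
    then show ?thesis using x uB[OF True] uB[OF BB(1)[OF True]] uB[OF BB(2)[OF True]] c[OF True]
      by (intro cI) (simp_all add: smult_mult_l smult_mult_r smult_assoc)
  qed (simp add: c_off)
  have c_zero: "c \<zero> p q = 0" for p q using c_smult[of \<zero> 0 p q] by simp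
  have c_u: "c (u r s) p q = (if p = r \<and> q = s then 1 else 0)" if rs: "(r, s) \<in> B" for r s p q
  proof (cases "(p, q) \<in> B")
    case True
    note cl = uB[OF True] uB[OF BB(1)[OF True]] uB[OF BB(2)[OF True]] uB[OF rs]
    show ?thesis
      by (rule cI[OF True])
        (use cl um[OF BB(1)[OF True] rs] um[OF rs BB(2)[OF True]] um[OF True BB(2)[OF True]]
          in \<open>auto simp: m_assoc\<close>)
  next
    case False
    then show ?thesis using rs by (auto simp: c_off)
  qed
  \<comment> \<open>The product formula is bilinear: it is checked on two matrix units, extended
    here in the right factor and afterwards in the left one.\<close>
  have c_mult_u: "c (u r s \<otimes> y) p q = (\<Sum>w\<in>{w\<in>P. b w = b p}. c (u r s) p w * c y w q)"
    if rs: "(r, s) \<in> B" and p: "p \<in> P" and y: "y \<in> carrier L" for r s y p q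
    using y
  proof (rule span_all)
    fix t v assume tv: "(t, v) \<in> B"
    have "(\<Sum>w\<in>{w\<in>P. b w = b p}. c (u r s) p w * c (u t v) w q) =
        (\<Sum>w\<in>{w\<in>P. b w = b p}. if w = s then (if p = r \<and> s = t \<and> q = v then 1 else 0) else 0)"
      by (intro sum.cong refl) (auto simp: c_u rs tv)
    also have "\<dots> = (if p = r \<and> s = t \<and> q = v then 1 else 0)"
      using fin[OF p] rs by (auto simp: B)
    also have "\<dots> = c (u r s \<otimes> u t v) p q"
    proof (cases "s = t")
      case True
      then have "(r, v) \<in> B" using rs tv by (simp add: B)
      then show ?thesis using um[OF rs tv] True by (simp add: c_u)
    qed (use um[OF rs tv] in \<open>simp add: c_zero\<close>)
    finally show "c (u r s \<otimes> u t v) p q = (\<Sum>w\<in>{w\<in>P. b w = b p}. c (u r s) p w * c (u t v) w q)" ..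
  qed (use uB[OF rs] in \<open>simp_all add: c_zero c_add c_smult r_distr smult_mult_r distrib_left sum.distrib
      sum_distrib_left mult.left_commute\<close>)
  have c_mult: "c (x \<otimes> y) p q = (\<Sum>w\<in>{w\<in>P. b w = b p}. c x p w * c y w q)"
    if p: "p \<in> P" and x: "x \<in> carrier L" and y: "y \<in> carrier L" for x y p q
    using x
    by (rule span_all) (use y in \<open>simp_all add: c_mult_u p c_zero c_add c_smult l_distr smult_mult_l
      distrib_right sum.distrib sum_distrib_left mult.assoc\<close>)
  let ?e = "\<lambda>x pq. c x (fst pq) (snd pq) \<odot> u (fst pq) (snd pq)"
  \<comment> \<open>One induction gives finite support and the expansion of x by its coordinates,
    from which injectivity of c follows. Allowing any finite T that contains the support lets the
    induction pass through sums, where coordinates may cancel.\<close>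
  have expand: "\<exists>T. finite T \<and> T \<subseteq> B \<and> (\<forall>p q. c x p q \<noteq> 0 \<longrightarrow> (p, q) \<in> T) \<and> x = (\<Oplus>pq\<in>T. ?e x pq)"
    if x: "x \<in> carrier L" for x
    using x
  proof (rule span_all)
    show "\<exists>T. finite T \<and> T \<subseteq> B \<and> (\<forall>p q. c \<zero> p q \<noteq> 0 \<longrightarrow> (p, q) \<in> T) \<and> \<zero> = (\<Oplus>pq\<in>T. ?e \<zero> pq)"
      by (intro exI[of _ "{}"]) (simp add: c_zero)
    fix p q assume pq: "(p, q) \<in> B"
    show "\<exists>T. finite T \<and> T \<subseteq> B \<and> (\<forall>p' q'. c (u p q) p' q' \<noteq> 0 \<longrightarrow> (p', q') \<in> T) \<and>
        u p q = (\<Oplus>pq'\<in>T. ?e (u p q) pq')"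
      using pq uB[OF pq] by (intro exI[of _ "{(p, q)}"]) (simp add: c_u)
  next
    fix k x assume xL: "x \<in> carrier L"
    assume "\<exists>T. finite T \<and> T \<subseteq> B \<and> (\<forall>p q. c x p q \<noteq> 0 \<longrightarrow> (p, q) \<in> T) \<and> x = (\<Oplus>pq\<in>T. ?e x pq)"
    then obtain T where T: "finite T" "T \<subseteq> B" "\<And>p q. c x p q \<noteq> 0 \<Longrightarrow> (p, q) \<in> T"
      "x = (\<Oplus>pq\<in>T. ?e x pq)" by blast
    have cl: "?e x \<in> T \<rightarrow> carrier L" using T(2) uB by auto
    have *: "k \<odot> (\<Oplus>pq\<in>S. f pq) = (\<Oplus>pq\<in>S. k \<odot> f pq)"
      if "finite S" "f \<in> S \<rightarrow> carrier L" for S and f :: "'p \<times> 'p \<Rightarrow> 'a"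
      using that by (induction S rule: finite_induct) (auto simp: smult_r_distr Pi_def)
    have "k \<odot> x = k \<odot> (\<Oplus>pq\<in>T. ?e x pq)" using T(4) by simp
    also have "\<dots> = (\<Oplus>pq\<in>T. k \<odot> ?e x pq)" by (rule *[OF T(1) cl])
    also have "\<dots> = (\<Oplus>pq\<in>T. ?e (k \<odot> x) pq)"
      using T(2) uB xL by (intro finsum_cong') (auto simp: c_smult smult_assoc)
    finally have "k \<odot> x = (\<Oplus>pq\<in>T. ?e (k \<odot> x) pq)" .
    moreover have "\<forall>p q. c (k \<odot> x) p q \<noteq> 0 \<longrightarrow> (p, q) \<in> T" using T(3) by (simp add: c_smult[OF xL])
    ultimately show "\<exists>T. finite T \<and> T \<subseteq> B \<and> (\<forall>p q. c (k \<odot> x) p q \<noteq> 0 \<longrightarrow> (p, q) \<in> T) \<and>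
        k \<odot> x = (\<Oplus>pq\<in>T. ?e (k \<odot> x) pq)"
      using T(1,2) by blast
  next
    fix x y assume xy: "x \<in> carrier L" "y \<in> carrier L"
    assume "\<exists>T. finite T \<and> T \<subseteq> B \<and> (\<forall>p q. c x p q \<noteq> 0 \<longrightarrow> (p, q) \<in> T) \<and> x = (\<Oplus>pq\<in>T. ?e x pq)"
      "\<exists>T. finite T \<and> T \<subseteq> B \<and> (\<forall>p q. c y p q \<noteq> 0 \<longrightarrow> (p, q) \<in> T) \<and> y = (\<Oplus>pq\<in>T. ?e y pq)"
    then obtain T T' where T: "finite T" "T \<subseteq> B" "\<forall>p q. c x p q \<noteq> 0 \<longrightarrow> (p, q) \<in> T"
      "x = (\<Oplus>pq\<in>T. ?e x pq)" and T': "finite T'" "T' \<subseteq> B" "\<forall>p q. c y p q \<noteq> 0 \<longrightarrow> (p, q) \<in> T'"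
      "y = (\<Oplus>pq\<in>T'. ?e y pq)" by blast
    have cl: "?e z \<in> T \<union> T' \<rightarrow> carrier L" for z using T(2) T'(2) uB by auto
    have "(\<Oplus>pq\<in>T. ?e x pq) = (\<Oplus>pq\<in>T \<union> T'. ?e x pq)"
    proof (rule add.finprod_mono_neutral_cong_left)
      fix pq assume pq: "pq \<in> (T \<union> T') - T"
      then have "c x (fst pq) (snd pq) = 0" using T(3)[rule_format, of "fst pq" "snd pq"] by auto
      then show "?e x pq = \<zero>" using pq T'(2) uB[of "fst pq" "snd pq"] by auto
    qed (use T T' cl in auto)
    moreover have "(\<Oplus>pq\<in>T'. ?e y pq) = (\<Oplus>pq\<in>T \<union> T'. ?e y pq)"
    proof (rule add.finprod_mono_neutral_cong_left)
      fix pq assume pq: "pq \<in> (T \<union> T') - T'"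
      then have "c y (fst pq) (snd pq) = 0" using T'(3)[rule_format, of "fst pq" "snd pq"] by auto
      then show "?e y pq = \<zero>" using pq T(2) uB[of "fst pq" "snd pq"] by auto
    qed (use T T' cl in auto)
    ultimately have "x \<oplus> y = (\<Oplus>pq\<in>T \<union> T'. ?e x pq) \<oplus> (\<Oplus>pq\<in>T \<union> T'. ?e y pq)"
      using T(4) T'(4) by simp
    also have "\<dots> = (\<Oplus>pq\<in>T \<union> T'. ?e x pq \<oplus> ?e y pq)" by (rule finsum_addf[symmetric, OF cl cl])
    also have "\<dots> = (\<Oplus>pq\<in>T \<union> T'. ?e (x \<oplus> y) pq)"
      using T(2) T'(2) uB xy by (intro finsum_cong') (auto simp: c_add smult_l_distr)
    finally have "x \<oplus> y = (\<Oplus>pq\<in>T \<union> T'. ?e (x \<oplus> y) pq)" .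
    moreover have "\<forall>p q. c (x \<oplus> y) p q \<noteq> 0 \<longrightarrow> (p, q) \<in> T \<union> T'"
      using T(3) T'(3) by (force simp: c_add[OF xy])
    moreover have "finite (T \<union> T')" "T \<union> T' \<subseteq> B" using T(1,2) T'(1,2) by auto
    ultimately show "\<exists>T. finite T \<and> T \<subseteq> B \<and> (\<forall>p q. c (x \<oplus> y) p q \<noteq> 0 \<longrightarrow> (p, q) \<in> T) \<and>
        x \<oplus> y = (\<Oplus>pq\<in>T. ?e (x \<oplus> y) pq)"
      by blast
  qed
  have "block_coordinates L P b c"
  proof unfold_locales
    show "finite {q\<in>P. b q = b p}" if "p \<in> P" for p by (rule fin[OF that])
  next
    fix x y assume xy: "x \<in> carrier L" "y \<in> carrier L" "c x = c y"
    define z where "z = x \<oplus> (- 1) \<odot> y"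
    have z: "z \<in> carrier L" using xy by (simp add: z_def)
    have cz: "c z p q = 0" for p q using xy by (simp add: z_def c_add c_smult)
    from expand[OF z] obtain T where T: "T \<subseteq> B" "z = (\<Oplus>pq\<in>T. ?e z pq)" by blast
    have "(\<Oplus>pq\<in>T. ?e z pq) = (\<Oplus>pq\<in>T. \<zero>)"
      using T(1) uB by (intro finsum_cong') (auto simp: cz)
    then have "z = \<zero>" using T(2) by simp
    then show "x = y" using xy
      by (simp add: z_def smult_minus_one a_minus_def[symmetric] diff_eq_zero_iff)
  next
    fix x p q assume "c x p q \<noteq> 0"
    then show "p \<in> P \<and> q \<in> P \<and> b p = b q" using c_off[of p q x] B by blast
  next
    fix x assume "x \<in> carrier L"
    from expand[OF this] obtain T where T: "finite T" "\<forall>p q. c x p q \<noteq> 0 \<longrightarrow> (p, q) \<in> T" by blast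
    then have "{(p, q). c x p q \<noteq> 0} \<subseteq> T" by blast
    then show "finite {(p, q). c x p q \<noteq> 0}" using T(1) by (rule finite_subset)
  next
    fix m :: "'p \<Rightarrow> 'p \<Rightarrow> 'k"
    assume mfin: "finite {(p, q). m p q \<noteq> 0}"
      and supp: "\<And>p q. m p q \<noteq> 0 \<Longrightarrow> p \<in> P \<and> q \<in> P \<and> b p = b q"
    let ?T = "{(p, q). m p q \<noteq> 0}" and ?m = "\<lambda>pq. m (fst pq) (snd pq) \<odot> u (fst pq) (snd pq)"
    have TB: "?T \<subseteq> B" using supp B by blast
    then have cl: "?m \<in> ?T \<rightarrow> carrier L" using uB by (auto simp: subset_iff)
    have "c (\<Oplus>pq\<in>?T. ?m pq) p q = m p q" for p q
    proof -
      have "c (\<Oplus>pq\<in>?T. ?m pq) p q = (\<Sum>pq\<in>?T. c (?m pq) p q)"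
        by (rule additive_finsum[OF mfin cl]) (rule c_add)
      also have "\<dots> = (\<Sum>pq\<in>?T. if pq = (p, q) then m p q else 0)"
      proof (intro sum.cong refl)
        fix pq assume "pq \<in> ?T"
        then have "(fst pq, snd pq) \<in> B" using TB by auto
        then show "c (?m pq) p q = (if pq = (p, q) then m p q else 0)"
          by (auto simp: c_smult uB c_u prod_eq_iff)
      qed
      also have "\<dots> = m p q" using mfin by simp
      finally show ?thesis .
    qed
    then have "c (\<Oplus>pq\<in>?T. ?m pq) = m" by (intro ext)
    moreover have "(\<Oplus>pq\<in>?T. ?m pq) \<in> carrier L" using cl by (rule finsum_closed)
    ultimately show "\<exists>x\<in>carrier L. c x = m" by blast
  qed (rule c_add c_smult c_mult; assumption)+
  then show ?thesis by blast
qed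

end

section \<open>Leavitt families\<close>

text \<open>
  The map \<open>pr d\<close> is the projection to the homogeneous component of degree \<open>d\<close>.
\<close>

locale leavitt_family = nonunital_algebra L + G: wf_digraph E
  for L :: "('k::field, 'a) module" (structure) and E :: "('v, 'e) pre_digraph" +
  fixes vert :: "'v \<Rightarrow> 'a" and edge :: "'e \<Rightarrow> 'a" and ghost :: "'e \<Rightarrow> 'a"
    and pr :: "int \<Rightarrow> 'a \<Rightarrow> 'a"
  assumes vert_closed [simp, intro]: "v \<in> verts E \<Longrightarrow> vert v \<in> carrier L"
    and edge_closed [simp, intro]: "e \<in> arcs E \<Longrightarrow> edge e \<in> carrier L"
    and ghost_closed [simp, intro]: "e \<in> arcs E \<Longrightarrow> ghost e \<in> carrier L"
    and vert_vert: "v \<in> verts E \<Longrightarrow> w \<in> verts E \<Longrightarrow> vert v \<otimes> vert w = (if v = w then vert v else \<zero>)"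
    and vert_edge: "e \<in> arcs E \<Longrightarrow> vert (tail E e) \<otimes> edge e = edge e"
    and edge_vert: "e \<in> arcs E \<Longrightarrow> edge e \<otimes> vert (head E e) = edge e"
    and vert_ghost: "e \<in> arcs E \<Longrightarrow> vert (head E e) \<otimes> ghost e = ghost e"
    and ghost_vert: "e \<in> arcs E \<Longrightarrow> ghost e \<otimes> vert (tail E e) = ghost e"
    and ghost_edge: "e \<in> arcs E \<Longrightarrow> f \<in> arcs E \<Longrightarrow>
      ghost e \<otimes> edge f = (if e = f then vert (head E e) else \<zero>)"
    and vert_regular: "regular_vertex E v \<Longrightarrow> vert v = (\<Oplus>e\<in>out_arcs E v. edge e \<otimes> ghost e)"
    and vert_nonzero: "v \<in> verts E \<Longrightarrow> vert v \<noteq> \<zero>"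
    and generated: "\<And>S. \<zero> \<in> S \<Longrightarrow> (\<And>v. v \<in> verts E \<Longrightarrow> vert v \<in> S) \<Longrightarrow>
      (\<And>e. e \<in> arcs E \<Longrightarrow> edge e \<in> S) \<Longrightarrow> (\<And>e. e \<in> arcs E \<Longrightarrow> ghost e \<in> S) \<Longrightarrow>
      (\<And>x y. x \<in> S \<Longrightarrow> y \<in> S \<Longrightarrow> x \<oplus> y \<in> S) \<Longrightarrow> (\<And>k x. x \<in> S \<Longrightarrow> k \<odot> x \<in> S) \<Longrightarrow>
      (\<And>v x. v \<in> verts E \<Longrightarrow> x \<in> S \<Longrightarrow> vert v \<otimes> x \<in> S) \<Longrightarrow>
      (\<And>e x. e \<in> arcs E \<Longrightarrow> x \<in> S \<Longrightarrow> edge e \<otimes> x \<in> S) \<Longrightarrow>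
      (\<And>e x. e \<in> arcs E \<Longrightarrow> x \<in> S \<Longrightarrow> ghost e \<otimes> x \<in> S) \<Longrightarrow> carrier L \<subseteq> S"
    and pr_closed [simp, intro]: "x \<in> carrier L \<Longrightarrow> pr d x \<in> carrier L"
    and pr_add: "x \<in> carrier L \<Longrightarrow> y \<in> carrier L \<Longrightarrow> pr d (x \<oplus> y) = pr d x \<oplus> pr d y"
    and pr_finite: "x \<in> carrier L \<Longrightarrow> finite {d. pr d x \<noteq> \<zero>}"
    and pr_eq_zero: "x \<in> carrier L \<Longrightarrow> (\<And>d. pr d x = \<zero>) \<Longrightarrow> x = \<zero>"
    and pr_edge_l: "e \<in> arcs E \<Longrightarrow> x \<in> carrier L \<Longrightarrow> pr d (edge e \<otimes> x) = edge e \<otimes> pr (d - 1) x"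
    and pr_edge_r: "e \<in> arcs E \<Longrightarrow> x \<in> carrier L \<Longrightarrow> pr d (x \<otimes> edge e) = pr (d - 1) x \<otimes> edge e"
    and pr_vert: "v \<in> verts E \<Longrightarrow> pr d (vert v) = (if d = 0 then vert v else \<zero>)"
    and pr_vert_l: "v \<in> verts E \<Longrightarrow> x \<in> carrier L \<Longrightarrow> pr d (vert v \<otimes> x) = vert v \<otimes> pr d x"
    and pr_vert_r: "v \<in> verts E \<Longrightarrow> x \<in> carrier L \<Longrightarrow> pr d (x \<otimes> vert v) = pr d x \<otimes> vert v"
begin

section \<open>Paths, ghost paths and the monomials p q^*\<close>

lemma tail_verts [simp]: "e \<in> arcs E \<Longrightarrow> tail E e \<in> verts E"
  and head_verts [simp]: "e \<in> arcs E \<Longrightarrow> head E e \<in> verts E"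
  by (simp_all add: G.wellformed)

lemma mult_left_cancel3:
  "x \<in> carrier L \<Longrightarrow> y \<in> carrier L \<Longrightarrow> z \<in> carrier L \<Longrightarrow> x \<otimes> y = w \<Longrightarrow> x \<otimes> (y \<otimes> z) = w \<otimes> z"
  by (simp add: m_assoc[symmetric])

lemma vert_edge_if:
  "v \<in> verts E \<Longrightarrow> e \<in> arcs E \<Longrightarrow> vert v \<otimes> edge e = (if v = tail E e then edge e else \<zero>)"
  using mult_left_cancel3[of "vert v" "vert (tail E e)" "edge e", OF _ _ _ vert_vert]
  by (auto simp: vert_edge)

lemma ghost_vert_if:
  "v \<in> verts E \<Longrightarrow> e \<in> arcs E \<Longrightarrow> ghost e \<otimes> vert v = (if v = tail E e then ghost e else \<zero>)"
  using m_assoc[of "ghost e" "vert (tail E e)" "vert v"] by (auto simp: ghost_vert vert_vert)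

lemma edge_vert_if:
  "v \<in> verts E \<Longrightarrow> e \<in> arcs E \<Longrightarrow> edge e \<otimes> vert v = (if v = head E e then edge e else \<zero>)"
  using m_assoc[of "edge e" "vert (head E e)" "vert v"] by (auto simp: edge_vert vert_vert)

text \<open>The end vertex is an argument because the empty path stands for a vertex that its edge
  list does not determine.\<close>

definition path_elem :: "'e list \<Rightarrow> 'v \<Rightarrow> 'a" where
  "path_elem es v = foldr (\<lambda>e x. edge e \<otimes> x) es (vert v)"

text \<open>The order of the factors is reversed, as (p q)^* = q^* p^*.\<close>

fun ghost_elem :: "'e list \<Rightarrow> 'v \<Rightarrow> 'a" where
  "ghost_elem [] v = vert v"
| "ghost_elem (e # es) v = ghost_elem es v \<otimes> ghost e"

lemma path_elem_simps [simp]: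
  "path_elem [] v = vert v" "path_elem (e # es) v = edge e \<otimes> path_elem es v"
  by (simp_all add: path_elem_def)

lemma walk_Nil [simp]: "G.awalk u [] v \<longleftrightarrow> u = v \<and> u \<in> verts E"
  by (rule G.awalk_Nil_iff)

lemma walk_Cons [simp]: "G.awalk u (e # es) v \<longleftrightarrow> e \<in> arcs E \<and> u = tail E e \<and> G.awalk (head E e) es v"
  by (auto simp: G.awalk_Cons_iff)

lemma walk_end: "G.awalk u es v \<Longrightarrow> v \<in> verts E"
  by (rule G.awalk_last_in_verts)

lemma walk_snoc:
  assumes "G.awalk u es v" "e \<in> arcs E" "tail E e = v"
  shows "G.awalk u (es @ [e]) (head E e)"
  using assms by (induction es arbitrary: u) auto

lemma path_elem_props:
  assumes "G.awalk u es v"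
  shows "path_elem es v \<in> carrier L" "ghost_elem es v \<in> carrier L"
    "vert u \<otimes> path_elem es v = path_elem es v" "path_elem es v \<otimes> vert v = path_elem es v"
    "ghost_elem es v \<otimes> vert u = ghost_elem es v" "vert v \<otimes> ghost_elem es v = ghost_elem es v"
    "ghost_elem es v \<otimes> path_elem es v = vert v"
proof -
  have "path_elem es v \<in> carrier L \<and> ghost_elem es v \<in> carrier L \<and>
    vert u \<otimes> path_elem es v = path_elem es v \<and> path_elem es v \<otimes> vert v = path_elem es v \<and>
    ghost_elem es v \<otimes> vert u = ghost_elem es v \<and> vert v \<otimes> ghost_elem es v = ghost_elem es v \<and>
    ghost_elem es v \<otimes> path_elem es v = vert v"
    using assms
  proof (induction es arbitrary: u)
    case Nil
    then show ?case by (auto simp: vert_vert)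
  next
    case (Cons e es)
    then have e: "e \<in> arcs E" "u = tail E e" and w: "G.awalk (head E e) es v" by simp_all
    note IH = Cons.IH[OF w]
    have v: "v \<in> verts E" using walk_end[OF w] .
    have "ghost_elem es v \<otimes> ghost e \<otimes> (edge e \<otimes> path_elem es v) =
        ghost_elem es v \<otimes> (ghost e \<otimes> edge e \<otimes> path_elem es v)"
      using IH e by (simp add: m_assoc)
    also have "\<dots> = vert v" using IH e by (simp add: ghost_edge)
    finally have "ghost_elem es v \<otimes> ghost e \<otimes> (edge e \<otimes> path_elem es v) = vert v" .
    moreover have "vert u \<otimes> (edge e \<otimes> path_elem es v) = edge e \<otimes> path_elem es v"
      using IH e by (simp add: m_assoc[symmetric] vert_edge)
    moreover have "edge e \<otimes> path_elem es v \<otimes> vert v = edge e \<otimes> path_elem es v"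
      using IH e v by (simp add: m_assoc)
    moreover have "ghost_elem es v \<otimes> ghost e \<otimes> vert u = ghost_elem es v \<otimes> ghost e"
      using IH e by (simp add: m_assoc ghost_vert)
    moreover have "vert v \<otimes> (ghost_elem es v \<otimes> ghost e) = ghost_elem es v \<otimes> ghost e"
      using IH e v by (simp add: m_assoc[symmetric])
    ultimately show ?case using IH e by simp
  qed
  then show "path_elem es v \<in> carrier L" "ghost_elem es v \<in> carrier L"
    "vert u \<otimes> path_elem es v = path_elem es v" "path_elem es v \<otimes> vert v = path_elem es v"
    "ghost_elem es v \<otimes> vert u = ghost_elem es v" "vert v \<otimes> ghost_elem es v = ghost_elem es v"
    "ghost_elem es v \<otimes> path_elem es v = vert v" by blast+
qed

lemma path_elem_snoc:
  assumes "G.awalk u es (tail E e)" "e \<in> arcs E"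
  shows "path_elem (es @ [e]) (head E e) = path_elem es (tail E e) \<otimes> edge e"
  using assms
proof (induction es arbitrary: u)
  case Nil
  then show ?case by (simp add: edge_vert vert_edge)
next
  case (Cons f es)
  then show ?case
    using Cons.IH[of "head E f"] path_elem_props(1)[of "head E f" es "tail E e"] by (simp add: m_assoc)
qed

lemma ghost_elem_snoc:
  assumes "G.awalk u es (tail E e)" "e \<in> arcs E"
  shows "ghost_elem (es @ [e]) (head E e) = ghost e \<otimes> ghost_elem es (tail E e)"
  using assms
proof (induction es arbitrary: u)
  case Nil
  then show ?case by (simp add: ghost_vert vert_ghost)
next
  case (Cons f es)
  then show ?case
    using Cons.IH[of "head E f"] path_elem_props(2)[of "head E f" es "tail E e"] by (simp add: m_assoc)
qed

definition monom :: "'e list \<Rightarrow> 'v \<Rightarrow> 'e list \<Rightarrow> 'a" where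
  "monom es v fs = path_elem es v \<otimes> ghost_elem fs v"

lemma monom_closed: "G.awalk u es v \<Longrightarrow> G.awalk w fs v \<Longrightarrow> monom es v fs \<in> carrier L"
  by (simp add: monom_def path_elem_props)

lemma vert_monom:
  assumes "G.awalk u es v" "G.awalk w fs v" "x \<in> verts E"
  shows "vert x \<otimes> monom es v fs = (if x = u then monom es v fs else \<zero>)"
proof -
  note p = path_elem_props[OF assms(1)] path_elem_props(2)[OF assms(2)]
  have u: "u \<in> verts E" by (rule G.awalk_hd_in_verts[OF assms(1)])
  have x: "vert x \<in> carrier L" "vert u \<in> carrier L" using u assms(3) by simp_all
  have "vert x \<otimes> monom es v fs = vert x \<otimes> (vert u \<otimes> monom es v fs)"
    unfolding monom_def m_assoc[OF x(2) p(1,8), symmetric] p(3) ..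
  also have "\<dots> = vert x \<otimes> vert u \<otimes> monom es v fs"
    by (rule m_assoc[OF x monom_closed[OF assms(1,2)], symmetric])
  also have "\<dots> = (if x = u then vert u \<otimes> monom es v fs else \<zero>)"
    unfolding vert_vert[OF assms(3) u] using monom_closed[OF assms(1,2)] by simp
  also have "vert u \<otimes> monom es v fs = monom es v fs"
    unfolding monom_def m_assoc[OF x(2) p(1,8), symmetric] p(3) ..
  finally show ?thesis .
qed

lemma edge_monom:
  assumes "G.awalk u es v" "G.awalk w fs v" "e \<in> arcs E"
  shows "edge e \<otimes> monom es v fs = (if head E e = u then monom (e # es) v fs else \<zero>)"
proof -
  note p = path_elem_props[OF assms(1)] path_elem_props(2)[OF assms(2)]
  have u: "u \<in> verts E" by (rule G.awalk_hd_in_verts[OF assms(1)])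
  have eq: "edge e \<otimes> monom es v fs = edge e \<otimes> vert u \<otimes> monom es v fs"
    using vert_monom[OF assms(1,2) u] monom_closed[OF assms(1,2)] assms(3) u by (simp add: m_assoc)
  have "edge e \<otimes> vert u \<otimes> monom es v fs = (if head E e = u then edge e \<otimes> monom es v fs else \<zero>)"
    using u assms(3) monom_closed[OF assms(1,2)] by (auto simp: edge_vert_if)
  moreover have "edge e \<otimes> monom es v fs = monom (e # es) v fs"
    using p(1,8) assms(3) by (simp add: monom_def m_assoc)
  ultimately have "edge e \<otimes> vert u \<otimes> monom es v fs = (if head E e = u then monom (e # es) v fs else \<zero>)"
    by (simp only:)
  with eq show ?thesis by (rule trans)
qed

lemma ghost_monom_Cons:
  assumes "G.awalk (head E f) es v" "G.awalk w fs v" "e \<in> arcs E" "f \<in> arcs E"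
  shows "ghost e \<otimes> monom (f # es) v fs = (if e = f then monom es v fs else \<zero>)"
proof -
  note p = path_elem_props[OF assms(1)] path_elem_props(2)[OF assms(2)]
  have "ghost e \<otimes> monom (f # es) v fs = ghost e \<otimes> edge f \<otimes> (path_elem es v \<otimes> ghost_elem fs v)"
    using p(1,8) assms(3,4) by (simp add: monom_def m_assoc)
  also have "\<dots> = (if e = f then vert (head E f) \<otimes> monom es v fs else \<zero>)"
    using p(1,8) assms(3,4) by (simp add: ghost_edge monom_def)
  finally show ?thesis using vert_monom[OF assms(1,2), of "head E f"] assms(4) by simp
qed

text \<open>Here e^* q^* = (q e)^*, so the edge is appended at the end of the second path.\<close>

lemma ghost_monom_Nil:
  assumes "G.awalk w fs v" "e \<in> arcs E"
  shows "ghost e \<otimes> monom [] v fs = (if tail E e = v then monom [] (head E e) (fs @ [e]) else \<zero>)"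
proof -
  note p = path_elem_props[OF assms(1)]
  have v: "v \<in> verts E" by (rule walk_end[OF assms(1)])
  have pv: "vert v \<otimes> ghost_elem fs v = ghost_elem fs v" by (rule p(6))
  have "ghost e \<otimes> monom [] v fs = ghost e \<otimes> vert v \<otimes> ghost_elem fs v"
    using p(2) v assms(2) by (simp add: monom_def m_assoc pv)
  also have "\<dots> = (if tail E e = v then ghost e \<otimes> ghost_elem fs v else \<zero>)"
    using p(2) v assms(2) by (auto simp: ghost_vert_if)
  also have "\<dots> = (if tail E e = v then monom [] (head E e) (fs @ [e]) else \<zero>)"
  proof (cases "tail E e = v")
    case True
    then have "ghost e \<otimes> ghost_elem fs v = ghost_elem (fs @ [e]) (head E e)"
      using ghost_elem_snoc[of w fs e] assms by simp
    moreover have "vert (head E e) \<otimes> (ghost e \<otimes> ghost_elem fs v) = ghost e \<otimes> ghost_elem fs v"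
      using p(2) assms(2) by (simp add: m_assoc[symmetric] vert_ghost)
    ultimately show ?thesis using True by (simp add: monom_def)
  qed simp
  finally show ?thesis .
qed

text \<open>Left multiplication by a generator sends a monomial to a monomial or to zero, and the
  generators are monomials themselves.\<close>

lemma spanned_by_monoms:
  assumes zero: "\<zero> \<in> S"
    and mon: "\<And>u es v w fs. G.awalk u es v \<Longrightarrow> G.awalk w fs v \<Longrightarrow> monom es v fs \<in> S"
    and add: "\<And>x y. x \<in> S \<Longrightarrow> y \<in> S \<Longrightarrow> x \<oplus> y \<in> S" and sm: "\<And>k x. x \<in> S \<Longrightarrow> k \<odot> x \<in> S"
  shows "carrier L \<subseteq> S"
proof -
  define cl where "cl T \<longleftrightarrow> \<zero> \<in> T \<and>
    (\<forall>u es v w fs. G.awalk u es v \<longrightarrow> G.awalk w fs v \<longrightarrow> monom es v fs \<in> T) \<and>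
    (\<forall>x\<in>T. \<forall>y\<in>T. x \<oplus> y \<in> T) \<and> (\<forall>k. \<forall>x\<in>T. k \<odot> x \<in> T)" for T
  have clD: "\<zero> \<in> T" "\<And>u es v w fs. G.awalk u es v \<Longrightarrow> G.awalk w fs v \<Longrightarrow> monom es v fs \<in> T"
    "\<And>x y. x \<in> T \<Longrightarrow> y \<in> T \<Longrightarrow> x \<oplus> y \<in> T" "\<And>k x. x \<in> T \<Longrightarrow> k \<odot> x \<in> T" if "cl T" for T
    using that unfolding cl_def by blast+
  \<comment> \<open>The part of L common to all sets with the closure properties of S. Unlike S it
    is stable under left multiplication by the generators, as \<open>generated\<close>
    requires.\<close>
  define M where "M = {x \<in> carrier L. \<forall>T. cl T \<longrightarrow> x \<in> T}"
  have left: "a \<otimes> x \<in> M" if x: "x \<in> M" and a: "a \<in> carrier L"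
    and am: "\<And>T u es v w fs. cl T \<Longrightarrow> G.awalk u es v \<Longrightarrow> G.awalk w fs v \<Longrightarrow> a \<otimes> monom es v fs \<in> T"
    for a x
  proof -
    have "a \<otimes> x \<in> T" if T: "cl T" for T
    proof -
      have "cl {y \<in> carrier L. a \<otimes> y \<in> T}"
        unfolding cl_def using clD[OF T] a am[OF T] monom_closed by (auto simp: r_distr smult_mult_r)
      then show ?thesis using x by (auto simp: M_def)
    qed
    then show ?thesis using x a by (simp add: M_def)
  qed
  have nil: "G.awalk v [] v" if "v \<in> verts E" for v using that by simp
  have "carrier L \<subseteq> M"
  proof (rule generated)
    show "\<zero> \<in> M" using clD(1) by (simp add: M_def)
    show "vert v \<in> M" if v: "v \<in> verts E" for v
    proof -
      have "monom [] v [] = vert v" using v by (simp add: monom_def vert_vert)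
      then show ?thesis using v clD(2)[OF _ nil[OF v] nil[OF v]] by (simp add: M_def)
    qed
    show "edge e \<in> M" if e: "e \<in> arcs E" for e
    proof -
      have "monom [e] (head E e) [] = edge e" using e by (simp add: monom_def edge_vert)
      then show ?thesis using e clD(2)[of _ "tail E e" "[e]" "head E e" "head E e" "[]"]
        by (simp add: M_def)
    qed
    show "ghost e \<in> M" if e: "e \<in> arcs E" for e
    proof -
      have "monom [] (head E e) [e] = ghost e" using e by (simp add: monom_def vert_ghost)
      then show ?thesis using e clD(2)[of _ "head E e" "[]" "head E e" "tail E e" "[e]"]
        by (simp add: M_def)
    qed
    show "x \<oplus> y \<in> M" if "x \<in> M" "y \<in> M" for x y using that clD(3) by (simp add: M_def)
    show "k \<odot> x \<in> M" if "x \<in> M" for k x using that clD(4) by (simp add: M_def)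
    show "vert v \<otimes> x \<in> M" if "v \<in> verts E" "x \<in> M" for v x
      using that clD(1,2) by (intro left) (auto simp: vert_monom)
    show "edge e \<otimes> x \<in> M" if "e \<in> arcs E" "x \<in> M" for e x
    proof (rule left[OF that(2)])
      fix T u es v w fs assume "cl T" "G.awalk u es v" "G.awalk w fs v"
      then show "edge e \<otimes> monom es v fs \<in> T"
        using that(1) clD(1) clD(2)[of T "tail E e" "e # es" v w fs] by (auto simp: edge_monom)
    qed (use that in simp)
    show "ghost e \<otimes> x \<in> M" if e: "e \<in> arcs E" and x: "x \<in> M" for e x
    proof (rule left[OF x])
      fix T u es v w fs assume T: "cl T" and w: "G.awalk u es v" "G.awalk w fs v"
      show "ghost e \<otimes> monom es v fs \<in> T"
      proof (cases es)
        case Nil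
        have "monom [] (head E e) (fs @ [e]) \<in> T" if te: "tail E e = v"
          using nil[OF head_verts[OF e]] walk_snoc[OF w(2) e te] by (rule clD(2)[OF T])
        then show ?thesis
          using ghost_monom_Nil[OF w(2) e] clD(1)[OF T] Nil by simp
      next
        case (Cons f es')
        then have f: "f \<in> arcs E" "G.awalk (head E f) es' v" using w(1) by simp_all
        show ?thesis
          using ghost_monom_Cons[OF f(2) w(2) e f(1)] clD(1)[OF T] clD(2)[OF T f(2) w(2)] Cons by simp
      qed
    qed (use e in simp)
  qed
  moreover have "cl S" unfolding cl_def using zero mon add sm by blast
  ultimately show ?thesis by (auto simp: M_def)
qed

end

section \<open>From solvability to the graph\<close>

context leavitt_family
begin

text \<open>A monomial is killed by all vertices except its start, and every element is a
  combination of finitely many monomials.\<close>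

lemma finite_left_vertices:
  assumes "x \<in> carrier L"
  shows "finite {v \<in> verts E. vert v \<otimes> x \<noteq> \<zero>}"
proof -
  let ?S = "{x \<in> carrier L. finite {v \<in> verts E. vert v \<otimes> x \<noteq> \<zero>}}"
  have "carrier L \<subseteq> ?S"
  proof (rule spanned_by_monoms)
    fix u es v w fs assume m: "G.awalk u es v" "G.awalk w fs v"
    have "{x \<in> verts E. vert x \<otimes> monom es v fs \<noteq> \<zero>} \<subseteq> {u}"
      using vert_monom[OF m] by (auto split: if_splits)
    then show "monom es v fs \<in> ?S" using monom_closed[OF m] finite_subset by blast
  next
    fix x y assume xy: "x \<in> ?S" "y \<in> ?S"
    then have "{v \<in> verts E. vert v \<otimes> (x \<oplus> y) \<noteq> \<zero>} \<subseteq>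
        {v \<in> verts E. vert v \<otimes> x \<noteq> \<zero>} \<union> {v \<in> verts E. vert v \<otimes> y \<noteq> \<zero>}"
      by (auto simp: r_distr)
    then have "finite {v \<in> verts E. vert v \<otimes> (x \<oplus> y) \<noteq> \<zero>}"
      by (rule finite_subset) (use xy in simp)
    then show "x \<oplus> y \<in> ?S" using xy by simp
  next
    fix k x assume x: "x \<in> ?S"
    then have "{v \<in> verts E. vert v \<otimes> (k \<odot> x) \<noteq> \<zero>} \<subseteq> {v \<in> verts E. vert v \<otimes> x \<noteq> \<zero>}"
      by (auto simp: smult_mult_r)
    then have "finite {v \<in> verts E. vert v \<otimes> (k \<odot> x) \<noteq> \<zero>}"
      by (rule finite_subset) (use x in simp)
    then show "k \<odot> x \<in> ?S" using x by simp
  next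
    have "{v \<in> verts E. vert v \<otimes> \<zero> \<noteq> \<zero>} = {}" by auto
    then have "finite {v \<in> verts E. vert v \<otimes> \<zero> \<noteq> \<zero>}" by (simp only: finite.emptyI)
    then show "\<zero> \<in> ?S" by blast
  qed
  then show ?thesis using assms by auto
qed

text \<open>Solvability for the orthogonal idempotents \<open>vert (w i)\<close> would give a single
  z that none of them kills. The \<open>y i\<close> will be paths or ghost paths joining infinitely
  many vertices to a single one.\<close>

lemma no_infinite_left_vertices:
  assumes Q: orthogonal_solvable and w: "inj w" "\<And>i::nat. w i \<in> verts E"
    and y: "\<And>i. y i \<in> carrier L" "\<And>i. vert (w i) \<otimes> y i = y i" and u: "u \<in> carrier L"
    and nz: "\<And>i. y i \<otimes> u \<noteq> \<zero>"
  shows False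
proof -
  have "\<forall>i. vert (w i) \<in> carrier L \<and> y i \<in> carrier L \<and> vert (w i) \<otimes> y i = y i"
    using w y by simp
  moreover have "\<forall>i j. vert (w i) \<otimes> vert (w j) = (if i = j then vert (w i) else \<zero>)"
    using w by (simp add: vert_vert inj_eq)
  ultimately obtain z where z: "z \<in> carrier L" "\<forall>i. vert (w i) \<otimes> z = y i \<otimes> u"
    using Q[unfolded orthogonal_solvable_def, rule_format, of "\<lambda>i. vert (w i)" y u] u by blast
  then have "range w \<subseteq> {v \<in> verts E. vert v \<otimes> z \<noteq> \<zero>}" using nz w(2) by auto
  then have "finite (range w)" using finite_left_vertices[OF z(1)] by (rule finite_subset)
  then show False using w(1) finite_imageD[of w UNIV] by simp
qed

text \<open>For a monomial p q^* with at least one edge, f^* p q^* f vanishes unless f is the first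
  edge of p, or of q if p is empty. Among the vertices only v contributes, and it contributes the
  constant 1.\<close>

lemma almost_constant_diagonal:
  assumes x: "x \<in> carrier L" and v: "v \<in> verts E"
  shows "\<exists>k. finite {f \<in> out_arcs E v. ghost f \<otimes> x \<otimes> edge f \<noteq> k \<odot> vert (head E f)}"
proof -
  let ?B = "\<lambda>x k. {f \<in> out_arcs E v. ghost f \<otimes> x \<otimes> edge f \<noteq> k \<odot> vert (head E f)}"
  let ?S = "{x \<in> carrier L. \<exists>k. finite (?B x k)}"
  have arc: "f \<in> arcs E" "tail E f = v" if "f \<in> out_arcs E v" for f using that by auto
  have "carrier L \<subseteq> ?S"
  proof (rule spanned_by_monoms)
    have "?B \<zero> 0 = {}" using arc by auto
    then have "finite (?B \<zero> 0)" by (simp only: finite.emptyI)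
    then show "\<zero> \<in> ?S" by blast
  next
    fix u es t w fs assume m: "G.awalk u es t" "G.awalk w fs t"
    have t: "t \<in> verts E" by (rule walk_end[OF m(1)])
    have "\<exists>k. finite (?B (monom es t fs) k)"
    proof (cases es)
      case Nil
      show ?thesis
      proof (cases fs)
        case fs: Nil
        have "monom es t fs = vert t" using t by (simp add: monom_def Nil fs vert_vert)
        then have "ghost f \<otimes> monom es t fs \<otimes> edge f = (if t = v then 1 else 0) \<odot> vert (head E f)"
          if "f \<in> out_arcs E v" for f
          using arc[OF that] t by (auto simp: ghost_vert_if ghost_edge)
        then have "?B (monom es t fs) (if t = v then 1 else 0) = {}" by blast
        then have "finite (?B (monom es t fs) (if t = v then 1 else 0))"
          by (simp only: finite.emptyI)
        then show ?thesis by (rule exI)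
      next
        case (Cons e fs')
        have e: "e \<in> arcs E" and w': "G.awalk (head E e) fs' t" using m(2) Cons by simp_all
        have g: "ghost_elem fs' t \<in> carrier L" using path_elem_props(2)[OF w'] .
        have "ghost f \<otimes> monom es t fs \<otimes> edge f = 0 \<odot> vert (head E f)"
          if "f \<in> out_arcs E v" "f \<noteq> e" for f
        proof -
          have "ghost f \<otimes> monom es t fs \<otimes> edge f =
              ghost f \<otimes> vert t \<otimes> ghost_elem fs' t \<otimes> (ghost e \<otimes> edge f)"
            using arc[OF that(1)] t e g by (simp add: monom_def Nil Cons m_assoc)
          also have "\<dots> = \<zero>" using arc[OF that(1)] t e g that(2) by (simp add: ghost_edge)
          finally show ?thesis using arc[OF that(1)] by simp
        qed
        then have "?B (monom es t fs) 0 \<subseteq> {e}" by blast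
        then show ?thesis using finite_subset by blast
      qed
    next
      case (Cons e es')
      have e: "e \<in> arcs E" and w': "G.awalk (head E e) es' t" using m(1) Cons by simp_all
      have "ghost f \<otimes> monom es t fs \<otimes> edge f = 0 \<odot> vert (head E f)"
        if "f \<in> out_arcs E v" "f \<noteq> e" for f
        using ghost_monom_Cons[OF w' m(2) arc(1)[OF that(1)] e] that arc[OF that(1)] Cons by simp
      then have "?B (monom es t fs) 0 \<subseteq> {e}" by blast
      then show ?thesis using finite_subset by blast
    qed
    then show "monom es t fs \<in> ?S" using monom_closed[OF m] by simp
  next
    fix x y assume "x \<in> ?S" "y \<in> ?S"
    then obtain k l where kl: "finite (?B x k)" "finite (?B y l)" and xy: "x \<in> carrier L" "y \<in> carrier L"
      by blast
    have "?B (x \<oplus> y) (k + l) \<subseteq> ?B x k \<union> ?B y l"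
    proof
      fix f assume f: "f \<in> ?B (x \<oplus> y) (k + l)"
      then have "f \<in> arcs E" by simp
      then have "ghost f \<otimes> (x \<oplus> y) \<otimes> edge f = ghost f \<otimes> x \<otimes> edge f \<oplus> ghost f \<otimes> y \<otimes> edge f"
        "(k + l) \<odot> vert (head E f) = k \<odot> vert (head E f) \<oplus> l \<odot> vert (head E f)"
        using xy by (simp_all add: r_distr l_distr smult_l_distr)
      then show "f \<in> ?B x k \<union> ?B y l" using f by auto
    qed
    then have "finite (?B (x \<oplus> y) (k + l))" by (rule finite_subset) (use kl in blast)
    then show "x \<oplus> y \<in> ?S" using xy by blast
  next
    fix l x assume "x \<in> ?S"
    then obtain k where k: "finite (?B x k)" and x: "x \<in> carrier L" by blast
    have "?B (l \<odot> x) (l * k) \<subseteq> ?B x k"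
      using x by (auto simp: smult_mult_l smult_mult_r smult_assoc)
    then have "finite (?B (l \<odot> x) (l * k))" by (rule finite_subset) (rule k)
    then show "l \<odot> x \<in> ?S" using x by blast
  qed
  then show ?thesis using x by blast
qed

text \<open>The orthogonal idempotents are the f f^* for infinitely many edges f leaving v.
  Prescribing f f^* and 0 in turn makes the diagonal of z alternate between 1 and 0, so it is not
  almost constant.\<close>

lemma row_finite:
  assumes Q: orthogonal_solvable
  shows "row_finite E"
  unfolding row_finite_def
proof (intro ballI, rule ccontr)
  fix v assume v: "v \<in> verts E" and inf: "infinite (out_arcs E v)"
  obtain f :: "nat \<Rightarrow> 'e" where f: "inj f" "range f \<subseteq> out_arcs E v"
    using infinite_countable_subset[OF inf] by blast
  have fa: "f i \<in> arcs E" "tail E (f i) = v" for i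
    using subsetD[OF f(2) rangeI, of i] by auto
  define e where "e i = edge (f i) \<otimes> ghost (f i)" for i
  define y where "y i = (if even i then e i else \<zero>)" for i
  have eL: "e i \<in> carrier L" for i using fa by (simp add: e_def)
  have ge: "ghost (f i) \<otimes> e j = (if i = j then ghost (f i) else \<zero>)" for i j
  proof -
    have "ghost (f i) \<otimes> e j = ghost (f i) \<otimes> edge (f j) \<otimes> ghost (f j)"
      using fa by (simp add: e_def m_assoc)
    also have "\<dots> = (if i = j then ghost (f i) else \<zero>)"
      using fa f(1) by (simp add: ghost_edge inj_eq vert_ghost)
    finally show ?thesis .
  qed
  have ee: "e i \<otimes> e j = (if i = j then e i else \<zero>)" for i j
    using fa ge[of i j] eL by (subst e_def) (simp add: m_assoc, simp add: e_def)
  have "\<forall>i. e i \<in> carrier L \<and> y i \<in> carrier L \<and> e i \<otimes> y i = y i"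
    using eL ee by (simp add: y_def)
  then obtain z where z: "z \<in> carrier L" "\<forall>i. e i \<otimes> z = y i \<otimes> vert v"
    using Q[unfolded orthogonal_solvable_def, rule_format, of e y "vert v"] ee v by blast
  have diag: "ghost (f i) \<otimes> z \<otimes> edge (f i) = (if even i then 1 else 0) \<odot> vert (head E (f i))" for i
  proof -
    have "ghost (f i) \<otimes> z = ghost (f i) \<otimes> e i \<otimes> z" using ge[of i i] by simp
    also have "\<dots> = ghost (f i) \<otimes> (e i \<otimes> z)" using fa eL z by (simp add: m_assoc)
    also have "\<dots> = ghost (f i) \<otimes> y i \<otimes> vert v"
      using z(2) fa eL v by (simp add: y_def m_assoc)
    also have "\<dots> = (if even i then ghost (f i) else \<zero>)"
      using ge[of i i] fa v ghost_vert[of "f i"] by (simp add: y_def)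
    finally show ?thesis using fa by (simp add: ghost_edge)
  qed
  obtain k where k: "finite {g \<in> out_arcs E v. ghost g \<otimes> z \<otimes> edge g \<noteq> k \<odot> vert (head E g)}"
    using almost_constant_diagonal[OF z(1) v] by blast
  have hL: "vert (head E (f i)) \<in> carrier L" "vert (head E (f i)) \<noteq> \<zero>" for i
    using fa vert_nonzero by simp_all
  have bad: False if g: "inj g" and bg: "\<And>i. ghost (f (g i)) \<otimes> z \<otimes> edge (f (g i)) \<noteq> k \<odot> vert (head E (f (g i)))"
    for g :: "nat \<Rightarrow> nat"
  proof -
    have "range (f \<circ> g) \<subseteq> {g \<in> out_arcs E v. ghost g \<otimes> z \<otimes> edge g \<noteq> k \<odot> vert (head E g)}"
      using fa bg by auto
    then have "finite (range (f \<circ> g))" using k by (rule finite_subset)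
    moreover have "inj (f \<circ> g)" using f(1) g by (rule inj_compose)
    ultimately show False using finite_imageD[of "f \<circ> g" UNIV] by simp
  qed
  show False
  proof (cases "k = 0")
    case True
    have "inj (\<lambda>i::nat. 2 * i)" by (simp add: inj_def)
    then show False by (rule bad) (use diag hL True in simp)
  next
    case False
    have "inj (\<lambda>i::nat. 2 * i + 1)" by (simp add: inj_def)
    then show False by (rule bad) (use diag hL False in \<open>simp add: smult_eq_zero_iff eq_commute[of \<zero>]\<close>)
  qed
qed

text \<open>By row-finiteness, infinitely many edges into v have infinitely many sources. The edges
  themselves serve as the elements joining these sources to v.\<close>

lemma column_finite:
  assumes Q: orthogonal_solvable
  shows "column_finite E"
  unfolding column_finite_def
proof (intro ballI, rule ccontr)
  fix v assume v: "v \<in> verts E" and inf: "infinite (in_arcs E v)"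
  have "finite {e \<in> in_arcs E v. tail E e = w}" if "w \<in> tail E ` in_arcs E v" for w
  proof -
    have "w \<in> verts E" using that by auto
    then have "finite (out_arcs E w)" using row_finite[OF Q] by (simp add: row_finite_def)
    then show ?thesis by (rule finite_subset[rotated]) auto
  qed
  then have "infinite (tail E ` in_arcs E v)"
    using pigeonhole_infinite[OF inf] by fastforce
  from infinite_countable_subset[OF this]
  obtain w :: "nat \<Rightarrow> 'v" where w: "inj w" "range w \<subseteq> tail E ` in_arcs E v" by blast
  have "\<exists>e. e \<in> arcs E \<and> head E e = v \<and> w i = tail E e" for i
    using subsetD[OF w(2) rangeI, of i] by auto
  then have "\<forall>i. \<exists>e. e \<in> arcs E \<and> head E e = v \<and> w i = tail E e" ..
  from choice[OF this] obtain g where g: "\<And>i. g i \<in> arcs E" "\<And>i. head E (g i) = v" "\<And>i. w i = tail E (g i)"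
    by blast
  show False
  proof (rule no_infinite_left_vertices[OF Q w(1), of "\<lambda>i. edge (g i)" "vert v"])
    fix i
    show "w i \<in> verts E" "vert (w i) \<otimes> edge (g i) = edge (g i)" using g by (simp_all add: vert_edge)
    have "edge (g i) \<noteq> \<zero>"
    proof
      assume "edge (g i) = \<zero>"
      then have "ghost (g i) \<otimes> edge (g i) = \<zero>" using g(1) by simp
      then show False using ghost_edge[OF g(1) g(1), of i i] vert_nonzero[OF v] g(2)[of i] by simp
    qed
    moreover have "edge (g i) \<otimes> vert v = edge (g i)" using edge_vert[OF g(1), of i] unfolding g(2) .
    ultimately show "edge (g i) \<otimes> vert v \<noteq> \<zero>" by (simp only: not_False_eq_True)
    show "edge (g i) \<in> carrier L" by (rule edge_closed[OF g(1)])
  next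
    show "vert v \<in> carrier L" by (rule vert_closed[OF v])
  qed
qed

text \<open>
  If \<open>c\<close> is a closed path at \<open>v\<close>, then \<open>v - c\<close> is not a right divisor of zero on \<open>v\<close>, but
  has no right inverse: by degrees, the inverse would have to be the infinite sum
  \<open>v + c + c\<^sup>2 + \<dots>\<close>.
\<close>

lemma acyclic:
  assumes Q: corner_solvable
  shows "acyclic_graph E"
  unfolding acyclic_graph_def
proof
  assume "\<exists>p. pre_digraph.cycle E p"
  then obtain p v where p: "G.awalk v p v" "p \<noteq> []" by (auto simp: G.cycle_def)
  define c where "c = path_elem p v"
  \<comment> \<open>The degree of c: multiplication by c shifts homogeneous components by n, and n >
    0 drives both contradictions below.\<close>
  define n where "n = int (length p)"
  have n: "n > 0" using p(2) by (simp add: n_def)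
  note pp = path_elem_props[OF p(1), folded c_def]
  have c: "c \<in> carrier L" and vc: "vert v \<otimes> c = c" and cv: "c \<otimes> vert v = c" using pp by simp_all
  have v: "v \<in> verts E" by (rule walk_end[OF p(1)])
  let ?v = "vert v"
  have vL: "?v \<in> carrier L" using v by simp
  have pr_c_l: "pr d (c \<otimes> x) = c \<otimes> pr (d - n) x" if x: "x \<in> carrier L" for d x
  proof -
    have "pr d (path_elem es w \<otimes> x) = path_elem es w \<otimes> pr (d - int (length es)) x"
      if "G.awalk u es w" for u es w d
      using that
    proof (induction es arbitrary: u d)
      case Nil
      then show ?case using x by (auto simp: pr_vert_l)
    next
      case (Cons e es)
      then have e: "e \<in> arcs E" and w: "G.awalk (head E e) es w" by simp_all
      note P = path_elem_props(1)[OF w]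
      have "pr d (path_elem (e # es) w \<otimes> x) = edge e \<otimes> pr (d - 1) (path_elem es w \<otimes> x)"
        using e P x by (simp add: m_assoc pr_edge_l)
      also have "\<dots> = path_elem (e # es) w \<otimes> pr (d - 1 - int (length es)) x"
        using Cons.IH[OF w, of "d - 1"] e P x by (simp add: m_assoc)
      finally show ?case by (simp add: algebra_simps)
    qed
    from this[OF p(1)] show ?thesis by (simp add: c_def n_def)
  qed
  have pr_c_r: "pr d (x \<otimes> c) = pr (d - n) x \<otimes> c" if x: "x \<in> carrier L" for d x
  proof -
    have "pr d (x \<otimes> path_elem es w) = pr (d - int (length es)) x \<otimes> path_elem es w"
      if "G.awalk u es w" "x \<in> carrier L" for u es w d x
      using that
    proof (induction es arbitrary: u d x)
      case Nil
      then show ?case by (auto simp: pr_vert_r)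
    next
      case (Cons e es)
      then have e: "e \<in> arcs E" and w: "G.awalk (head E e) es w" and x: "x \<in> carrier L" by simp_all
      note P = path_elem_props(1)[OF w]
      have "pr d (x \<otimes> path_elem (e # es) w) = pr d (x \<otimes> edge e \<otimes> path_elem es w)"
        using e P x by (simp add: m_assoc)
      also have "\<dots> = pr (d - int (length es)) (x \<otimes> edge e) \<otimes> path_elem es w"
        using e x by (intro Cons.IH[OF w]) simp
      also have "\<dots> = pr (d - int (length es) - 1) x \<otimes> path_elem (e # es) w"
        using e P x by (simp add: m_assoc pr_edge_r)
      finally show ?case by (simp add: algebra_simps)
    qed
    from this[OF p(1) x] show ?thesis by (simp add: c_def n_def)
  qed
  \<comment> \<open>If each nonzero component in degree at most d forces one n degrees lower, there
    are infinitely many of them.\<close>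
  have descent: "False"
    if x: "x \<in> carrier L" and dn: "pr d x \<noteq> \<zero>"
      and step: "\<And>d'. d' \<le> d \<Longrightarrow> pr d' x \<noteq> \<zero> \<Longrightarrow> pr (d' - n) x \<noteq> \<zero>" for x d
  proof -
    have "pr (d - int k * n) x \<noteq> \<zero>" for k
    proof (induction k)
      case (Suc k)
      have "d - int k * n \<le> d" using n by simp
      from step[OF this Suc] show ?case by (simp add: algebra_simps)
    qed (use dn in simp)
    then have "range (\<lambda>k. d - int k * n) \<subseteq> {d. pr d x \<noteq> \<zero>}" by auto
    then have "finite (range (\<lambda>k. d - int k * n))" using pr_finite[OF x] by (rule finite_subset)
    moreover have "inj (\<lambda>k::nat. d - int k * n)" using n by (simp add: inj_def)
    ultimately show False using finite_imageD[of "\<lambda>k::nat. d - int k * n" UNIV] by simp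
  qed
  define a where "a = ?v \<ominus> c"
  have a: "a \<in> carrier L" using vL c by (simp add: a_def)
  have va: "?v \<otimes> a = a" using vL c v vc by (simp add: a_def r_diff_distr vert_vert)
  have av: "a \<otimes> ?v = a" using vL c v cv by (simp add: a_def l_diff_distr vert_vert)
  have ann: "\<forall>x\<in>carrier L. x \<otimes> a = \<zero> \<longrightarrow> x \<otimes> ?v = \<zero>"
  proof (intro ballI impI)
    fix x assume x: "x \<in> carrier L" "x \<otimes> a = \<zero>"
    define y where "y = x \<otimes> ?v"
    have y: "y \<in> carrier L" using x vL by (simp add: y_def)
    have eq: "x \<otimes> ?v = x \<otimes> c"
      using x vL c unfolding a_def by (simp add: r_diff_distr diff_eq_zero_iff)
    have y_c: "y \<otimes> c = x \<otimes> c" using x(1) vL c vc by (simp add: y_def m_assoc)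
    \<comment> \<open>From y = y c follows pr d y = pr (d - n) y c, so by descent no component of y
      is nonzero.\<close>
    have yc: "y = y \<otimes> c" by (rule trans[OF eq[folded y_def] y_c[symmetric]])
    have "pr d y = \<zero>" for d
    proof (rule ccontr)
      assume nz: "pr d y \<noteq> \<zero>"
      have step: "pr (d' - n) y \<noteq> \<zero>" if nz': "pr d' y \<noteq> \<zero>" for d'
      proof
        assume z: "pr (d' - n) y = \<zero>"
        have "pr d' y = pr (d' - n) y \<otimes> c" by (rule trans[OF arg_cong[OF yc, of "pr d'"] pr_c_r[OF y]])
        also have "\<dots> = \<zero>" unfolding z by (rule l_null[OF c])
        finally show False using nz' by contradiction
      qed
      show False by (rule descent[OF y nz]) (rule step)
    qed
    then show "x \<otimes> ?v = \<zero>" using pr_eq_zero[OF y] by (simp add: y_def)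
  qed
  have vv: "?v \<otimes> ?v = ?v" using v by (simp add: vert_vert)
  have "\<exists>z\<in>carrier L. a \<otimes> z = ?v"
    by (rule Q[unfolded corner_solvable_def, THEN bspec, OF vL, THEN bspec, OF a, THEN mp, OF vv,
      THEN mp, OF va, THEN mp, OF av, THEN mp, OF ann])
  then obtain z where z: "z \<in> carrier L" "a \<otimes> z = ?v" by (rule bexE)
  \<comment> \<open>In terms of y = v z the equation (v - c) z = v reads y = v + c y. By descent y
    has no negative components. So its component of degree 0 is v, and that of degree (k + 1) n is c
    times that of degree k n, which is nonzero because the ghost of p cancels c.\<close>
  define y where "y = ?v \<otimes> z"
  have y: "y \<in> carrier L" using z vL by (simp add: y_def)
  have "?v = ?v \<otimes> z \<ominus> c \<otimes> z" using z vL c by (simp add: a_def l_diff_distr)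
  also have "c \<otimes> z = c \<otimes> y" using z vL c cv by (simp add: y_def m_assoc[symmetric])
  finally have "?v \<oplus> c \<otimes> y = (y \<ominus> c \<otimes> y) \<oplus> c \<otimes> y" by (simp add: y_def)
  also have "\<dots> = y" using y c by (simp add: a_minus_def a_assoc l_neg)
  finally have yeq: "y = ?v \<oplus> c \<otimes> y" ..
  have pr_y: "pr d y = (if d = 0 then ?v else \<zero>) \<oplus> c \<otimes> pr (d - n) y" for d
  proof -
    have "pr d y = pr d (?v \<oplus> c \<otimes> y)" by (rule arg_cong[OF yeq])
    also have "\<dots> = pr d ?v \<oplus> pr d (c \<otimes> y)" by (rule pr_add[OF vL m_closed[OF c y]])
    finally show ?thesis unfolding pr_vert[OF v] pr_c_l[OF y] .
  qed
  have neg: "pr d y = \<zero>" if "d < 0" for d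
  proof (rule ccontr)
    assume nz: "pr d y \<noteq> \<zero>"
    have "pr (d' - n) y \<noteq> \<zero>" if "d' \<le> d" "pr d' y \<noteq> \<zero>" for d'
      using pr_y[of d'] that \<open>d < 0\<close> c y by auto
    then show False using descent[OF y nz] by blast
  qed
  have "pr (int k * n) y \<noteq> \<zero> \<and> ?v \<otimes> pr (int k * n) y = pr (int k * n) y" for k
  proof (induction k)
    case 0
    have "pr 0 y = ?v" using pr_y[of 0] neg[of "- n"] n c vL by simp
    then show ?case using vert_nonzero[OF v] v by (simp add: vert_vert)
  next
    case (Suc k)
    let ?x = "pr (int k * n) y"
    have x: "?x \<in> carrier L" using y by simp
    have "int (Suc k) * n - n = int k * n" "int (Suc k) * n \<noteq> 0" using n by (simp_all add: algebra_simps)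
      (metis add_pos_nonneg less_irrefl mult_nonneg_nonneg of_nat_0_le_iff order_less_imp_le)
    then have eq: "pr (int (Suc k) * n) y = c \<otimes> ?x"
      using pr_y[of "int (Suc k) * n"] c x by simp
    have "c \<otimes> ?x \<noteq> \<zero>"
    proof
      assume "c \<otimes> ?x = \<zero>"
      then have "ghost_elem p v \<otimes> (c \<otimes> ?x) = \<zero>" using pp by simp
      then have "?v \<otimes> ?x = \<zero>" using pp x by (simp add: m_assoc[symmetric])
      then show False using Suc by simp
    qed
    moreover have "?v \<otimes> (c \<otimes> ?x) = c \<otimes> ?x" using c x vL vc by (simp add: m_assoc[symmetric])
    ultimately show ?case unfolding eq ..
  qed
  then have "range (\<lambda>k. int k * n) \<subseteq> {d. pr d y \<noteq> \<zero>}" by auto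
  then have "finite (range (\<lambda>k. int k * n))" using pr_finite[OF y] by (rule finite_subset)
  moreover have "inj (\<lambda>k::nat. int k * n)" using n by (simp add: inj_def)
  ultimately show False using finite_imageD[of "\<lambda>k::nat. int k * n" UNIV] by simp
qed

lemma no_closed_walk: "acyclic_graph E \<Longrightarrow> G.awalk u p u \<Longrightarrow> p = []"
  using G.closed_w_imp_cycle[of p] by (auto simp: acyclic_graph_def G.closed_w_def)

text \<open>Acyclicity makes the vertices w i of the path distinct. The ghosts of its initial pieces
  from w 0 to w i are nonzero and join all w i to w 0.\<close>

lemma no_right_infinite_path:
  assumes Q: orthogonal_solvable and ac: "acyclic_graph E"
  shows "\<not> right_infinite_path E p"
proof
  assume "right_infinite_path E p"
  then have pa: "p i \<in> arcs E" and pn: "head E (p i) = tail E (p (Suc i))" for i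
    by (auto simp: right_infinite_path_def)
  define w where "w i = tail E (p i)" for i
  have walk: "G.awalk (w i) (map p [i..<i + j]) (w (i + j))" for i j
  proof (induction j)
    case 0
    then show ?case using pa[of i] by (simp add: w_def)
  next
    case (Suc j)
    have "G.awalk (w i) (map p [i..<i + j] @ [p (i + j)]) (head E (p (i + j)))"
      by (rule walk_snoc[OF Suc pa]) (simp add: w_def)
    moreover have "map p [i..<i + Suc j] = map p [i..<i + j] @ [p (i + j)]" by simp
    moreover have "w (i + Suc j) = head E (p (i + j))" by (simp add: w_def pn)
    ultimately show ?case by (simp only:)
  qed
  have "i = j" if "w i = w j" "i \<le> j" for i j
    using no_closed_walk[OF ac, of "w i" "map p [i..<j]"] walk[of i "j - i"] that by auto
  then have inj: "inj w" by (intro injI) (metis nat_le_linear)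
  show False
  proof (rule no_infinite_left_vertices[OF Q inj, of "\<lambda>i. ghost_elem (map p [0..<i]) (w i)" "vert (w 0)"])
    fix i
    have "G.awalk (w 0) (map p [0..<i]) (w i)" using walk[of 0 i] by simp
    note P = path_elem_props[OF this]
    show "w i \<in> verts E" using pa[of i] by (simp add: w_def)
    show "ghost_elem (map p [0..<i]) (w i) \<in> carrier L"
      "vert (w i) \<otimes> ghost_elem (map p [0..<i]) (w i) = ghost_elem (map p [0..<i]) (w i)"
      by (rule P)+
    have "ghost_elem (map p [0..<i]) (w i) \<noteq> \<zero>"
      using P(1,7) vert_nonzero[OF \<open>w i \<in> verts E\<close>] by auto
    then show "ghost_elem (map p [0..<i]) (w i) \<otimes> vert (w 0) \<noteq> \<zero>" unfolding P(5) .
  qed (use pa[of 0] in \<open>simp add: w_def\<close>)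
qed

text \<open>Mirror image of the right infinite case: here the finite paths themselves lead from the
  distinct vertices w i to w 0.\<close>

lemma no_left_infinite_path:
  assumes Q: orthogonal_solvable and ac: "acyclic_graph E"
  shows "\<not> left_infinite_path E p"
proof
  assume "left_infinite_path E p"
  then have pa: "p i \<in> arcs E" and pn: "head E (p (Suc i)) = tail E (p i)" for i
    by (auto simp: left_infinite_path_def)
  define w where "w i = tail E (p i)" for i
  have walk: "G.awalk (w (i + j)) (rev (map p [Suc i..<Suc (i + j)])) (w i)" for i j
  proof (induction j)
    case 0
    then show ?case using pa[of i] by (simp add: w_def)
  next
    case (Suc j)
    then show ?case using pa[of "Suc (i + j)"] pn[of "i + j"] by (simp add: w_def)
  qed
  have "i = j" if "w i = w j" "i \<le> j" for i j
  proof -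
    have "i + (j - i) = j" using that(2) by simp
    with walk[of i "j - i"] that(1) have "G.awalk (w j) (rev (map p [Suc i..<Suc j])) (w j)"
      by (simp only:)
    then have "rev (map p [Suc i..<Suc j]) = []" by (rule no_closed_walk[OF ac])
    then show ?thesis using that(2) by (simp del: upt_Suc)
  qed
  then have inj: "inj w" by (intro injI) (metis nat_le_linear)
  \<comment> \<open>The path from w i to w 0 runs through p i, ..., p 1. It omits p 0, which starts
    at w 0.\<close>
  define y where "y i = path_elem (rev (map p [1..<Suc i])) (w 0)" for i
  show False
  proof (rule no_infinite_left_vertices[OF Q inj, of y "vert (w 0)"])
    fix i
    have "G.awalk (w i) (rev (map p [1..<Suc i])) (w 0)" using walk[of 0 i] by (simp del: upt_Suc)
    note P = path_elem_props[OF this, folded y_def]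
    show "w i \<in> verts E" using pa[of i] by (simp add: w_def)
    show "y i \<in> carrier L" "vert (w i) \<otimes> y i = y i" by (rule P)+
    have "w 0 \<in> verts E" using pa[of 0] by (simp add: w_def)
    moreover have "vert (w 0) = \<zero>" if 0: "y i = \<zero>"
      using P(7) unfolding 0 r_null[OF P(2)] by (rule sym)
    ultimately have "y i \<noteq> \<zero>" using vert_nonzero by blast
    then show "y i \<otimes> vert (w 0) \<noteq> \<zero>" unfolding P(4) .
  qed (use pa[of 0] in \<open>simp add: w_def\<close>)
qed

section \<open>From the graph to matrix units\<close>

text \<open>A form of Koenig's lemma: without left infinite paths, passing from a vertex to the
  sources of its incoming edges is well-founded, and a nonempty path to w splits off its last edge,
  for which there are finitely many choices.\<close>

lemma finite_walks_to:
  assumes "column_finite E" and "\<nexists>p. left_infinite_path E p" and "w \<in> verts E"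
  shows "finite {es. \<exists>u. G.awalk u es w}"
proof -
  let ?R = "{(tail E e, head E e) | e. e \<in> arcs E}"
  have "wf ?R"
    unfolding wf_iff_no_infinite_down_chain
  proof
    assume "\<exists>f. \<forall>i. (f (Suc i), f i) \<in> ?R"
    then obtain f where "\<forall>i. (f (Suc i), f i) \<in> ?R" by blast
    then have "\<forall>i. \<exists>e. e \<in> arcs E \<and> f (Suc i) = tail E e \<and> f i = head E e" by blast
    from choice[OF this] obtain p where
      "\<And>i. p i \<in> arcs E \<and> f (Suc i) = tail E (p i) \<and> f i = head E (p i)" by blast
    then have "left_infinite_path E p" unfolding left_infinite_path_def by metis
    then show False using assms(2) by blast
  qed
  then show ?thesis using assms(3)
  proof (induction w rule: wf_induct_rule)
    case (less w)
    let ?W = "\<lambda>w. {es. \<exists>u. G.awalk u es w}"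
    have "?W w \<subseteq> {[]} \<union> (\<Union>e\<in>in_arcs E w. (\<lambda>es. es @ [e]) ` ?W (tail E e))"
    proof
      fix es assume "es \<in> ?W w"
      then obtain u where u: "G.awalk u es w" by blast
      show "es \<in> {[]} \<union> (\<Union>e\<in>in_arcs E w. (\<lambda>es. es @ [e]) ` ?W (tail E e))"
      proof (cases es rule: rev_cases)
        case (snoc es' e)
        have "e \<in> arcs E \<and> head E e = w \<and> G.awalk u es' (tail E e)"
          using u unfolding snoc by (induction es' arbitrary: u) auto
        then have "e \<in> in_arcs E w" and "es' \<in> ?W (tail E e)" by auto
        then show ?thesis unfolding snoc by blast
      qed simp
    qed
    moreover have "finite (?W (tail E e))" if e: "e \<in> in_arcs E w" for e
    proof -
      have "e \<in> arcs E" "head E e = w" using e by simp_all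
      then have "(tail E e, w) \<in> ?R" "tail E e \<in> verts E" by auto
      then show ?thesis by (rule less.IH)
    qed
    then have "finite (\<Union>e\<in>in_arcs E w. (\<lambda>es. es @ [e]) ` ?W (tail E e))"
      using less.prems assms(1) by (intro finite_UN_I finite_imageI) (simp_all add: column_finite_def)
    ultimately show ?case using finite_subset by blast
  qed
qed

text \<open>Indices are the paths ending in a sink, blocks collect the paths with a common sink.
  Absence of left infinite paths makes blocks finite; absence of right infinite paths lets every
  monomial be expanded into monomials that end in sinks.\<close>

theorem graph_imp_block_coordinates:
  assumes rf: "row_finite E" and cf: "column_finite E" and nl: "\<nexists>p. left_infinite_path E p"
    and nr: "\<nexists>p. right_infinite_path E p"
  shows "\<exists>(P :: ('e list \<times> 'v) set) b c. block_coordinates L P (b :: _ \<Rightarrow> 'a) c"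
proof -
  define P where "P = {(es, w). w \<in> verts E \<and> out_arcs E w = {} \<and> (\<exists>u. G.awalk u es w)}"
  \<comment> \<open>The sink is recorded by its vertex element, because block labels must be
    elements of L. Distinct vertices have distinct elements, being orthogonal and nonzero.\<close>
  define b where "b = (\<lambda>p :: 'e list \<times> 'v. vert (snd p))"
  define u where "u p q = monom (fst p) (snd p) (fst q)" for p q :: "'e list \<times> 'v"
  have vinj: "v = w" if "v \<in> verts E" "w \<in> verts E" "vert v = vert w" for v w
    using vert_vert[OF that(1,2)] vert_vert[OF that(1,1)] vert_nonzero[OF that(1)] that(3)
    by (auto split: if_splits)
  have b: "snd p = snd q" if "p \<in> P" "q \<in> P" "b p = b q" for p q
    using that by (auto simp: P_def b_def intro: vinj)
  have PE: "\<exists>u. G.awalk u (fst p) (snd p)" "snd p \<in> verts E" "out_arcs E (snd p) = {}" if "p \<in> P" for p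
    using that by (auto simp: P_def)
  \<comment> \<open>A path that has reached a sink cannot be continued, so neither of two different
    paths to sinks extends the other, and p^* q vanishes unless the paths agree.\<close>
  have gp: "ghost_elem fs w \<otimes> path_elem gs w' = (if fs = gs \<and> w = w' then vert w else \<zero>)"
    if "G.awalk x fs w" "G.awalk x' gs w'" "out_arcs E w = {}" "out_arcs E w' = {}" for fs gs w w' x x'
    using that
  proof (induction fs arbitrary: gs x x')
    case Nil
    then have w: "w \<in> verts E" "w' \<in> verts E" using walk_end by blast+
    show ?case
    proof (cases gs)
      case Nil
      then show ?thesis using w by (simp add: vert_vert)
    next
      case (Cons g gs')
      then have g: "g \<in> arcs E" "G.awalk (head E g) gs' w'" using Nil.prems(2) by simp_all
      then have "tail E g \<noteq> w" using Nil.prems(3) by auto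
      then have "vert w \<otimes> (edge g \<otimes> path_elem gs' w') = \<zero>"
        using w g path_elem_props(1)[OF g(2)] by (simp add: m_assoc[symmetric] vert_edge_if)
      then show ?thesis using Cons by simp
    qed
  next
    case (Cons f fs)
    then have f: "f \<in> arcs E" "G.awalk (head E f) fs w" by simp_all
    have w': "w' \<in> verts E" using Cons.prems(2) by (rule walk_end)
    note F = path_elem_props(2)[OF f(2)]
    show ?case
    proof (cases gs)
      case Nil
      have "tail E f \<noteq> w'" using Cons.prems(4) f(1) by auto
      then show ?thesis using Nil f F w' by (simp add: m_assoc ghost_vert_if)
    next
      case gs: (Cons g gs')
      then have g: "g \<in> arcs E" "G.awalk (head E g) gs' w'" using Cons.prems(2) by simp_all
      note Gp = path_elem_props(1,3)[OF g(2)]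
      have "ghost_elem (f # fs) w \<otimes> path_elem gs w' =
          ghost_elem fs w \<otimes> (ghost f \<otimes> edge g \<otimes> path_elem gs' w')"
        using f g F Gp(1) gs by (simp add: m_assoc)
      also have "\<dots> = (if f = g then ghost_elem fs w \<otimes> path_elem gs' w' else \<zero>)"
        using f g F Gp by (simp add: ghost_edge)
      also have "\<dots> = (if f # fs = gs \<and> w = w' then vert w else \<zero>)"
        using Cons.IH[OF f(2) g(2) Cons.prems(3,4)] gs by auto
      finally show ?thesis .
    qed
  qed
  have "\<exists>c. block_coordinates L P b c"
  proof (rule matrix_units_imp_block_coordinates[of P b u])
    fix p assume p: "p \<in> P"
    have "{q \<in> P. b q = b p} \<subseteq> (\<lambda>es. (es, snd p)) ` {es. \<exists>u. G.awalk u es (snd p)}"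
    proof
      fix q assume "q \<in> {q \<in> P. b q = b p}"
      then have "q \<in> P" "snd q = snd p" using b p by blast+
      then show "q \<in> (\<lambda>es. (es, snd p)) ` {es. \<exists>u. G.awalk u es (snd p)}"
        using PE(1)[OF \<open>q \<in> P\<close>] by (cases q) auto
    qed
    then show "finite {q \<in> P. b q = b p}"
      by (rule finite_subset) (intro finite_imageI finite_walks_to[OF cf nl PE(2)[OF p]])
  next
    fix p q assume pq: "p \<in> P" "q \<in> P" "b p = b q"
    obtain x y where xy: "G.awalk x (fst p) (snd p)" "G.awalk y (fst q) (snd p)"
      using PE(1)[OF pq(1)] PE(1)[OF pq(2)] b[OF pq] by auto
    note X = path_elem_props[OF xy(1)] and Y = path_elem_props[OF xy(2)]
    show uL: "u p q \<in> carrier L" using monom_closed[OF xy] by (simp add: u_def)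
    have v: "vert (snd p) \<in> carrier L" using PE(2)[OF pq(1)] by simp
    have "ghost_elem (fst p) (snd p) \<otimes> u p q \<otimes> path_elem (fst q) (snd p) =
        (ghost_elem (fst p) (snd p) \<otimes> path_elem (fst p) (snd p)) \<otimes>
        (ghost_elem (fst q) (snd p) \<otimes> path_elem (fst q) (snd p))"
      using X(1,2) Y(1,2) by (simp add: u_def monom_def m_assoc)
    also have "\<dots> = vert (snd p)"
      unfolding X(7) Y(7) using PE(2)[OF pq(1)] by (simp add: vert_vert)
    finally show "u p q \<noteq> \<zero>" using vert_nonzero[OF PE(2)[OF pq(1)]] X(2) Y(1) by auto
    fix r s assume rs: "r \<in> P" "s \<in> P" "b r = b s"
    obtain x' y' where xy': "G.awalk x' (fst r) (snd r)" "G.awalk y' (fst s) (snd r)"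
      using PE(1)[OF rs(1)] PE(1)[OF rs(2)] b[OF rs] by auto
    note X' = path_elem_props[OF xy'(1)] and Y' = path_elem_props[OF xy'(2)]
    have "u p q \<otimes> u r s = path_elem (fst p) (snd p) \<otimes>
        ((ghost_elem (fst q) (snd p) \<otimes> path_elem (fst r) (snd r)) \<otimes> ghost_elem (fst s) (snd r))"
      using X(1) Y(2) X'(1) Y'(2) by (simp add: u_def monom_def m_assoc)
    also have "ghost_elem (fst q) (snd p) \<otimes> path_elem (fst r) (snd r) =
        (if q = r then vert (snd p) else \<zero>)"
      using gp[OF xy(2) xy'(1) PE(3)[OF pq(1)] PE(3)[OF rs(1)]] b[OF pq] by (auto simp: prod_eq_iff)
    also have "path_elem (fst p) (snd p) \<otimes> ((if q = r then vert (snd p) else \<zero>) \<otimes>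
        ghost_elem (fst s) (snd r)) = (if q = r then u p s else \<zero>)"
    proof (cases "q = r")
      case True
      then have "snd r = snd p" using b[OF pq] by simp
      then show ?thesis using True Y'(6) by (simp add: u_def monom_def)
    next
      case False
      then show ?thesis using X(1) Y'(2) by simp
    qed
    finally show "u p q \<otimes> u r s = (if q = r then u p s else \<zero>)" .
  next
    fix S assume zero: "\<zero> \<in> S" and uS: "\<And>p q. p \<in> P \<Longrightarrow> q \<in> P \<Longrightarrow> b p = b q \<Longrightarrow> u p q \<in> S"
      and add: "\<And>x y. x \<in> S \<Longrightarrow> y \<in> S \<Longrightarrow> x \<oplus> y \<in> S" and sm: "\<And>k x. x \<in> S \<Longrightarrow> k \<odot> x \<in> S"
    \<comment> \<open>Without right infinite paths, passing from a vertex to the ranges of its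
      outgoing edges is well-founded, so the expansion below terminates.\<close>
    let ?R = "{(head E e, tail E e) | e. e \<in> arcs E}"
    have wf: "wf ?R"
      unfolding wf_iff_no_infinite_down_chain
    proof
      assume "\<exists>f. \<forall>i. (f (Suc i), f i) \<in> ?R"
      then obtain f where "\<forall>i. (f (Suc i), f i) \<in> ?R" by blast
      then have "\<forall>i. \<exists>e. e \<in> arcs E \<and> f (Suc i) = head E e \<and> f i = tail E e" by blast
      from choice[OF this] obtain p where
        "\<And>i. p i \<in> arcs E \<and> f (Suc i) = head E (p i) \<and> f i = tail E (p i)" by blast
      then have "right_infinite_path E p" unfolding right_infinite_path_def by metis
      then show False using nr by blast
    qed
    have sum: "(\<Oplus>i\<in>F. f i) \<in> S" if "finite F" "\<And>i. i \<in> F \<Longrightarrow> f i \<in> S" "\<And>i. i \<in> F \<Longrightarrow> f i \<in> carrier L"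
      for F :: "'e set" and f
      using that by (induction F rule: finite_induct) (auto simp: zero add Pi_def)
    have "\<forall>x es y fs. G.awalk x es v \<longrightarrow> G.awalk y fs v \<longrightarrow> monom es v fs \<in> S" for v
      using wf
    proof (induction v rule: wf_induct_rule)
      case (less v)
      show ?case
      proof (intro allI impI)
        fix x es y fs assume xy: "G.awalk x es v" "G.awalk y fs v"
        have v: "v \<in> verts E" using xy(1) by (rule walk_end)
        show "monom es v fs \<in> S"
        proof (cases "out_arcs E v = {}")
          case True
          then have "(es, v) \<in> P" "(fs, v) \<in> P" using xy v by (auto simp: P_def)
          from uS[OF this] show ?thesis by (simp add: u_def b_def)
        next
          case False
          have fin: "finite (out_arcs E v)" using rf v by (simp add: row_finite_def)
          then have reg: "regular_vertex E v" using False v by (simp add: regular_vertex_def)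
          have arc: "e \<in> arcs E" "tail E e = v" if "e \<in> out_arcs E v" for e using that by simp_all
          note X = path_elem_props[OF xy(1)] and Y = path_elem_props[OF xy(2)]
          have cl: "(\<lambda>e. edge e \<otimes> ghost e) \<in> out_arcs E v \<rightarrow> carrier L" using arc by auto
          have walks: "G.awalk x (es @ [e]) (head E e)" "G.awalk y (fs @ [e]) (head E e)"
            if "e \<in> out_arcs E v" for e
            using walk_snoc[OF xy(1) arc[OF that]] walk_snoc[OF xy(2) arc[OF that]] .
          have m: "path_elem es v \<otimes> (edge e \<otimes> ghost e) \<otimes> ghost_elem fs v = monom (es @ [e]) (head E e) (fs @ [e])"
            if e: "e \<in> out_arcs E v" for e
            using path_elem_snoc[of x es e] ghost_elem_snoc[of y fs e] arc[OF e] xy X(1) Y(2)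
            by (simp add: monom_def m_assoc)
          \<comment> \<open>Inserting v as the sum of the e e^* turns p q^* into the sum of the
            monomials (p e) (q e)^* , whose ends lie one step further.\<close>
          have "monom es v fs = path_elem es v \<otimes> vert v \<otimes> ghost_elem fs v"
            unfolding X(4) by (simp add: monom_def)
          also have "\<dots> = path_elem es v \<otimes> (\<Oplus>e\<in>out_arcs E v. edge e \<otimes> ghost e) \<otimes> ghost_elem fs v"
            using vert_regular[OF reg] by simp
          also have "\<dots> = (\<Oplus>e\<in>out_arcs E v. path_elem es v \<otimes> (edge e \<otimes> ghost e)) \<otimes> ghost_elem fs v"
            using finsum_r_distr[OF fin cl X(1)] by simp
          also have "\<dots> = (\<Oplus>e\<in>out_arcs E v. path_elem es v \<otimes> (edge e \<otimes> ghost e) \<otimes> ghost_elem fs v)"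
            using arc X(1) by (intro finsum_l_distr[OF fin _ Y(2)]) auto
          also have "\<dots> \<in> S"
          proof (rule sum[OF fin])
            fix e assume e: "e \<in> out_arcs E v"
            have "(head E e, v) \<in> ?R" using arc[OF e] by blast
            from less[OF this] walks[OF e] have "monom (es @ [e]) (head E e) (fs @ [e]) \<in> S" by blast
            then show "path_elem es v \<otimes> (edge e \<otimes> ghost e) \<otimes> ghost_elem fs v \<in> S"
              unfolding m[OF e] .
            show "path_elem es v \<otimes> (edge e \<otimes> ghost e) \<otimes> ghost_elem fs v \<in> carrier L"
              using arc[OF e] X(1) Y(2) by simp
          qed
          finally show ?thesis .
        qed
      qed
    qed
    then show "carrier L \<subseteq> S" by (intro spanned_by_monoms zero add sm) blast+
  qed
  then show ?thesis by blast
qed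

end

section \<open>The Leavitt path algebra as a Leavitt family\<close>

lemma poly_mapping_decompose:
  "p = (\<Sum>w\<in>Poly_Mapping.keys p. Poly_Mapping.single w (Poly_Mapping.lookup p w))"
  by (rule poly_mapping_eqI) (simp add: lookup_sum lookup_single when_def in_keys_iff)

lemma poly_mapping_add_induct [case_names single add]:
  assumes single: "\<And>w k. P (Poly_Mapping.single w k)" and add: "\<And>p q. P p \<Longrightarrow> P q \<Longrightarrow> P (p + q)"
  shows "P (p :: 'w \<Rightarrow>\<^sub>0 'k::comm_monoid_add)"
proof -
  have "P (\<Sum>w\<in>A. Poly_Mapping.single w (f w))" if "finite A" for A and f :: "'w \<Rightarrow> 'k"
    using that
  proof (induction A rule: finite_induct)
    case empty
    show ?case using single[of undefined 0] by simp
  next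
    case (insert w A)
    then show ?case by (simp add: add single)
  qed
  from this[of "Poly_Mapping.keys p" "Poly_Mapping.lookup p"] show ?thesis
    using poly_mapping_decompose[of p] by simp
qed

locale lpa_presentation = wf_digraph E for E :: "('v, 'e) pre_digraph" +
  fixes K :: "'k::field itself"
begin

section \<open>The free algebra, the ideal of relations and the quotient\<close>

definition F :: "('v, 'e, 'k) lpa_free ring" where
  "F = free_algebra TYPE('k) (lpa_gens E)"

definition I :: "('v, 'e, 'k) lpa_free set" where
  "I = lpa_ideal E"

definition L :: "('k, ('v, 'e, 'k) lpa_free set) module" where
  "L = leavitt_path_algebra TYPE('k) E"

lemma F_simps [simp]:
  "monoid.mult F = (*)" "one F = 1" "zero F = 0" "add F = (+)"
  by (simp_all add: F_def free_algebra_def)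

lemma carrier_F: "p \<in> carrier F \<longleftrightarrow> (\<forall>w\<in>Poly_Mapping.keys p. set (letters w) \<subseteq> lpa_gens E)"
  by (simp add: F_def free_algebra_def)

lemma letters_simps [simp]: "letters 0 = []" "letters (v + w) = letters v @ letters w"
  by (simp_all add: zero_free_word_def plus_free_word_def)

lemma F_add: "p \<in> carrier F \<Longrightarrow> q \<in> carrier F \<Longrightarrow> p + q \<in> carrier F"
  using keys_add[of p q] by (auto simp: carrier_F)

lemma F_minus: "p \<in> carrier F \<Longrightarrow> - p \<in> carrier F"
  by (simp add: carrier_F)

lemma F_diff: "p \<in> carrier F \<Longrightarrow> q \<in> carrier F \<Longrightarrow> p - q \<in> carrier F"
  using F_add[of p "- q"] F_minus by simp

lemma F_mult: "p \<in> carrier F \<Longrightarrow> q \<in> carrier F \<Longrightarrow> p * q \<in> carrier F"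
  using keys_mult[of p q] by (fastforce simp: carrier_F)

lemma F_single: "set (letters w) \<subseteq> lpa_gens E \<Longrightarrow> Poly_Mapping.single w k \<in> carrier F"
  by (simp add: carrier_F)

lemma F_gen: "g \<in> lpa_gens E \<Longrightarrow> gen g \<in> carrier F"
  by (simp add: gen_def F_single)

lemma F_sum: "(\<And>i. i \<in> A \<Longrightarrow> f i \<in> carrier F) \<Longrightarrow> (\<Sum>i\<in>A. f i) \<in> carrier F"
  by (induction A rule: infinite_finite_induct) (auto simp: F_add, auto simp: carrier_F)

lemma zero_F: "0 \<in> carrier F" and one_F: "1 \<in> carrier F"
  by (simp_all add: carrier_F)

lemma ring_F: "ring F"
proof (rule ringI)
  show "abelian_group F"
  proof (rule abelian_groupI)
    fix p assume "p \<in> carrier F"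
    then show "\<exists>q\<in>carrier F. q \<oplus>\<^bsub>F\<^esub> p = \<zero>\<^bsub>F\<^esub>"
      by (intro bexI[of _ "- p"]) (simp_all add: F_minus)
  qed (simp_all add: F_add zero_F add.assoc add.commute)
  show "monoid F" by (rule monoidI) (simp_all add: F_mult one_F mult.assoc)
qed (simp_all add: distrib_left distrib_right)

lemma gens [simp]:
  "v \<in> verts E \<Longrightarrow> Vert v \<in> lpa_gens E" "e \<in> arcs E \<Longrightarrow> Edge e \<in> lpa_gens E"
  "e \<in> arcs E \<Longrightarrow> Ghost e \<in> lpa_gens E"
  by (auto simp: lpa_gens_def)

lemma relations_subset: "lpa_relations E \<subseteq> carrier F"
proof
  fix r :: "('v, 'e, 'k) lpa_free" assume "r \<in> lpa_relations E"
  then show "r \<in> carrier F"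
    by cases (auto simp: regular_vertex_def intro!: F_diff F_mult F_gen F_sum)
qed

lemma ideal_I: "ideal I F"
  unfolding I_def lpa_ideal_def F_def[symmetric]
  by (rule ring.genideal_ideal[OF ring_F relations_subset])

lemma relation_in_I: "r \<in> lpa_relations E \<Longrightarrow> r \<in> I"
  using ring.genideal_self[OF ring_F relations_subset]
  unfolding I_def lpa_ideal_def F_def[symmetric] by blast

lemma I_minimal: "ideal J F \<Longrightarrow> lpa_relations E \<subseteq> J \<Longrightarrow> I \<subseteq> J"
  unfolding I_def lpa_ideal_def F_def[symmetric] by (rule ring.genideal_minimal[OF ring_F])

text \<open>Polynomials are finite sums of scalar multiples of words, so absorption may be tested on
  these. Negatives come from the empty word with coefficient -1.\<close>

lemma word_idealI:
  assumes J: "J \<subseteq> carrier F" "0 \<in> J" "\<And>x y. x \<in> J \<Longrightarrow> y \<in> J \<Longrightarrow> x + y \<in> J"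
    and l: "\<And>w k x. set (letters w) \<subseteq> lpa_gens E \<Longrightarrow> x \<in> J \<Longrightarrow> Poly_Mapping.single w k * x \<in> J"
    and r: "\<And>w k x. set (letters w) \<subseteq> lpa_gens E \<Longrightarrow> x \<in> J \<Longrightarrow> x * Poly_Mapping.single w k \<in> J"
  shows "ideal J F"
proof (rule idealI[OF ring_F])
  interpret ring F by (rule ring_F)
  have sum: "(\<Sum>i\<in>A. f i) \<in> J" if "\<And>i. i \<in> A \<Longrightarrow> f i \<in> J" for A :: "('v, 'e) lpa_gen free_word set" and f
    using that by (induction A rule: infinite_finite_induct) (simp_all add: J(2,3))
  have minus: "- x \<in> J" if "x \<in> J" for x
  proof -
    have "Poly_Mapping.single 0 (- 1) * x = - x" by (simp add: single_uminus)
    then show ?thesis using l[of 0 x "- 1"] that by simp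
  qed
  have "inv\<^bsub>add_monoid F\<^esub> x = - x" if "x \<in> J" for x
    using minus_equality[of "- x" x] that J(1) F_minus by (auto simp: a_inv_def)
  then show "subgroup J (add_monoid F)"
    unfolding subgroup_def using J minus by simp
  fix x a assume x: "x \<in> J" and a: "a \<in> carrier F"
  have w: "set (letters w) \<subseteq> lpa_gens E" if "w \<in> Poly_Mapping.keys a" for w
    using that a by (simp add: carrier_F)
  have "a * x = (\<Sum>w\<in>Poly_Mapping.keys a. Poly_Mapping.single w (Poly_Mapping.lookup a w) * x)"
    by (subst poly_mapping_decompose[of a]) (rule sum_distrib_right)
  then show "a \<otimes>\<^bsub>F\<^esub> x \<in> J" using sum[OF l[OF w x]] by simp
  have "x * a = (\<Sum>w\<in>Poly_Mapping.keys a. x * Poly_Mapping.single w (Poly_Mapping.lookup a w))"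
    by (subst poly_mapping_decompose[of a]) (rule sum_distrib_left)
  then show "x \<otimes>\<^bsub>F\<^esub> a \<in> J" using sum[OF r[OF w x]] by simp
qed

definition cl :: "('v, 'e, 'k) lpa_free \<Rightarrow> ('v, 'e, 'k) lpa_free set" where
  "cl p = I +>\<^bsub>F\<^esub> p"

text \<open>The augmentation ideal, that is, the free algebra without unit; its classes make up
  L.\<close>

definition aug :: "('v, 'e, 'k) lpa_free set" where
  "aug = {p \<in> carrier F. Poly_Mapping.lookup p 0 = 0}"

lemma augD: "p \<in> aug \<Longrightarrow> p \<in> carrier F"
  by (simp add: aug_def)

lemma zero_free_word_iff: "(v + w :: 'g free_word) = 0 \<longleftrightarrow> v = 0 \<and> w = 0"
  by (cases v; cases w) (auto simp: zero_free_word_def plus_free_word_def)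

lemma aug_mult:
  assumes "p \<in> aug \<or> q \<in> aug" "p \<in> carrier F" "q \<in> carrier F"
  shows "p * q \<in> aug"
proof -
  have "0 \<notin> Poly_Mapping.keys (p * q)"
  proof
    assume "0 \<in> Poly_Mapping.keys (p * q)"
    then have "0 \<in> {v + w | v w. v \<in> Poly_Mapping.keys p \<and> w \<in> Poly_Mapping.keys q}"
      using keys_mult by (rule rev_subsetD)
    then obtain v w where vw: "0 = v + w" "v \<in> Poly_Mapping.keys p" "w \<in> Poly_Mapping.keys q"
      by blast
    from vw(1) have "v = 0 \<and> w = 0" by (rule zero_free_word_iff[THEN iffD1, OF sym])
    then show False using vw(2,3) assms(1) by (auto simp: aug_def in_keys_iff)
  qed
  then show ?thesis using F_mult assms by (simp add: aug_def in_keys_iff)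
qed

lemma aug_add: "p \<in> aug \<Longrightarrow> q \<in> aug \<Longrightarrow> p + q \<in> aug"
  by (simp add: aug_def F_add lookup_add)

lemma aug_minus: "p \<in> aug \<Longrightarrow> - p \<in> aug"
  by (simp add: aug_def F_minus)

lemma aug_zero: "0 \<in> aug"
  by (simp add: aug_def zero_F)

lemma aug_gen: "g \<in> lpa_gens E \<Longrightarrow> gen g \<in> aug"
  by (simp add: aug_def F_gen) (simp add: gen_def lookup_single when_def zero_free_word_def)

lemma const_F: "const k \<in> carrier F"
  by (simp add: const_def F_single)

lemma cl_eq_iff:
  assumes "p \<in> carrier F" "q \<in> carrier F"
  shows "cl p = cl q \<longleftrightarrow> p - q \<in> I"
proof -
  interpret ring F by (rule ring_F)
  have "\<ominus>\<^bsub>F\<^esub> q = - q" using minus_equality[of "- q" q] assms F_minus by simp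
  then have "p \<ominus>\<^bsub>F\<^esub> q = p - q" by (simp add: a_minus_def)
  then show ?thesis using quotient_eq_iff_same_a_r_cos[OF ideal_I assms] by (simp add: cl_def)
qed

lemma L_simps:
  "carrier L = cl ` aug" "zero L = cl 0"
  "p \<in> carrier F \<Longrightarrow> q \<in> carrier F \<Longrightarrow> cl p \<oplus>\<^bsub>L\<^esub> cl q = cl (p + q)"
  "p \<in> carrier F \<Longrightarrow> q \<in> carrier F \<Longrightarrow> cl p \<otimes>\<^bsub>L\<^esub> cl q = cl (p * q)"
  "p \<in> carrier F \<Longrightarrow> k \<odot>\<^bsub>L\<^esub> cl p = cl (const k * p)"
proof -
  interpret ideal I F by (rule ideal_I)
  show "carrier L = cl ` aug"
    by (simp add: L_def leavitt_path_algebra_def Let_def cl_def aug_def F_def I_def)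
  have "I +>\<^bsub>F\<^esub> 0 = I" using a_rcos_zero[OF ideal_axioms, of 0] Icarr additive_subgroup.zero_closed
    additive_subgroup_axioms by (metis F_simps(3))
  then show "zero L = cl 0"
    by (simp add: L_def leavitt_path_algebra_def Let_def cl_def F_def[symmetric] I_def[symmetric] FactRing_def)
  show "cl p \<oplus>\<^bsub>L\<^esub> cl q = cl (p + q)" if "p \<in> carrier F" "q \<in> carrier F" for p q
    using a_rcos_sum[OF that]
    by (simp add: L_def leavitt_path_algebra_def Let_def cl_def F_def[symmetric] I_def[symmetric] FactRing_def)
  show m: "cl p \<otimes>\<^bsub>L\<^esub> cl q = cl (p * q)" if "p \<in> carrier F" "q \<in> carrier F" for p q
    using rcoset_mult_add[OF that]
    by (simp add: L_def leavitt_path_algebra_def Let_def cl_def F_def[symmetric] I_def[symmetric] FactRing_def)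
  show "k \<odot>\<^bsub>L\<^esub> cl p = cl (const k * p)" if "p \<in> carrier F" for p
    using rcoset_mult_add[OF const_F that, of k]
    by (simp add: L_def leavitt_path_algebra_def Let_def cl_def F_def[symmetric] I_def[symmetric] FactRing_def)
qed

lemma carrier_LE:
  assumes "x \<in> carrier L"
  obtains p where "p \<in> aug" "p \<in> carrier F" "x = cl p"
  using assms augD by (auto simp: L_simps(1))

lemma clL: "p \<in> aug \<Longrightarrow> cl p \<in> carrier L"
  by (simp add: L_simps(1))

lemma const_commute: "p * const k = const k * (p :: ('v, 'e, 'k) lpa_free)"
proof (induction p rule: poly_mapping_add_induct)
  case (single w l)
  then show ?case by (simp add: const_def mult_single mult.commute)
qed (simp add: distrib_left distrib_right)

lemma const_simps:
  "const (k + l) = const k + (const l :: ('v, 'e, 'k) lpa_free)"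
  "const (k * l) = const k * (const l :: ('v, 'e, 'k) lpa_free)" "const 1 = (1 :: ('v, 'e, 'k) lpa_free)"
  by (simp_all add: const_def single_add mult_single)

lemma nonunital_algebra_L: "nonunital_algebra L"
proof -
  have "abelian_group L"
  proof (rule abelian_groupI)
    fix x assume "x \<in> carrier L"
    then obtain p where p: "p \<in> aug" "p \<in> carrier F" "x = cl p" by (rule carrier_LE)
    show "\<exists>y\<in>carrier L. y \<oplus>\<^bsub>L\<^esub> x = \<zero>\<^bsub>L\<^esub>"
      using p by (intro bexI[of _ "cl (- p)"]) (simp_all add: L_simps(2,3) F_minus clL aug_minus)
    show "\<zero>\<^bsub>L\<^esub> \<oplus>\<^bsub>L\<^esub> x = x" using p by (simp add: L_simps(2,3) zero_F)
    fix y assume "y \<in> carrier L"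
    then obtain q where q: "q \<in> aug" "q \<in> carrier F" "y = cl q" by (rule carrier_LE)
    show "x \<oplus>\<^bsub>L\<^esub> y \<in> carrier L" "x \<oplus>\<^bsub>L\<^esub> y = y \<oplus>\<^bsub>L\<^esub> x"
      using p q by (simp_all add: L_simps(3) clL aug_add add.commute)
    fix z assume "z \<in> carrier L"
    then obtain r where r: "r \<in> aug" "r \<in> carrier F" "z = cl r" by (rule carrier_LE)
    show "x \<oplus>\<^bsub>L\<^esub> y \<oplus>\<^bsub>L\<^esub> z = x \<oplus>\<^bsub>L\<^esub> (y \<oplus>\<^bsub>L\<^esub> z)"
      using p q r by (simp add: L_simps(3) F_add add.assoc)
  qed (simp add: L_simps(2) clL aug_zero)
  then interpret abelian_group L .
  show ?thesis
  proof unfold_locales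
    fix x assume "x \<in> carrier L"
    then obtain p where p: "p \<in> aug" "p \<in> carrier F" "x = cl p" by (rule carrier_LE)
    note S = L_simps(3-5) F_mult F_add const_F const_simps distrib_left distrib_right mult.assoc
    show "k \<odot>\<^bsub>L\<^esub> x \<in> carrier L" for k using p by (simp add: S clL aug_mult)
    show "(k + l) \<odot>\<^bsub>L\<^esub> x = k \<odot>\<^bsub>L\<^esub> x \<oplus>\<^bsub>L\<^esub> l \<odot>\<^bsub>L\<^esub> x" for k l using p by (simp add: S)
    show "(k * l) \<odot>\<^bsub>L\<^esub> x = k \<odot>\<^bsub>L\<^esub> (l \<odot>\<^bsub>L\<^esub> x)" for k l using p by (simp add: S)
    show "1 \<odot>\<^bsub>L\<^esub> x = x" using p by (simp add: S)
    fix y assume "y \<in> carrier L"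
    then obtain q where q: "q \<in> aug" "q \<in> carrier F" "y = cl q" by (rule carrier_LE)
    show "x \<otimes>\<^bsub>L\<^esub> y \<in> carrier L" using p q by (simp add: S clL aug_mult)
    show "k \<odot>\<^bsub>L\<^esub> (x \<oplus>\<^bsub>L\<^esub> y) = k \<odot>\<^bsub>L\<^esub> x \<oplus>\<^bsub>L\<^esub> k \<odot>\<^bsub>L\<^esub> y" for k using p q by (simp add: S)
    show "(k \<odot>\<^bsub>L\<^esub> x) \<otimes>\<^bsub>L\<^esub> y = k \<odot>\<^bsub>L\<^esub> (x \<otimes>\<^bsub>L\<^esub> y)" for k using p q by (simp add: S)
    have "p * (const k * q) = const k * (p * q)" for k
      using const_commute[of p k] by (metis mult.assoc)
    then show "x \<otimes>\<^bsub>L\<^esub> (k \<odot>\<^bsub>L\<^esub> y) = k \<odot>\<^bsub>L\<^esub> (x \<otimes>\<^bsub>L\<^esub> y)" for k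
      using p q by (simp add: L_simps(4,5) F_mult const_F)
    fix z assume "z \<in> carrier L"
    then obtain r where r: "r \<in> aug" "r \<in> carrier F" "z = cl r" by (rule carrier_LE)
    show "x \<otimes>\<^bsub>L\<^esub> y \<otimes>\<^bsub>L\<^esub> z = x \<otimes>\<^bsub>L\<^esub> (y \<otimes>\<^bsub>L\<^esub> z)"
      "(x \<oplus>\<^bsub>L\<^esub> y) \<otimes>\<^bsub>L\<^esub> z = x \<otimes>\<^bsub>L\<^esub> z \<oplus>\<^bsub>L\<^esub> y \<otimes>\<^bsub>L\<^esub> z"
      "z \<otimes>\<^bsub>L\<^esub> (x \<oplus>\<^bsub>L\<^esub> y) = z \<otimes>\<^bsub>L\<^esub> x \<oplus>\<^bsub>L\<^esub> z \<otimes>\<^bsub>L\<^esub> y"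
      using p q r by (simp_all add: S)
  qed
qed

section \<open>The grading of the free algebra and of the quotient\<close>

definition deg :: "('v, 'e) lpa_gen free_word \<Rightarrow> int" where
  "deg w = sum_list (map (\<lambda>g. case g of Vert _ \<Rightarrow> 0 | Edge _ \<Rightarrow> 1 | Ghost _ \<Rightarrow> - 1) (letters w))"

definition hom_part :: "int \<Rightarrow> ('v, 'e, 'k) lpa_free \<Rightarrow> ('v, 'e, 'k) lpa_free" where
  "hom_part d p = (\<Sum>w\<in>{w\<in>Poly_Mapping.keys p. deg w = d}. Poly_Mapping.single w (Poly_Mapping.lookup p w))"

lemma deg_simps [simp]: "deg (v + w) = deg v + deg w" "deg 0 = 0"
  by (simp_all add: deg_def)

lemma lookup_hom_part:
  "Poly_Mapping.lookup (hom_part d p) w = (if deg w = d then Poly_Mapping.lookup p w else 0)"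
  by (auto simp: hom_part_def lookup_sum lookup_single when_def in_keys_iff)

lemma hom_part_add: "hom_part d (p + q) = hom_part d p + hom_part d q"
  by (rule poly_mapping_eqI) (simp add: lookup_hom_part lookup_add)

lemma hom_part_diff: "hom_part d (p - q) = hom_part d p - hom_part d q"
  by (rule poly_mapping_eqI) (simp add: lookup_hom_part lookup_minus)

lemma hom_part_zero [simp]: "hom_part d 0 = 0"
  by (rule poly_mapping_eqI) (simp add: lookup_hom_part)

lemma hom_part_sum: "hom_part d (\<Sum>i\<in>A. f i) = (\<Sum>i\<in>A. hom_part d (f i))"
  by (induction A rule: infinite_finite_induct) (simp_all add: hom_part_add)

lemma hom_part_single:
  "hom_part d (Poly_Mapping.single w k) = (if deg w = d then Poly_Mapping.single w k else 0)"
  by (rule poly_mapping_eqI) (auto simp: lookup_hom_part lookup_single when_def)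

lemma hom_part_single_mult:
  "hom_part d (Poly_Mapping.single w k * p) = Poly_Mapping.single w k * hom_part (d - deg w) p"
proof (induction p rule: poly_mapping_add_induct)
  case (single v l)
  then show ?case by (auto simp: mult_single hom_part_single)
qed (simp add: distrib_left hom_part_add)

lemma hom_part_mult_single:
  "hom_part d (p * Poly_Mapping.single w k) = hom_part (d - deg w) p * Poly_Mapping.single w k"
proof (induction p rule: poly_mapping_add_induct)
  case (single v l)
  then show ?case by (auto simp: mult_single hom_part_single)
qed (simp add: distrib_right hom_part_add)

lemma hom_part_F: "p \<in> carrier F \<Longrightarrow> hom_part d p \<in> carrier F"
  by (auto simp: carrier_F in_keys_iff lookup_hom_part split: if_splits)

lemma hom_part_aug: "p \<in> aug \<Longrightarrow> hom_part d p \<in> aug"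
  by (simp add: aug_def hom_part_F lookup_hom_part)

lemma I_add: "p \<in> I \<Longrightarrow> q \<in> I \<Longrightarrow> p + q \<in> I" and I_zero: "0 \<in> I"
  and I_mult_l: "p \<in> I \<Longrightarrow> q \<in> carrier F \<Longrightarrow> q * p \<in> I"
  and I_mult_r: "p \<in> I \<Longrightarrow> q \<in> carrier F \<Longrightarrow> p * q \<in> I" and I_F: "p \<in> I \<Longrightarrow> p \<in> carrier F"
proof -
  interpret ideal I F by (rule ideal_I)
  show "p \<in> I \<Longrightarrow> q \<in> I \<Longrightarrow> p + q \<in> I" using additive_subgroup.a_closed[OF additive_subgroup_axioms, of p q] by simp
  show "0 \<in> I" using additive_subgroup.zero_closed[OF additive_subgroup_axioms] by simp
  show "p \<in> I \<Longrightarrow> q \<in> carrier F \<Longrightarrow> q * p \<in> I" using I_l_closed[of p q] by simp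
  show "p \<in> I \<Longrightarrow> q \<in> carrier F \<Longrightarrow> p * q \<in> I" using I_r_closed[of p q] by simp
  show "p \<in> I \<Longrightarrow> p \<in> carrier F" by (rule Icarr)
qed

lemma gen_mult_gen: "gen g * gen h = Poly_Mapping.single (Word [g, h]) 1"
  by (simp add: gen_def mult_single plus_free_word_def)

lemma hom_part_gen: "hom_part d (gen g) = (if d = deg (Word [g]) then gen g else 0)"
  by (simp add: gen_def hom_part_single)

lemma hom_part_gen2: "hom_part d (gen g * gen h) = (if d = deg (Word [g, h]) then gen g * gen h else 0)"
  by (simp add: gen_mult_gen hom_part_single)

text \<open>An ideal generated by homogeneous elements is graded: the polynomials with all
  components in I form an ideal that contains the relations.\<close>

lemma hom_part_I:
  assumes "p \<in> I"
  shows "hom_part d p \<in> I"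
proof -
  let ?J = "{p \<in> carrier F. \<forall>d. hom_part d p \<in> I}"
  have "ideal ?J F"
    by (rule word_idealI) (auto simp: hom_part_single_mult hom_part_mult_single hom_part_add F_add
      F_mult F_single I_add I_zero I_mult_l I_mult_r zero_F)
  moreover have "lpa_relations E \<subseteq> ?J"
  proof
    fix r :: "('v, 'e, 'k) lpa_free" assume r: "r \<in> lpa_relations E"
    have "\<exists>n. \<forall>d. hom_part d r = (if d = n then r else 0)"
      using r
    proof cases
      case (idem v)
      then show ?thesis
        by (intro exI[of _ "0"]) (simp add: hom_part_diff hom_part_sum hom_part_gen hom_part_gen2 deg_def)
    next
      case (orth v w)
      then show ?thesis
        by (intro exI[of _ "0"]) (simp add: hom_part_diff hom_part_sum hom_part_gen hom_part_gen2 deg_def)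
    next
      case (source_edge e)
      then show ?thesis
        by (intro exI[of _ "1"]) (simp add: hom_part_diff hom_part_sum hom_part_gen hom_part_gen2 deg_def)
    next
      case (edge_range e)
      then show ?thesis
        by (intro exI[of _ "1"]) (simp add: hom_part_diff hom_part_sum hom_part_gen hom_part_gen2 deg_def)
    next
      case (range_ghost e)
      then show ?thesis
        by (intro exI[of _ "- 1"]) (simp add: hom_part_diff hom_part_sum hom_part_gen hom_part_gen2 deg_def)
    next
      case (ghost_source e)
      then show ?thesis
        by (intro exI[of _ "- 1"]) (simp add: hom_part_diff hom_part_sum hom_part_gen hom_part_gen2 deg_def)
    next
      case (ghost_edge e)
      then show ?thesis
        by (intro exI[of _ "0"]) (simp add: hom_part_diff hom_part_sum hom_part_gen hom_part_gen2 deg_def)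
    next
      case (ghost_edge_orth e f)
      then show ?thesis
        by (intro exI[of _ "0"]) (simp add: hom_part_diff hom_part_sum hom_part_gen hom_part_gen2 deg_def)
    next
      case (regular v)
      then show ?thesis
        by (intro exI[of _ "0"]) (simp add: hom_part_diff hom_part_sum hom_part_gen hom_part_gen2 deg_def)
    qed
    then show "r \<in> ?J" using relation_in_I[OF r] relations_subset r I_zero by auto
  qed
  ultimately have "I \<subseteq> ?J" by (rule I_minimal)
  then show ?thesis using assms by blast
qed

text \<open>Works with a chosen representative; \<open>hom_part_I\<close> makes the result
  independent of the choice.\<close>

definition hom_proj :: "int \<Rightarrow> ('v, 'e, 'k) lpa_free set \<Rightarrow> ('v, 'e, 'k) lpa_free set" where
  "hom_proj d x = cl (hom_part d (SOME p. p \<in> aug \<and> x = cl p))"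

lemma hom_proj_cl:
  assumes "p \<in> aug"
  shows "hom_proj d (cl p) = cl (hom_part d p)"
proof -
  define q where "q = (SOME q. q \<in> aug \<and> cl p = cl q)"
  have "q \<in> aug \<and> cl p = cl q" unfolding q_def by (rule someI[of _ p]) (use assms in simp)
  then have q: "q \<in> carrier F" "cl p = cl q" using augD by auto
  have p: "p \<in> carrier F" using assms by (rule augD)
  have "hom_part d (p - q) \<in> I" using cl_eq_iff[OF p q(1)] q(2) by (intro hom_part_I) simp
  then have "cl (hom_part d p) = cl (hom_part d q)"
    by (simp add: cl_eq_iff hom_part_F p q(1) hom_part_diff)
  then show ?thesis by (simp add: hom_proj_def q_def)
qed

text \<open>
  Vertices are nonzero because they act nontrivially on functions on the set of pairs of a vertex
  and an element of an infinite set \<open>U\<close> with at least as many elements as there are edges: for every vertex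
  \<open>v\<close> that emits edges there is a bijection from \<open>out_arcs E v \<times> U\<close> to \<open>U\<close>.
\<close>

lemma exists_branching:
  "\<exists>\<psi> :: 'e \<Rightarrow> 'e + nat \<Rightarrow> 'e + nat. \<forall>v. out_arcs E v \<noteq> {} \<longrightarrow>
    bij_betw (\<lambda>(y, e). \<psi> e y) (UNIV \<times> out_arcs E v) UNIV"
proof -
  have "\<exists>\<beta>. out_arcs E v \<noteq> {} \<longrightarrow> bij_betw \<beta> ((UNIV :: ('e + nat) set) \<times> out_arcs E v) (UNIV :: ('e + nat) set)" for v
  proof (cases "out_arcs E v = {}")
    case False
    have inf: "infinite (UNIV :: ('e + nat) set)" by simp
    have "inj_on Inl (out_arcs E v)" by simp
    then have le: "(card_of (out_arcs E v), card_of (UNIV :: ('e + nat) set)) \<in> ordLeq"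
      using card_of_ordLeq[of "out_arcs E v" "UNIV :: ('e + nat) set"] by blast
    from card_of_Times_infinite[OF inf False le]
    show ?thesis using card_of_ordIso by blast
  qed simp
  then have "\<forall>v. \<exists>\<beta>. out_arcs E v \<noteq> {} \<longrightarrow>
    bij_betw \<beta> ((UNIV :: ('e + nat) set) \<times> out_arcs E v) (UNIV :: ('e + nat) set)" ..
  from choice[OF this] obtain \<beta> where \<beta>: "\<And>v. out_arcs E v \<noteq> {} \<Longrightarrow>
    bij_betw (\<beta> v) ((UNIV :: ('e + nat) set) \<times> out_arcs E v) (UNIV :: ('e + nat) set)" by blast
  define \<psi> where "\<psi> e y = \<beta> (tail E e) (y, e)" for e y
  have "bij_betw (\<lambda>(y, e). \<psi> e y) (UNIV \<times> out_arcs E v) UNIV" if "out_arcs E v \<noteq> {}" for v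
    using \<beta>[OF that] by (rule bij_betw_cong[THEN iffD1, rotated]) (auto simp: \<psi>_def)
  then show ?thesis by blast
qed

lemma gen_Vert_notin_I:
  assumes v: "v \<in> verts E"
  shows "gen (Vert v) \<notin> I"
proof
  assume vI: "gen (Vert v) \<in> I"
  obtain \<psi> :: "'e \<Rightarrow> 'e + nat \<Rightarrow> 'e + nat" where
    \<psi>: "\<And>v. out_arcs E v \<noteq> {} \<Longrightarrow> bij_betw (\<lambda>(y, e). \<psi> e y) (UNIV \<times> out_arcs E v) UNIV"
    using exists_branching by blast
  have \<psi>_inj: "e = f \<and> y = z" if "e \<in> arcs E" "f \<in> arcs E" "tail E e = tail E f" "\<psi> e y = \<psi> f z" for e f y z
  proof -
    have "out_arcs E (tail E e) \<noteq> {}" using that(1) by auto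
    from \<psi>[OF this] have "inj_on (\<lambda>(y, e). \<psi> e y) (UNIV \<times> out_arcs E (tail E e))"
      by (rule bij_betw_imp_inj_on)
    from inj_onD[OF this, of "(y, e)" "(z, f)"] show ?thesis using that by auto
  qed
  have \<psi>_surj: "\<exists>e\<in>out_arcs E v. \<exists>z. \<psi> e z = y" if "out_arcs E v \<noteq> {}" for v y
  proof -
    have "y \<in> (\<lambda>(y, e). \<psi> e y) ` (UNIV \<times> out_arcs E v)"
      using \<psi>[OF that] by (simp add: bij_betw_def)
    then show ?thesis by auto
  qed
  \<comment> \<open>Letters act by partial maps on pairs. \<open>Ghost e\<close> leads from the
    range of e to its source and encodes the second component by \<psi> e; \<open>Edge e\<close> is
    its partial inverse. Read from left to right, e^* e fixes the pairs at the range of e, and e e^*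
    fixes those pairs at its source whose second component lies in the image of \<psi> e.\<close>
  define act :: "('v, 'e) lpa_gen \<Rightarrow> 'v \<times> ('e + nat) \<Rightarrow> ('v \<times> ('e + nat)) option" where
    "act g s = (case g of Vert w \<Rightarrow> if fst s = w then Some s else None
      | Edge e \<Rightarrow> if fst s = tail E e \<and> (\<exists>z. \<psi> e z = snd s)
          then Some (head E e, THE z. \<psi> e z = snd s) else None
      | Ghost e \<Rightarrow> if fst s = head E e then Some (tail E e, \<psi> e (snd s)) else None)" for g s
  have act_Vert: "act (Vert w) (x, y) = (if x = w then Some (x, y) else None)" for w x y
    by (simp add: act_def)
  have act_Ghost: "act (Ghost e) (x, y) = (if x = head E e then Some (tail E e, \<psi> e y) else None)" for e x y
    by (simp add: act_def)
  have act_Edge: "act (Edge e) (tail E e, \<psi> e z) = Some (head E e, z)" if "e \<in> arcs E" for e z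
  proof -
    have "(THE z'. \<psi> e z' = \<psi> e z) = z" using \<psi>_inj[OF that that] by (intro the_equality) auto
    then show ?thesis by (auto simp: act_def)
  qed
  have act_Edge_None: "act (Edge e) (x, y) = None" if "x \<noteq> tail E e \<or> (\<forall>z. \<psi> e z \<noteq> y)" for e x y
    using that by (auto simp: act_def)
  define run where "run gs s = fold (\<lambda>g s. Option.bind s (act g)) gs (Some s)" for gs s
  have fold_None: "fold (\<lambda>g s. Option.bind s (act g)) gs None = None" for gs
    by (induction gs) simp_all
  have run_simps: "run [] s = Some s" "run (g # gs) s = (case act g s of None \<Rightarrow> None | Some s' \<Rightarrow> run gs s')"
    for g gs s
    by (simp_all add: run_def fold_None split: option.splits)
  have run_append: "run (gs @ hs) s = (case run gs s of None \<Rightarrow> None | Some s' \<Rightarrow> run hs s')" for gs hs s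
    by (induction gs arbitrary: s) (simp_all add: run_simps split: option.splits)
  define val where "val f t = (case t of None \<Rightarrow> 0 | Some s \<Rightarrow> f s)"
    for f :: "'v \<times> ('e + nat) \<Rightarrow> 'k" and t
  \<comment> \<open>\<open>ev p f\<close> is the function f acted on by p: a word runs first, then f
    is evaluated at the pair reached, with value 0 if the run breaks off. Products act by
    composition, so the polynomials acting as zero form an ideal.\<close>
  define ev where "ev p f s = (\<Sum>w\<in>Poly_Mapping.keys p. Poly_Mapping.lookup p w * val f (run (letters w) s))"
    for p f s
  have ev_super: "ev p f s = (\<Sum>w\<in>A. Poly_Mapping.lookup p w * val f (run (letters w) s))"
    if "finite A" "Poly_Mapping.keys p \<subseteq> A" for p f s A
    unfolding ev_def using that by (intro sum.mono_neutral_left) (auto simp: in_keys_iff)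
  have ev_add: "ev (p + q) f s = ev p f s + ev q f s" for p q f s
  proof -
    let ?A = "Poly_Mapping.keys p \<union> Poly_Mapping.keys q"
    have A: "finite ?A" by simp
    have k: "Poly_Mapping.keys (p + q) \<subseteq> ?A" by (rule keys_add)
    show ?thesis
      using ev_super[OF A k] ev_super[OF A, of p] ev_super[OF A, of q]
      by (simp add: lookup_add distrib_right sum.distrib)
  qed
  have ev_single: "ev (Poly_Mapping.single w k) f s = k * val f (run (letters w) s)" for w k f s
    using ev_super[of "{w}" "Poly_Mapping.single w k"] by (simp add: lookup_single)
  have ev_zero: "ev 0 f s = 0" for f s by (simp add: ev_def)
  have ev_diff: "ev (p - q) f s = ev p f s - ev q f s" for p q f s
    using ev_add[of "p - q" q] by (simp add: algebra_simps)
  have ev_sum: "ev (\<Sum>i\<in>A. h i) f s = (\<Sum>i\<in>A. ev (h i) f s)" for h :: "'e \<Rightarrow> _" and A f s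
    by (induction A rule: infinite_finite_induct) (simp_all add: ev_zero ev_add)
  have ev_single_mult: "ev (Poly_Mapping.single w k * p) f s =
      (case run (letters w) s of None \<Rightarrow> 0 | Some s' \<Rightarrow> k * ev p f s')" for w k p f s
  proof (induction p rule: poly_mapping_add_induct)
    case (single v l)
    then show ?case
      by (simp add: mult_single ev_single run_append val_def split: option.splits)
  qed (simp add: distrib_left ev_add split: option.splits)
  have ev_mult_single: "ev (p * Poly_Mapping.single w k) f s = ev p (\<lambda>s. k * val f (run (letters w) s)) s"
    for w k p f s
  proof (induction p rule: poly_mapping_add_induct)
    case (single v l)
    then show ?case
      by (simp add: mult_single ev_single run_append val_def split: option.splits)
  qed (simp add: distrib_right ev_add)
  let ?J = "{p \<in> carrier F. \<forall>f s. ev p f s = 0}"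
  have "ideal ?J F"
    by (rule word_idealI) (auto simp: ev_single_mult ev_mult_single ev_add F_add F_mult F_single
      zero_F ev_zero split: option.splits)
  moreover have "lpa_relations E \<subseteq> ?J"
  proof
    fix r :: "('v, 'e, 'k) lpa_free" assume r: "r \<in> lpa_relations E"
    have ev_gen: "ev (gen g) f s = val f (act g s)" for g f s
      by (simp add: gen_def ev_single run_simps split: option.splits)
    have ev_gen2: "ev (gen g * gen h) f s = val f (case act g s of None \<Rightarrow> None | Some s' \<Rightarrow> act h s')" for g h f s
      by (simp add: gen_mult_gen ev_single run_simps split: option.splits)
    have "ev r f (x, y) = 0" for f x y
      using r
    proof cases
      case (idem v)
      then show ?thesis by (simp add: ev_diff ev_gen ev_gen2 act_Vert)
    next
      case (orth v w)
      then show ?thesis by (simp add: ev_gen2 act_Vert val_def)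
    next
      case (source_edge e)
      show ?thesis
      proof (cases "\<exists>z. x = tail E e \<and> y = \<psi> e z")
        case True
        then obtain z where "x = tail E e" "y = \<psi> e z" by blast
        then show ?thesis using source_edge by (simp add: ev_diff ev_gen ev_gen2 act_Vert act_Edge)
      next
        case False
        then have "act (Edge e) (x, y) = None" by (intro act_Edge_None) auto
        then show ?thesis using source_edge
          by (cases "x = tail E e") (simp_all add: ev_diff ev_gen ev_gen2 act_Vert val_def)
      qed
    next
      case (edge_range e)
      show ?thesis
      proof (cases "\<exists>z. x = tail E e \<and> y = \<psi> e z")
        case True
        then obtain z where "x = tail E e" "y = \<psi> e z" by blast
        then show ?thesis using edge_range by (simp add: ev_diff ev_gen ev_gen2 act_Vert act_Edge)
      next
        case False
        then have "act (Edge e) (x, y) = None" by (intro act_Edge_None) auto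
        then show ?thesis using edge_range by (simp add: ev_diff ev_gen ev_gen2 act_Vert val_def)
      qed
    next
      case (range_ghost e)
      then show ?thesis by (simp add: ev_diff ev_gen ev_gen2 act_Vert act_Ghost)
    next
      case (ghost_source e)
      then show ?thesis by (simp add: ev_diff ev_gen ev_gen2 act_Vert act_Ghost)
    next
      case (ghost_edge e)
      then show ?thesis by (simp add: ev_diff ev_gen ev_gen2 act_Vert act_Ghost act_Edge)
    next
      case (ghost_edge_orth e e')
      have "act (Edge e') (tail E e, \<psi> e y) = None"
        using \<psi>_inj[of e e' y] ghost_edge_orth by (intro act_Edge_None) metis
      then show ?thesis using ghost_edge_orth by (simp add: ev_gen2 act_Ghost val_def)
    next
      case (regular v)
      have term0: "ev (gen (Edge e) * gen (Ghost e)) f (x, y) = (if x = v \<and> (\<exists>z. \<psi> e z = y) then f (x, y) else 0)"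
        if "e \<in> out_arcs E v" for e
      proof (cases "\<exists>z. x = tail E e \<and> y = \<psi> e z")
        case True
        then obtain z where "x = tail E e" "y = \<psi> e z" by blast
        then show ?thesis using that by (auto simp: ev_gen2 act_Edge act_Ghost val_def)
      next
        case False
        then have "act (Edge e) (x, y) = None" by (intro act_Edge_None) auto
        then show ?thesis using that False by (auto simp: ev_gen2 val_def)
      qed
      have "(\<Sum>e\<in>out_arcs E v. ev (gen (Edge e) * gen (Ghost e)) f (x, y)) = (if x = v then f (x, y) else 0)"
      proof -
        have "out_arcs E v \<noteq> {}" "finite (out_arcs E v)" using regular by (auto simp: regular_vertex_def)
        \<comment> \<open>The images of the \<psi> e for the edges e leaving v partition the second
          components, so exactly one e e^* fixes (v, y).\<close>
        from \<psi>_surj[OF this(1), of y] obtain e0 z where e0: "e0 \<in> out_arcs E v" "\<psi> e0 z = y" by blast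
        have "(\<exists>z. \<psi> e z = y) \<longleftrightarrow> e = e0" if "e \<in> out_arcs E v" for e
          using e0 \<psi>_inj[of e e0 _ z] that by auto
        then have "(\<Sum>e\<in>out_arcs E v. ev (gen (Edge e) * gen (Ghost e)) f (x, y)) =
            (\<Sum>e\<in>out_arcs E v. if e = e0 then (if x = v then f (x, y) else 0) else 0)"
          using term0 by (intro sum.cong refl) auto
        also have "\<dots> = (if x = v then f (x, y) else 0)"
          using e0(1) \<open>finite (out_arcs E v)\<close> by simp
        finally show ?thesis .
      qed
      then show ?thesis using regular by (simp add: ev_diff ev_sum ev_gen act_Vert val_def)
    qed
    then show "r \<in> ?J" using relations_subset r by auto
  qed
  ultimately have "I \<subseteq> ?J" by (rule I_minimal)
  then have "gen (Vert v) \<in> ?J" using vI by (rule subsetD)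
  \<comment> \<open>The vertex v fixes every pair over v, whatever the second component, so the
    constant function 1 keeps the value 1 there.\<close>
  then have "ev (gen (Vert v)) (\<lambda>_. 1) (v, Inr 0) = 0" by blast
  then show False by (simp add: gen_def ev_single run_simps act_Vert val_def)
qed

lemma cl_relation:
  assumes "p - q \<in> lpa_relations E" "p \<in> carrier F" "q \<in> carrier F"
  shows "cl p = cl q"
  using assms relation_in_I cl_eq_iff by blast

lemma cl_relation_zero: "p \<in> lpa_relations E \<Longrightarrow> p \<in> carrier F \<Longrightarrow> cl p = cl 0"
  by (rule cl_relation[of p 0]) (simp_all add: zero_F)

theorem leavitt_family_L:
  "leavitt_family L E (\<lambda>v. cl (gen (Vert v))) (\<lambda>e. cl (gen (Edge e))) (\<lambda>e. cl (gen (Ghost e))) hom_proj"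
proof -
  interpret A: nonunital_algebra L by (rule nonunital_algebra_L)
  note G = F_gen[OF gens(1)] F_gen[OF gens(2)] F_gen[OF gens(3)]
  note H = tail_in_verts head_in_verts
  show ?thesis
  proof unfold_locales
    fix v assume v: "v \<in> verts E"
    show "cl (gen (Vert v)) \<in> carrier L" using v by (simp add: clL aug_gen)
    show "cl (gen (Vert v)) \<noteq> \<zero>\<^bsub>L\<^esub>"
      using gen_Vert_notin_I[OF v] cl_eq_iff[OF G(1)[OF v] zero_F] by (simp add: L_simps(2))
    show "hom_proj d (cl (gen (Vert v))) = (if d = 0 then cl (gen (Vert v)) else \<zero>\<^bsub>L\<^esub>)" for d
      using v by (simp add: hom_proj_cl aug_gen L_simps(2))
        (simp add: gen_def hom_part_single deg_def)
    fix w assume w: "w \<in> verts E"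
    have "cl (gen (Vert v) * gen (Vert w)) = (if v = w then cl (gen (Vert v)) else cl 0)"
      using cl_relation[OF lpa_relations.idem[OF v] F_mult[OF G(1)[OF v] G(1)[OF v]] G(1)[OF v]]
        cl_relation_zero[OF lpa_relations.orth[OF v w] F_mult[OF G(1)[OF v] G(1)[OF w]]]
      by (cases "v = w") simp_all
    then show "cl (gen (Vert v)) \<otimes>\<^bsub>L\<^esub> cl (gen (Vert w)) = (if v = w then cl (gen (Vert v)) else \<zero>\<^bsub>L\<^esub>)"
      using v w by (simp add: L_simps(2,4) G)
  next
    fix v x d assume v: "v \<in> verts E" and "x \<in> carrier L"
    then obtain p where p: "p \<in> aug" "p \<in> carrier F" "x = cl p" using carrier_LE by metis
    have "hom_part d (gen (Vert v) * p) = gen (Vert v) * hom_part d p"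
      "hom_part d (p * gen (Vert v)) = hom_part d p * gen (Vert v)"
      unfolding gen_def hom_part_single_mult hom_part_mult_single by (simp_all add: deg_def)
    then show "hom_proj d (cl (gen (Vert v)) \<otimes>\<^bsub>L\<^esub> x) = cl (gen (Vert v)) \<otimes>\<^bsub>L\<^esub> hom_proj d x"
      "hom_proj d (x \<otimes>\<^bsub>L\<^esub> cl (gen (Vert v))) = hom_proj d x \<otimes>\<^bsub>L\<^esub> cl (gen (Vert v))"
      using p v by (simp_all add: L_simps(4) G hom_proj_cl aug_mult aug_gen hom_part_F)
  next
    fix e assume e: "e \<in> arcs E"
    note t = e tail_in_verts[OF e] head_in_verts[OF e]
    show "cl (gen (Edge e)) \<in> carrier L" "cl (gen (Ghost e)) \<in> carrier L"
      using e by (simp_all add: clL aug_gen)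
    show "cl (gen (Vert (tail E e))) \<otimes>\<^bsub>L\<^esub> cl (gen (Edge e)) = cl (gen (Edge e))"
      "cl (gen (Edge e)) \<otimes>\<^bsub>L\<^esub> cl (gen (Vert (head E e))) = cl (gen (Edge e))"
      "cl (gen (Vert (head E e))) \<otimes>\<^bsub>L\<^esub> cl (gen (Ghost e)) = cl (gen (Ghost e))"
      "cl (gen (Ghost e)) \<otimes>\<^bsub>L\<^esub> cl (gen (Vert (tail E e))) = cl (gen (Ghost e))"
      using t cl_relation[OF lpa_relations.source_edge[OF e] F_mult[OF G(1)[OF t(2)] G(2)[OF e]] G(2)[OF e]]
        cl_relation[OF lpa_relations.edge_range[OF e] F_mult[OF G(2)[OF e] G(1)[OF t(3)]] G(2)[OF e]]
        cl_relation[OF lpa_relations.range_ghost[OF e] F_mult[OF G(1)[OF t(3)] G(3)[OF e]] G(3)[OF e]]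
        cl_relation[OF lpa_relations.ghost_source[OF e] F_mult[OF G(3)[OF e] G(1)[OF t(2)]] G(3)[OF e]]
      by (simp_all add: L_simps(4) G)
    show "cl (gen (Ghost e)) \<otimes>\<^bsub>L\<^esub> cl (gen (Edge f)) = (if e = f then cl (gen (Vert (head E e))) else \<zero>\<^bsub>L\<^esub>)"
      if f: "f \<in> arcs E" for f
      using cl_relation[OF lpa_relations.ghost_edge[OF e] F_mult[OF G(3)[OF e] G(2)[OF e]] G(1)[OF t(3)]]
        cl_relation_zero[OF lpa_relations.ghost_edge_orth[OF e f] F_mult[OF G(3)[OF e] G(2)[OF f]]] e f
      by (cases "e = f") (simp_all add: L_simps(2,4) G)
    fix x d assume "x \<in> carrier L"
    then obtain p where p: "p \<in> aug" "p \<in> carrier F" "x = cl p" by (rule carrier_LE)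
    have "hom_part d (gen (Edge e) * p) = gen (Edge e) * hom_part (d - 1) p"
      "hom_part d (p * gen (Edge e)) = hom_part (d - 1) p * gen (Edge e)"
      unfolding gen_def hom_part_single_mult hom_part_mult_single by (simp_all add: deg_def)
    then show "hom_proj d (cl (gen (Edge e)) \<otimes>\<^bsub>L\<^esub> x) = cl (gen (Edge e)) \<otimes>\<^bsub>L\<^esub> hom_proj (d - 1) x"
      "hom_proj d (x \<otimes>\<^bsub>L\<^esub> cl (gen (Edge e))) = hom_proj (d - 1) x \<otimes>\<^bsub>L\<^esub> cl (gen (Edge e))"
      using p e by (simp_all add: L_simps(4) G hom_proj_cl aug_mult aug_gen hom_part_F)
  next
    fix v assume reg: "regular_vertex E v"
    then have v: "v \<in> verts E" and fin: "finite (out_arcs E v)" by (auto simp: regular_vertex_def)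
    have finsum: "(\<Oplus>\<^bsub>L\<^esub>e\<in>A. cl (gen (Edge e)) \<otimes>\<^bsub>L\<^esub> cl (gen (Ghost e))) = cl (\<Sum>e\<in>A. gen (Edge e) * gen (Ghost e))"
      if "finite A" "A \<subseteq> arcs E" for A
      using that
    proof (induction A rule: finite_induct)
      case empty
      then show ?case by (simp add: L_simps(2))
    next
      case (insert e A)
      have "(\<lambda>e. cl (gen (Edge e)) \<otimes>\<^bsub>L\<^esub> cl (gen (Ghost e))) \<in> A \<rightarrow> carrier L"
        using insert.prems by (auto intro!: A.m_closed clL aug_gen)
      then show ?case
        using insert by (simp add: L_simps(3,4) G F_mult F_sum subset_iff clL aug_mult aug_gen)
    qed
    have "(\<Oplus>\<^bsub>L\<^esub>e\<in>out_arcs E v. cl (gen (Edge e)) \<otimes>\<^bsub>L\<^esub> cl (gen (Ghost e))) =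
        cl (\<Sum>e\<in>out_arcs E v. gen (Edge e) * gen (Ghost e))" by (intro finsum fin) auto
    then show "cl (gen (Vert v)) = (\<Oplus>\<^bsub>L\<^esub>e\<in>out_arcs E v. cl (gen (Edge e)) \<otimes>\<^bsub>L\<^esub> cl (gen (Ghost e)))"
    proof -
      have "(\<Sum>e\<in>out_arcs E v. gen (Edge e) * gen (Ghost e)) \<in> carrier F"
        by (intro F_sum F_mult G) simp_all
      from cl_relation[OF lpa_relations.regular[OF reg] G(1)[OF v] this] show ?thesis
        using \<open>(\<Oplus>\<^bsub>L\<^esub>e\<in>out_arcs E v. cl (gen (Edge e)) \<otimes>\<^bsub>L\<^esub> cl (gen (Ghost e))) =
          cl (\<Sum>e\<in>out_arcs E v. gen (Edge e) * gen (Ghost e))\<close> by (simp only:)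
    qed
  next
    fix S assume S: "\<zero>\<^bsub>L\<^esub> \<in> S" "\<And>v. v \<in> verts E \<Longrightarrow> cl (gen (Vert v)) \<in> S"
      "\<And>e. e \<in> arcs E \<Longrightarrow> cl (gen (Edge e)) \<in> S" "\<And>e. e \<in> arcs E \<Longrightarrow> cl (gen (Ghost e)) \<in> S"
      and S_add: "\<And>x y. x \<in> S \<Longrightarrow> y \<in> S \<Longrightarrow> x \<oplus>\<^bsub>L\<^esub> y \<in> S"
      and S_sm: "\<And>k x. x \<in> S \<Longrightarrow> k \<odot>\<^bsub>L\<^esub> x \<in> S"
      and S_mult: "\<And>v x. v \<in> verts E \<Longrightarrow> x \<in> S \<Longrightarrow> cl (gen (Vert v)) \<otimes>\<^bsub>L\<^esub> x \<in> S"
      "\<And>e x. e \<in> arcs E \<Longrightarrow> x \<in> S \<Longrightarrow> cl (gen (Edge e)) \<otimes>\<^bsub>L\<^esub> x \<in> S"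
      "\<And>e x. e \<in> arcs E \<Longrightarrow> x \<in> S \<Longrightarrow> cl (gen (Ghost e)) \<otimes>\<^bsub>L\<^esub> x \<in> S"
    have gS: "cl (gen g) \<in> S" and gmS: "\<And>x. x \<in> S \<Longrightarrow> cl (gen g) \<otimes>\<^bsub>L\<^esub> x \<in> S" if "g \<in> lpa_gens E" for g
      using that S S_mult by (auto simp: lpa_gens_def)
    \<comment> \<open>A nonempty word arises from its last letter by left multiplications, which
      match the closure properties of S.\<close>
    have word: "cl (Poly_Mapping.single (Word gs) 1) \<in> S" if "set gs \<subseteq> lpa_gens E" "gs \<noteq> []" for gs
      using that
    proof (induction gs)
      case (Cons g gs)
      show ?case
      proof (cases "gs = []")
        case True
        then show ?thesis using gS[of g] Cons.prems by (simp add: gen_def)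
      next
        case False
        then have "cl (gen g) \<otimes>\<^bsub>L\<^esub> cl (Poly_Mapping.single (Word gs) 1) \<in> S"
          using Cons gmS by simp
        moreover have "gen g * Poly_Mapping.single (Word gs) 1 = Poly_Mapping.single (Word (g # gs)) (1 :: 'k)"
          by (simp add: gen_def mult_single plus_free_word_def)
        ultimately show ?thesis using Cons.prems by (simp add: L_simps(4) F_gen F_single)
      qed
    qed simp
    have single: "cl (Poly_Mapping.single w k) \<in> S" if "set (letters w) \<subseteq> lpa_gens E" "w \<noteq> 0" for w k
    proof -
      have ne: "letters w \<noteq> []" using that(2) by (cases w) (simp add: zero_free_word_def)
      have "k \<odot>\<^bsub>L\<^esub> cl (Poly_Mapping.single (Word (letters w)) 1) \<in> S" by (rule S_sm[OF word[OF that(1) ne]])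
      moreover have "const k * Poly_Mapping.single w 1 = Poly_Mapping.single w k"
        by (simp add: const_def mult_single)
      ultimately show ?thesis using that(1) by (simp add: L_simps(5) F_single)
    qed
    show "carrier L \<subseteq> S"
    proof
      fix x assume "x \<in> carrier L"
      then obtain p where p: "p \<in> aug" "p \<in> carrier F" "x = cl p" by (rule carrier_LE)
      let ?f = "\<lambda>w. Poly_Mapping.single w (Poly_Mapping.lookup p w)"
      have "cl (\<Sum>w\<in>A. ?f w) \<in> S" if "finite A" "A \<subseteq> Poly_Mapping.keys p" for A
        using that
      proof (induction A rule: finite_induct)
        case empty
        then show ?case using S(1) by (simp add: L_simps(2))
      next
        case (insert w A)
        \<comment> \<open>The empty word does not occur, because elements of \<open>aug\<close> have
          no constant term.\<close>
        have wk: "set (letters w') \<subseteq> lpa_gens E" "w' \<noteq> 0" if "w' \<in> Poly_Mapping.keys p" for w'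
          using that p(1,2) by (auto simp: carrier_F aug_def in_keys_iff)
        have "cl (?f w) \<oplus>\<^bsub>L\<^esub> cl (\<Sum>w\<in>A. ?f w) \<in> S"
          using insert wk by (intro S_add single) auto
        moreover have "(\<Sum>w\<in>A. ?f w) \<in> carrier F" "?f w \<in> carrier F"
          using insert.prems wk by (auto intro!: F_sum F_single)
        ultimately show ?case using insert by (simp add: L_simps(3))
      qed
      from this[OF finite_keys order_refl] show "x \<in> S"
        using poly_mapping_decompose[of p] p(3) by simp
    qed
  next
    fix x d assume "x \<in> carrier L"
    then obtain p where p: "p \<in> aug" "p \<in> carrier F" "x = cl p" by (rule carrier_LE)
    show "hom_proj d x \<in> carrier L" using p by (simp add: hom_proj_cl clL hom_part_aug)
    have "hom_part d p = 0" if "d \<notin> deg ` Poly_Mapping.keys p" for d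
      using that by (intro poly_mapping_eqI) (auto simp: lookup_hom_part in_keys_iff)
    then have "{d. hom_proj d x \<noteq> \<zero>\<^bsub>L\<^esub>} \<subseteq> deg ` Poly_Mapping.keys p"
      using p by (auto simp: hom_proj_cl L_simps(2))
    then show "finite {d. hom_proj d x \<noteq> \<zero>\<^bsub>L\<^esub>}" by (rule finite_subset) simp
    show "hom_proj d (x \<oplus>\<^bsub>L\<^esub> y) = hom_proj d x \<oplus>\<^bsub>L\<^esub> hom_proj d y" if "y \<in> carrier L" for y
    proof -
      from that obtain q where q: "q \<in> aug" "q \<in> carrier F" "y = cl q" by (rule carrier_LE)
      then show ?thesis using p by (simp add: L_simps(3) hom_proj_cl aug_add hom_part_add hom_part_F)
    qed
  next
    fix x assume "x \<in> carrier L" and z: "\<And>d. hom_proj d x = \<zero>\<^bsub>L\<^esub>"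
    then obtain p where p: "p \<in> aug" "p \<in> carrier F" "x = cl p" using carrier_LE by metis
    have hI: "hom_part d p \<in> I" for d
      using z[of d] p cl_eq_iff[OF hom_part_F[OF p(2)] zero_F] by (simp add: hom_proj_cl L_simps(2))
    \<comment> \<open>A polynomial is the sum of its finitely many components, so it lies in I as
      soon as all of them do.\<close>
    have "(\<Sum>d\<in>A. hom_part d p) \<in> I" if "finite A" for A
      using that by (induction A rule: finite_induct) (simp_all add: I_zero I_add hI)
    then have "(\<Sum>d\<in>deg ` Poly_Mapping.keys p. hom_part d p) \<in> I" by simp
    also have "(\<Sum>d\<in>deg ` Poly_Mapping.keys p. hom_part d p) = p"
      by (rule poly_mapping_eqI) (auto simp: lookup_sum lookup_hom_part in_keys_iff image_iff)
    finally show "x = \<zero>\<^bsub>L\<^esub>" using cl_eq_iff[OF p(2) zero_F] p(3) by (simp add: L_simps(2))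
  qed
qed

end

theorem theorem4p6:
  fixes E :: "('v, 'e) pre_digraph"
    and L :: "('k::field, ('v, 'e, 'k) lpa_free set) module"
    and A :: "(('v, 'e, 'k) lpa_free set \<Rightarrow> ('v, 'e, 'k) lpa_free set) ring"
  assumes "wf_digraph E"
    and "L = leavitt_path_algebra TYPE('k) E"
    and "A = End_ring L (right_regular L)"
  shows
    "(left_self_injective TYPE('t) A \<longleftrightarrow>
        semisimple_module L (right_regular L) \<and>
        (\<forall>S. simple_submodule L (right_regular L) S \<longrightarrow>
          artinian_ring (L\<lparr>carrier := homogeneous_component L (right_regular L) S\<rparr>))) \<and>
     (left_self_injective TYPE('t) A \<longleftrightarrow> direct_sum_of_matrix_algebras L) \<and>
     (left_self_injective TYPE('t) A \<longleftrightarrow>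
        row_finite E \<and> column_finite E \<and> acyclic_graph E \<and>
        (\<nexists>p. left_infinite_path E p) \<and> (\<nexists>p. right_infinite_path E p))"
proof -
  interpret P: lpa_presentation E "TYPE('k)"
    using \<open>wf_digraph E\<close> by (simp add: lpa_presentation_def)
  have L: "L = P.L" using assms(2) by (simp add: P.L_def)
  interpret leavitt_family L E "\<lambda>v. P.cl (gen (Vert v))" "\<lambda>e. P.cl (gen (Edge e))"
    "\<lambda>e. P.cl (gen (Ghost e))" P.hom_proj
    unfolding L by (rule P.leavitt_family_L)
  let ?ss = "semisimple_module L (right_regular L) \<and>
    (\<forall>S. simple_submodule L (right_regular L) S \<longrightarrow>
      artinian_ring (L\<lparr>carrier := homogeneous_component L (right_regular L) S\<rparr>))"
  let ?graph = "row_finite E \<and> column_finite E \<and> acyclic_graph E \<and>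
    (\<nexists>p. left_infinite_path E p) \<and> (\<nexists>p. right_infinite_path E p)"
  have graph: ?graph if Q: orthogonal_solvable corner_solvable
    using row_finite[OF Q(1)] column_finite[OF Q(1)] acyclic[OF Q(2)]
      no_left_infinite_path[OF Q(1) acyclic[OF Q(2)]] no_right_infinite_path[OF Q(1) acyclic[OF Q(2)]]
    by blast
  have 1: ?graph if "left_self_injective TYPE('t) A"
    by (rule graph[OF self_injective_imp_orthogonal_solvable[OF that[unfolded assms(3)]]
      self_injective_imp_corner_solvable[OF that[unfolded assms(3)]]])
  have 2: ?graph if ss: ?ss
    by (rule graph[OF artinian_semisimple_imp_orthogonal_solvable[OF ss[folded artinian_semisimple_def]]
      semisimple_imp_corner_solvable[OF conjunct1[OF ss]]])
  have 3: "direct_sum_of_matrix_algebras L" if g: ?graph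
  proof -
    have "\<exists>(P :: ('e list \<times> 'v) set) b c.
        block_coordinates L P (b :: _ \<Rightarrow> ('v, 'e, 'k) lpa_free set) c"
      by (rule graph_imp_block_coordinates) (use g in blast)+
    then show ?thesis by (elim exE) (rule block_coordinates_imp_direct_sum)
  qed
  have 4: "left_self_injective TYPE('t) A \<and> ?ss" if "direct_sum_of_matrix_algebras L"
  proof -
    from direct_sum_imp_block_coordinates[OF that]
    obtain P :: "(('v, 'e, 'k) lpa_free set \<times> nat) set" and c where bc: "block_coordinates L P fst c"
      by blast
    show ?thesis
      unfolding assms(3) artinian_semisimple_def[symmetric]
      by (intro conjI block_coordinates.left_self_injective_End_right[OF bc]
        block_coordinates.artinian_semisimple[OF bc])
  qed
  \<comment> \<open>The implications close up: self-injectivity (a) and semisimplicity with artinian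
    components (s) each give the graph condition (g), this gives the direct sum (d), and d returns
    both a and s.\<close>
  have "(a \<longleftrightarrow> s) \<and> (a \<longleftrightarrow> d) \<and> (a \<longleftrightarrow> g)"
    if "a \<Longrightarrow> g" "s \<Longrightarrow> g" "g \<Longrightarrow> d" "d \<Longrightarrow> a \<and> s" for a s d g
    using that by blast
  from this[OF 1 2 3 4] show ?thesis .
qed

end
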